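(* Let $d\ge1$, $a_1,\dots,a_d>0$, and let $H$ be the Hamiltonian on the $d$-dimensional hyperrectangular lattice graph with edge lengths $a_1,\dots,a_d$ and $\delta$ couplings of strength $\alpha>0$ at all vertices. Then: (1) every spectral gap of $H$ has its lower endpoint equal to $\left(\frac{m\pi}{a_j}\right)^2$ for some $j\in\{1,\dots,d\}$ and some $m\in\mathbb{N}$; (2) for $\ell\in\{1,\dots,d\}$ and $m\in\mathbb{N}$, there is a spectral gap with lower endpoint $\left(\frac{m\pi}{a_\ell}\right)^2$ if and only if $$\frac{2m\pi}{a_{\ell}}\sum_{j=1}^d\tan\left(\frac{\pi}{2}\left(m\frac{a_j}{a_{\ell}}-\left\lfloor m\frac{a_j}{a_{\ell}}\right\rfloor\right)\right)<\alpha.$$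
   Context: The lattice graph $\Gamma$ has vertex set $\{(n_1a_1,\dots,n_da_d): n_i\in\mathbb{Z}\}\subset\mathbb{R}^d$, with an edge (segment of length $a_j$) between two vertices iff they differ by $a_je_j$ for some $j$. $H$ is the self-adjoint operator on $L^2(\Gamma)$ acting as $\psi\mapsto-\psi''$ on each edge, with domain consisting of functions $H^2$ on each edge satisfying at every vertex $v$: $\psi$ is continuous at $v$, and the sum over the $2d$ incident edges of the derivatives at $v$ taken in the direction away from $v$ equals $\alpha\psi(v)$. A spectral gap is an open interval $(E_1,E_2)$ with $E_1<E_2$, $E_1,E_2\in\sigma(H)$ and $(E_1,E_2)\cap\sigma(H)=\emptyset$. $\lfloor\cdot\rfloor$ is the floor function, $\mathbb{N}=\{1,2,\dots\}$. *)

theory Defs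
  imports "HOL-Analysis.Analysis"
begin

(* The dimension d is the cardinality of the finite index type 'd (d >= 1 automatically).
   Vertices of the lattice are indexed by n :: 'd => int (position (n_i a_i)_i).
   Edge (n, j) is the segment from vertex n to vertex n + e_j, of length a j,
   parametrised by t in [0, a j] with t = 0 at vertex n.
   A function on the graph is psi :: (('d => int) * 'd) => real => complex. *)

definition unit_step :: "'d \<Rightarrow> ('d \<Rightarrow> int)" where
  "unit_step j = (\<lambda>i. if i = j then 1 else 0)"

definition edge_L2_sq :: "('d \<Rightarrow> real) \<Rightarrow> ((('d \<Rightarrow> int) \<times> 'd) \<Rightarrow> real \<Rightarrow> complex)
    \<Rightarrow> (('d \<Rightarrow> int) \<times> 'd) \<Rightarrow> real" where
  "edge_L2_sq a \<psi> e = integral {0..a (snd e)} (\<lambda>t. (norm (\<psi> e t))\<^sup>2)"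

definition in_L2 :: "('d \<Rightarrow> real) \<Rightarrow> ((('d \<Rightarrow> int) \<times> 'd) \<Rightarrow> real \<Rightarrow> complex) \<Rightarrow> bool" where
  "in_L2 a \<psi> \<longleftrightarrow>
     (\<forall>e. \<psi> e measurable_on {0..a (snd e)} \<and>
          (\<lambda>t. (norm (\<psi> e t))\<^sup>2) integrable_on {0..a (snd e)}) \<and>
     (edge_L2_sq a \<psi>) summable_on UNIV"

definition L2_norm :: "('d \<Rightarrow> real) \<Rightarrow> ((('d \<Rightarrow> int) \<times> 'd) \<Rightarrow> real \<Rightarrow> complex) \<Rightarrow> real" where
  "L2_norm a \<psi> = sqrt (infsum (edge_L2_sq a \<psi>) UNIV)"

(* lattice_H a \<alpha> \<psi> g : \<psi> is in the domain of H and H \<psi> = g (a.e. on every edge).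
   dpsi is the edgewise derivative psi'; psi' is absolutely continuous with psi'' = -g,
   psi is continuous at each vertex, and the sum of outgoing derivatives equals \<alpha> psi(v). *)
definition lattice_H :: "('d \<Rightarrow> real) \<Rightarrow> real \<Rightarrow> ((('d \<Rightarrow> int) \<times> 'd) \<Rightarrow> real \<Rightarrow> complex)
    \<Rightarrow> ((('d \<Rightarrow> int) \<times> 'd) \<Rightarrow> real \<Rightarrow> complex) \<Rightarrow> bool" where
  "lattice_H a \<alpha> \<psi> g \<longleftrightarrow>
     in_L2 a \<psi> \<and> in_L2 a g \<and>
     (\<exists>d\<psi>.
        (\<forall>e. g e integrable_on {0..a (snd e)} \<and>
             (\<forall>t\<in>{0..a (snd e)}.
                 (\<psi> e has_vector_derivative d\<psi> e t) (at t within {0..a (snd e)}) \<and>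
                 d\<psi> e t = d\<psi> e 0 - integral {0..t} (g e))) \<and>
        (\<forall>n. \<exists>c. (\<forall>j. \<psi> (n, j) 0 = c \<and> \<psi> (n - unit_step j, j) (a j) = c) \<and>
                 (\<Sum>j\<in>UNIV. d\<psi> (n, j) 0 - d\<psi> (n - unit_step j, j) (a j)) = complex_of_real \<alpha> * c))"

definition lattice_resolvent :: "('d \<Rightarrow> real) \<Rightarrow> real \<Rightarrow> real \<Rightarrow> bool" where
  "lattice_resolvent a \<alpha> E \<longleftrightarrow>
     (\<forall>\<psi>. lattice_H a \<alpha> \<psi> (\<lambda>e t. complex_of_real E * \<psi> e t) \<longrightarrow>
           (\<forall>e. \<forall>t\<in>{0..a (snd e)}. \<psi> e t = 0)) \<and>
     (\<exists>C. \<forall>f. in_L2 a f \<longrightarrow>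
        (\<exists>\<psi>. lattice_H a \<alpha> \<psi> (\<lambda>e t. f e t + complex_of_real E * \<psi> e t) \<and>
              L2_norm a \<psi> \<le> C * L2_norm a f))"

(* spectrum of the self-adjoint H (a subset of the reals) *)
definition lattice_spectrum :: "('d \<Rightarrow> real) \<Rightarrow> real \<Rightarrow> real set" where
  "lattice_spectrum a \<alpha> = {E. \<not> lattice_resolvent a \<alpha> E}"

definition spectral_gap :: "real set \<Rightarrow> real \<Rightarrow> real \<Rightarrow> bool" where
  "spectral_gap S E1 E2 \<longleftrightarrow> E1 < E2 \<and> E1 \<in> S \<and> E2 \<in> S \<and> {E1<..<E2} \<inter> S = {}"

end

theory Submission
  imports Defs
begin

text \<open>
On an edge of length \<open>b\<close> the equation \<open>-\<psi>'' = E \<psi> + f\<close> has a unique solution with given boundary values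
unless \<open>E\<close> is a Dirichlet eigenvalue of the edge. Away from the Dirichlet energies the operator
\<open>H - E\<close> therefore reduces to a discrete Laplacian with diagonal
\<open>\<alpha> + \<Sum>\<^sub>j 2 C\<^sub>j / S\<^sub>j\<close> and hopping weights \<open>1 / S\<^sub>j\<close>, where \<open>C\<^sub>j, S\<^sub>j\<close> are the values at \<open>a\<^sub>j\<close> of the cosine-like
and sine-like solutions. If the diagonal dominates, a Neumann series inverts it; otherwise some real
quasimomentum satisfies the dispersion relation and exponentially damped Bloch waves are approximate
eigenfunctions. For \<open>E = k\<^sup>2\<close> the dominance condition reads \<open>F k < \<alpha>\<close>, where \<open>F\<close> is the weighted sum of
tangents in the statement. Between consecutive Dirichlet momenta \<open>F\<close> is strictly
increasing and tends to \<open>\<infinity>\<close> at the right end, so that a gap can only start at a Dirichlet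
momentum, and does so exactly if \<open>F\<close> is smaller than \<open>\<alpha>\<close> there.
\<close>

section \<open>Square summable functions on the lattice\<close>

text \<open>Two obstacles shape the argument. For a right-hand side that is only square integrable
  the second derivative exists merely in the integrated sense of \<open>lattice_H\<close>, so
  variation of constants rests on integration by parts for indefinite integrals. The two criteria
  are complementary for E > 0. With x_j the cosine of a real quasimomentum, the dispersion sum of 2
  (x_j - C_j) / S_j is 0 at x = C and has maximum F at x_j = sgn S_j. So every \<alpha> in (0, F] is
  attained, while \<alpha> > F is precisely diagonal dominance. The tangents come from (1 - cos y) /
  sin y = tan (y / 2), where y is the remainder of k a_j modulo pi. The floor makes F continuous
  from the right, so its value at a Dirichlet momentum decides what happens just above it.\<close>

definition l2_bounded :: "('x \<Rightarrow> 'b::real_normed_vector) \<Rightarrow> real \<Rightarrow> bool" where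
  "l2_bounded u M \<longleftrightarrow> (\<forall>F. finite F \<longrightarrow> L2_set (\<lambda>x. norm (u x)) F \<le> M)"

lemma l2_boundedD: "l2_bounded u M \<Longrightarrow> finite F \<Longrightarrow> L2_set (\<lambda>x. norm (u x)) F \<le> M"
  by (simp add: l2_bounded_def)

lemma l2_bounded_nonneg: "l2_bounded u M \<Longrightarrow> 0 \<le> M"
  using l2_boundedD[of u M "{}"] by simp

lemma l2_bounded_zero: "0 \<le> M \<Longrightarrow> l2_bounded (\<lambda>x. 0) M"
  by (simp add: l2_bounded_def L2_set_0')

lemma l2_bounded_mono:
  assumes "l2_bounded v M" "\<And>x. norm (u x) \<le> norm (v x)"
  shows "l2_bounded u M"
  unfolding l2_bounded_def
proof (intro allI impI)
  fix F :: "'a set" assume "finite F"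
  have "L2_set (\<lambda>x. norm (u x)) F \<le> L2_set (\<lambda>x. norm (v x)) F"
    by (rule L2_set_mono) (use assms in auto)
  also have "\<dots> \<le> M" by (rule l2_boundedD) fact+
  finally show "L2_set (\<lambda>x. norm (u x)) F \<le> M" .
qed

lemma l2_bounded_add:
  assumes "l2_bounded u M" "l2_bounded v N"
  shows "l2_bounded (\<lambda>x. u x + v x) (M + N)"
  unfolding l2_bounded_def
proof (intro allI impI)
  fix F :: "'a set" assume F: "finite F"
  have "L2_set (\<lambda>x. norm (u x + v x)) F \<le> L2_set (\<lambda>x. norm (u x) + norm (v x)) F"
    by (rule L2_set_mono) (auto intro: norm_triangle_ineq)
  also have "\<dots> \<le> L2_set (\<lambda>x. norm (u x)) F + L2_set (\<lambda>x. norm (v x)) F"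
    by (rule L2_set_triangle_ineq)
  also have "\<dots> \<le> M + N"
    using assms F by (intro add_mono l2_boundedD)
  finally show "L2_set (\<lambda>x. norm (u x + v x)) F \<le> M + N" .
qed

lemma l2_bounded_scale:
  fixes u :: "'x \<Rightarrow> 'b::real_normed_algebra_1"
  assumes "l2_bounded u M" "norm w \<le> W"
  shows "l2_bounded (\<lambda>x. w * u x) (W * M)"
  unfolding l2_bounded_def
proof (intro allI impI)
  fix F :: "'x set" assume F: "finite F"
  have "L2_set (\<lambda>x. norm (w * u x)) F \<le> L2_set (\<lambda>x. norm w * norm (u x)) F"
    by (rule L2_set_mono) (auto intro: norm_mult_ineq)
  also have "\<dots> = norm w * L2_set (\<lambda>x. norm (u x)) F"
    by (simp add: L2_set_right_distrib)
  also have "\<dots> \<le> W * M"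
    using assms F l2_boundedD[OF assms(1) F] by (intro mult_mono) (auto intro: order_trans[OF norm_ge_zero])
  finally show "L2_set (\<lambda>x. norm (w * u x)) F \<le> W * M" .
qed

lemma l2_bounded_sum:
  assumes "finite J" "\<And>j. j \<in> J \<Longrightarrow> l2_bounded (u j) (M j)"
  shows "l2_bounded (\<lambda>x. \<Sum>j\<in>J. u j x) (\<Sum>j\<in>J. M j)"
  using assms by (induction J) (auto intro!: l2_bounded_add l2_bounded_zero)

lemma l2_bounded_reindex:
  fixes h :: "'y \<Rightarrow> 'x"
  assumes "l2_bounded u M" "inj h"
  shows "l2_bounded (\<lambda>x. u (h x)) M"
  unfolding l2_bounded_def
proof (intro allI impI)
  fix F :: "'y set" assume F: "finite F"
  have "L2_set (\<lambda>x. norm (u x)) (h ` F) \<le> M"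
    using F by (intro l2_boundedD[OF assms(1)]) auto
  then show "L2_set (\<lambda>x. norm (u (h x))) F \<le> M"
    using assms(2) by (simp add: L2_set_def sum.reindex inj_on_subset)
qed

lemma l2_bounded_pointwise: "l2_bounded u M \<Longrightarrow> norm (u x) \<le> M"
  using l2_boundedD[of u M "{x}"] by simp

text \<open>Each direction adds at most \<open>M\<^sup>2\<close> to the sum of squares. This would
  give the square root of \<open>CARD('d)\<close>; the larger factor \<open>CARD('d)\<close> keeps
  later constants free of roots.\<close>

lemma l2_bounded_prod:
  fixes u :: "'x \<times> 'd::finite \<Rightarrow> 'b::real_normed_vector"
  assumes "\<And>j. l2_bounded (\<lambda>x. u (x, j)) M"
  shows "l2_bounded u (real CARD('d) * M)"
  unfolding l2_bounded_def
proof (intro allI impI)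
  fix G :: "('x \<times> 'd) set" assume G: "finite G"
  have M: "0 \<le> M" using assms l2_bounded_nonneg by blast
  have "(\<Sum>e\<in>G. (norm (u e))\<^sup>2) \<le> (\<Sum>e\<in>fst ` G \<times> UNIV. (norm (u e))\<^sup>2)"
    using G by (intro sum_mono2) force+
  also have "\<dots> = (\<Sum>x\<in>fst ` G. \<Sum>j\<in>UNIV. (norm (u (x, j)))\<^sup>2)"
    by (simp add: sum.cartesian_product)
  also have "\<dots> = (\<Sum>j\<in>UNIV. \<Sum>x\<in>fst ` G. (norm (u (x, j)))\<^sup>2)"
    by (rule sum.swap)
  also have "\<dots> \<le> (\<Sum>j\<in>(UNIV::'d set). M\<^sup>2)"
  proof (rule sum_mono)
    fix j
    have "L2_set (\<lambda>x. norm (u (x, j))) (fst ` G) \<le> M"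
      using G by (intro l2_boundedD[OF assms]) auto
    then show "(\<Sum>x\<in>fst ` G. (norm (u (x, j)))\<^sup>2) \<le> M\<^sup>2"
      using M by (simp add: L2_set_def real_sqrt_le_iff' sum_nonneg sqrt_le_D)
  qed
  also have "\<dots> \<le> (real CARD('d) * M)\<^sup>2"
  proof -
    have "real CARD('d) * M\<^sup>2 \<le> (real CARD('d))\<^sup>2 * M\<^sup>2"
      by (intro mult_right_mono) (auto simp: power2_eq_square)
    then show ?thesis by (simp add: power_mult_distrib)
  qed
  finally show "L2_set (\<lambda>x. norm (u x)) G \<le> real CARD('d) * M"
    using M by (simp add: L2_set_def real_le_lsqrt sum_nonneg)
qed

text \<open>On a finite set the norm depends continuously on the values, so the bound survives
  pointwise limits (Fatou for counting measure). This is the benefit of phrasing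
  \<open>l2_bounded\<close> by finite sets.\<close>

lemma l2_bounded_limit:
  assumes "\<And>p. l2_bounded (c p) M" "\<And>x. (\<lambda>p. c p x) \<longlonglongrightarrow> d x"
  shows "l2_bounded d M"
  unfolding l2_bounded_def
proof (intro allI impI)
  fix F :: "'a set" assume F: "finite F"
  have "(\<lambda>p. L2_set (\<lambda>x. norm (c p x)) F) \<longlonglongrightarrow> L2_set (\<lambda>x. norm (d x)) F"
    unfolding L2_set_def by (intro tendsto_intros assms)
  then show "L2_set (\<lambda>x. norm (d x)) F \<le> M"
    by (rule LIMSEQ_le_const2) (use assms F in \<open>auto intro: l2_boundedD\<close>)
qed

section \<open>The discrete Laplacian on the lattice: solvability and uniqueness\<close>

text \<open>The neighbour in positive direction. Addition of the unit vector is written as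
  subtraction of its negative, so that both neighbours use the function difference occurring in
  \<open>lattice_H\<close>.\<close>

abbreviation shift_up :: "'d \<Rightarrow> ('d \<Rightarrow> int) \<Rightarrow> 'd \<Rightarrow> int" where
  "shift_up j n \<equiv> n - (\<lambda>i. - unit_step j i)"

lemma shift_up_down [simp]:
  "shift_up j n - unit_step j = n" "shift_up j (n - unit_step j) = n"
  by (auto simp: fun_eq_iff)

lemma inj_shift: "inj (\<lambda>n. shift_up j n)" "inj (\<lambda>n. n - unit_step j)"
  by (auto simp: inj_def fun_eq_iff)

text \<open>The solution is the limit of the Jacobi iteration; only finite partial sums of squares are
  estimated, so no completeness of the space of square summable functions is needed.\<close>
lemma discrete_resolvent:
  fixes w :: "'d::finite \<Rightarrow> real" and r :: "('d \<Rightarrow> int) \<Rightarrow> complex"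
  assumes dom: "(\<Sum>j\<in>UNIV. 2 * \<bar>w j\<bar>) < \<beta>" and r: "l2_bounded r M"
  shows "\<exists>c. l2_bounded c (M / (\<beta> - (\<Sum>j\<in>UNIV. 2 * \<bar>w j\<bar>))) \<and>
    (\<forall>n. of_real \<beta> * c n = r n + (\<Sum>j\<in>UNIV. of_real (w j) * (c (shift_up j n) + c (n - unit_step j))))"
proof -
  define \<kappa> where "\<kappa> = (\<Sum>j\<in>UNIV. 2 * \<bar>w j\<bar>)"
  have \<kappa>: "0 \<le> \<kappa>" "\<kappa> < \<beta>" using dom by (auto simp: \<kappa>_def intro: sum_nonneg)
  have M: "0 \<le> M" using r by (rule l2_bounded_nonneg)
  define T :: "(('d \<Rightarrow> int) \<Rightarrow> complex) \<Rightarrow> ('d \<Rightarrow> int) \<Rightarrow> complex" where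
    "T c n = (\<Sum>j\<in>UNIV. of_real (w j) * (c (shift_up j n) + c (n - unit_step j)))" for c n
  have T: "l2_bounded (T c) (\<kappa> * N)" if c: "l2_bounded c N" for c N
  proof -
    have "l2_bounded (T c) (\<Sum>j\<in>UNIV. \<bar>w j\<bar> * (N + N))"
      unfolding T_def
      by (intro l2_bounded_sum l2_bounded_scale l2_bounded_add)
        (auto intro: l2_bounded_reindex[OF c inj_shift(1)] l2_bounded_reindex[OF c inj_shift(2)])
    then show ?thesis by (simp add: \<kappa>_def sum_distrib_left mult_ac)
  qed
  have T_diff: "T c n - T d n = T (\<lambda>n. c n - d n) n" for c d n
    by (simp add: T_def sum_subtractf[symmetric] algebra_simps)
  define c where "c = rec_nat (\<lambda>n. 0) (\<lambda>_ c n. of_real (1 / \<beta>) * (r n + T c n))"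
  have c0: "c 0 = (\<lambda>n. 0)" and cS: "c (Suc p) = (\<lambda>n. of_real (1 / \<beta>) * (r n + T (c p) n))" for p
    by (simp_all add: c_def)
  have bd: "l2_bounded (c p) (M / (\<beta> - \<kappa>))" for p
  proof (induction p)
    case 0
    then show ?case using \<kappa> M by (simp add: c0 l2_bounded_zero)
  next
    case (Suc p)
    have "l2_bounded (c (Suc p)) (1 / \<beta> * (M + \<kappa> * (M / (\<beta> - \<kappa>))))"
      unfolding cS using \<kappa> by (intro l2_bounded_scale l2_bounded_add r T Suc) (simp add: norm_divide)
    \<comment> \<open>\<open>M / (\<beta> - \<kappa>)\<close> is the fixed point of the map sending
      N to (M + \<kappa> N) / \<beta>, hence the bound reproduces itself along the
      iteration.\<close>
    moreover have "1 / \<beta> * (M + \<kappa> * (M / (\<beta> - \<kappa>))) = M / (\<beta> - \<kappa>)"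
      using \<kappa> by (simp add: field_simps)
    ultimately show ?case by simp
  qed
  \<comment> \<open>Each step contracts differences by \<open>\<kappa> / \<beta>\<close>, so the
    iteration converges geometrically at every single vertex.\<close>
  have incr: "l2_bounded (\<lambda>n. c (Suc p) n - c p n) (M / \<beta> * (\<kappa> / \<beta>) ^ p)" for p
  proof (induction p)
    case 0
    have "l2_bounded (\<lambda>n. of_real (1 / \<beta>) * r n) (1 / \<beta> * M)"
      using \<kappa> by (intro l2_bounded_scale r) (simp add: norm_divide)
    then show ?case by (simp add: cS c0 T_def)
  next
    case (Suc p)
    have "c (Suc (Suc p)) n - c (Suc p) n = of_real (1 / \<beta>) * T (\<lambda>n. c (Suc p) n - c p n) n" for n
      unfolding T_diff[symmetric] cS by (simp add: algebra_simps)
    moreover have "l2_bounded (\<lambda>n. of_real (1 / \<beta>) * T (\<lambda>n. c (Suc p) n - c p n) n)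
        (1 / \<beta> * (\<kappa> * (M / \<beta> * (\<kappa> / \<beta>) ^ p)))"
      using \<kappa> by (intro l2_bounded_scale T Suc) (simp add: norm_divide)
    ultimately show ?case by (simp add: mult_ac)
  qed
  have conv: "\<exists>l. (\<lambda>p. c p n) \<longlonglongrightarrow> l" for n
  proof -
    have "summable (\<lambda>p. c (Suc p) n - c p n)"
    proof (rule summable_comparison_test)
      show "\<exists>N. \<forall>p\<ge>N. norm (c (Suc p) n - c p n) \<le> M / \<beta> * (\<kappa> / \<beta>) ^ p"
        using l2_bounded_pointwise[OF incr] by blast
      show "summable (\<lambda>p. M / \<beta> * (\<kappa> / \<beta>) ^ p)"
        using \<kappa> by (intro summable_mult summable_geometric) auto
    qed
    then show ?thesis
      using summable_LIMSEQ[of "\<lambda>p. c (Suc p) n - c p n"]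
      by (auto simp: sum_lessThan_telescope[of "\<lambda>p. c p n"] c0)
  qed
  then obtain d where d: "\<And>n. (\<lambda>p. c p n) \<longlonglongrightarrow> d n" by metis
  have "l2_bounded d (M / (\<beta> - \<kappa>))" by (rule l2_bounded_limit[OF bd d])
  moreover have "of_real \<beta> * d n = r n + T d n" for n
  proof -
    have "(\<lambda>p. c (Suc p) n) \<longlonglongrightarrow> of_real (1 / \<beta>) * (r n + T d n)"
      unfolding cS T_def by (intro tendsto_intros d)
    moreover have "(\<lambda>p. c (Suc p) n) \<longlonglongrightarrow> d n" using d by (rule LIMSEQ_Suc)
    ultimately have "d n = of_real (1 / \<beta>) * (r n + T d n)" by (rule LIMSEQ_unique[symmetric])
    then show ?thesis using \<kappa> by simp
  qed
  ultimately show ?thesis by (auto simp: \<kappa>_def T_def)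
qed

text \<open>Maximum principle: the supremum \<open>s\<close> of the moduli satisfies \<beta> s \<le>
  \<kappa> s with \<kappa> < \<beta>. The hypothesis is boundedness because that is what the trace
  estimate on an edge delivers.\<close>

lemma discrete_injective:
  fixes w :: "'d::finite \<Rightarrow> real" and c :: "('d \<Rightarrow> int) \<Rightarrow> complex"
  assumes dom: "(\<Sum>j\<in>UNIV. 2 * \<bar>w j\<bar>) < \<beta>" and bd: "\<And>n. norm (c n) \<le> M"
    and eq: "\<And>n. of_real \<beta> * c n = (\<Sum>j\<in>UNIV. of_real (w j) * (c (shift_up j n) + c (n - unit_step j)))"
  shows "c n = 0"
proof -
  define \<kappa> where "\<kappa> = (\<Sum>j\<in>UNIV. 2 * \<bar>w j\<bar>)"
  have \<kappa>: "0 \<le> \<kappa>" "\<kappa> < \<beta>" using dom by (auto simp: \<kappa>_def intro: sum_nonneg)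
  define s where "s = (SUP n. norm (c n))"
  have s: "norm (c n) \<le> s" for n
    unfolding s_def by (rule cSUP_upper) (auto intro!: bdd_aboveI2[where M = M] bd)
  have "\<beta> * norm (c n) \<le> \<kappa> * s" for n
  proof -
    have "\<beta> * norm (c n) = norm (of_real \<beta> * c n)" using \<kappa> by (simp add: norm_mult)
    also have "\<dots> \<le> (\<Sum>j\<in>UNIV. norm (of_real (w j) * (c (shift_up j n) + c (n - unit_step j))))"
      unfolding eq by (rule norm_sum)
    also have "\<dots> \<le> (\<Sum>j\<in>UNIV. \<bar>w j\<bar> * (s + s))"
      unfolding norm_mult by (intro sum_mono mult_mono norm_triangle_mono s) auto
    also have "\<dots> = \<kappa> * s"
      unfolding \<kappa>_def sum_distrib_right by (intro sum.cong) auto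
    finally show ?thesis .
  qed
  then have "norm (c n) \<le> \<kappa> * s / \<beta>" for n using \<kappa> by (simp add: pos_le_divide_eq mult.commute)
  then have "s \<le> \<kappa> * s / \<beta>" unfolding s_def by (intro cSUP_least) auto
  then have "(\<beta> - \<kappa>) * s \<le> 0" using \<kappa> by (simp add: field_simps)
  then have "s \<le> 0" using \<kappa> by (simp add: mult_le_0_iff)
  then show ?thesis using s[of n] by (smt (verit) norm_le_zero_iff)
qed

section \<open>Solutions on a single edge\<close>

text \<open>The solutions of \<open>-y'' = E y\<close> with \<open>y 0 = 1, y' 0 = 0\<close> and \<open>y 0 = 0, y' 0 = 1\<close>, for every sign of \<open>E\<close>.\<close>
definition csol :: "real \<Rightarrow> real \<Rightarrow> real" where
  "csol E t = (if 0 < E then cos (sqrt E * t) else cosh (sqrt (- E) * t))"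

definition ssol :: "real \<Rightarrow> real \<Rightarrow> real" where
  "ssol E t = (if 0 < E then sin (sqrt E * t) / sqrt E else if E = 0 then t
     else sinh (sqrt (- E) * t) / sqrt (- E))"

lemma csol_0 [simp]: "csol E 0 = 1" and ssol_0 [simp]: "ssol E 0 = 0"
  by (auto simp: csol_def ssol_def)

text \<open>The solutions and their derivatives form the transfer matrix of the edge; this is the
  statement that its determinant is 1.\<close>

lemma csol_ssol_square: "(csol E t)\<^sup>2 + E * (ssol E t)\<^sup>2 = 1"
proof (cases E "0::real" rule: linorder_cases)
  case less
  then show ?thesis
    using hyperbolic_pythagoras[of "sqrt (- E) * t"]
    by (simp add: csol_def ssol_def power_divide field_simps)
next
  case greater
  then show ?thesis
    by (simp add: csol_def ssol_def power_divide)
qed (simp add: csol_def ssol_def)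

lemma DERIV_csol: "(csol E has_real_derivative - E * ssol E t) (at t within A)"
proof (cases E "0::real" rule: linorder_cases)
  case less
  then obtain k where "k > 0" "E = - (k * k)"
    by (intro that[of "sqrt (- E)"]) auto
  then show ?thesis unfolding csol_def ssol_def
    by (auto intro!: derivative_eq_intros simp: real_sqrt_mult not_less)
next
  case greater
  then obtain k where "k > 0" "E = k * k"
    by (intro that[of "sqrt E"]) auto
  then show ?thesis unfolding csol_def ssol_def
    by (auto intro!: derivative_eq_intros simp: real_sqrt_mult)
qed (auto simp: csol_def[abs_def] ssol_def[abs_def] intro!: derivative_eq_intros)

lemma DERIV_ssol: "(ssol E has_real_derivative csol E t) (at t within A)"
proof (cases E "0::real" rule: linorder_cases)
  case less
  then obtain k where "k > 0" "E = - (k * k)"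
    by (intro that[of "sqrt (- E)"]) auto
  then show ?thesis unfolding csol_def ssol_def
    by (auto intro!: derivative_eq_intros simp: real_sqrt_mult not_less)
next
  case greater
  then obtain k where "k > 0" "E = k * k"
    by (intro that[of "sqrt E"]) auto
  then show ?thesis unfolding csol_def ssol_def
    by (auto intro!: derivative_eq_intros simp: real_sqrt_mult)
qed (auto simp: csol_def[abs_def] ssol_def[abs_def] intro!: derivative_eq_intros)

lemma has_vector_derivative_csol:
  "((\<lambda>t. complex_of_real (csol E t)) has_vector_derivative - of_real E * of_real (ssol E t)) (at t within A)"
  using has_vector_derivative_of_real[OF DERIV_csol, where 'a = complex] by simp

lemma has_vector_derivative_ssol:
  "((\<lambda>t. complex_of_real (ssol E t)) has_vector_derivative of_real (csol E t)) (at t within A)"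
  by (rule has_vector_derivative_of_real[OF DERIV_ssol])

lemma continuous_csol: "continuous_on A (csol E)"
  by (rule DERIV_continuous_on[OF DERIV_csol])

lemma continuous_ssol: "continuous_on A (ssol E)"
  by (rule DERIV_continuous_on[OF DERIV_ssol])

section \<open>The homogeneous edge equation: uniqueness and control of boundary values\<close>

lemma continuous_on_interval_bounded:
  fixes h :: "real \<Rightarrow> real"
  assumes "continuous_on {a..b} h"
  obtains K where "K \<ge> 0" "\<And>t. t \<in> {a..b} \<Longrightarrow> \<bar>h t\<bar> \<le> K"
proof -
  obtain K where "\<And>t. t \<in> {a..b} \<Longrightarrow> \<bar>h t\<bar> \<le> K"
    using compact_imp_bounded[OF compact_continuous_image[OF assms]]
    by (auto simp del: atLeastAtMost_iff simp: bounded_iff)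
  then show ?thesis by (intro that[of "max K 0"]) (auto simp: le_max_iff_disj simp del: atLeastAtMost_iff)
qed

text \<open>The determinant identity over the complex numbers, oriented so that the simplifier
  eliminates products of \<open>csol\<close> and exposes the cancellation.\<close>

lemma csol_square: "complex_of_real (csol E t) * of_real (csol E t)
   = 1 - of_real E * of_real (ssol E t) * of_real (ssol E t)"
proof -
  have "csol E t * csol E t = 1 - E * ssol E t * ssol E t"
    using csol_ssol_square[of E t] by (simp add: power2_eq_square algebra_simps)
  from arg_cong[OF this, of complex_of_real] show ?thesis by simp
qed

text \<open>Applying the inverse transfer matrix to the pair of \<open>\<psi>\<close> and
  \<open>d\<psi>\<close> gives two quantities \<open>u\<close> and \<open>v\<close> with derivative
  zero. They equal the initial data, and multiplying back by the transfer matrix yields the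
  formulas.\<close>

lemma homogeneous_solution:
  fixes \<psi> d\<psi> :: "real \<Rightarrow> complex"
  assumes \<psi>: "\<And>t. t \<in> {0..b} \<Longrightarrow> (\<psi> has_vector_derivative d\<psi> t) (at t within {0..b})"
    and d\<psi>: "\<And>t. t \<in> {0..b} \<Longrightarrow> d\<psi> t = d\<psi> 0 - integral {0..t} (\<lambda>t. of_real E * \<psi> t)"
    and t: "t \<in> {0..b}"
  shows "\<psi> t = \<psi> 0 * of_real (csol E t) + d\<psi> 0 * of_real (ssol E t)"
    and "d\<psi> t = d\<psi> 0 * of_real (csol E t) - of_real E * \<psi> 0 * of_real (ssol E t)"
proof -
  have cont: "continuous_on {0..b} \<psi>"
    using \<psi> by (rule continuous_on_vector_derivative)
  \<comment> \<open>The integral equation can be differentiated at every point because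
    \<open>\<psi>\<close>, being differentiable, is continuous.\<close>
  have dd: "(d\<psi> has_vector_derivative - of_real E * \<psi> t) (at t within {0..b})" if "t \<in> {0..b}" for t
  proof (rule has_vector_derivative_transform[OF that])
    show "((\<lambda>t. d\<psi> 0 - integral {0..t} (\<lambda>t. of_real E * \<psi> t)) has_vector_derivative - of_real E * \<psi> t)
       (at t within {0..b})"
      by (rule has_vector_derivative_eq_rhs, rule has_vector_derivative_diff[OF has_vector_derivative_const
            integral_has_vector_derivative[OF continuous_on_mult[OF continuous_on_const cont] that]]) simp
  qed (rule d\<psi>)
  define u where "u t = \<psi> t * of_real (csol E t) - d\<psi> t * of_real (ssol E t)" for t
  define v where "v t = of_real E * \<psi> t * of_real (ssol E t) + d\<psi> t * of_real (csol E t)" for t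
  have "(u has_vector_derivative 0) (at t within {0..b})" if "t \<in> {0..b}" for t
    unfolding u_def
    by (rule has_vector_derivative_eq_rhs, (rule has_vector_derivative_add has_vector_derivative_diff
          has_vector_derivative_mult has_vector_derivative_const has_vector_derivative_csol
          has_vector_derivative_ssol \<psi> dd that)+)
      (simp add: algebra_simps)
  then obtain c where c: "\<And>t. t \<in> {0..b} \<Longrightarrow> u t = c"
    using has_vector_derivative_zero_constant[of "{0..b}" u] by (auto simp: convex_real_interval)
  have "(v has_vector_derivative 0) (at t within {0..b})" if "t \<in> {0..b}" for t
    unfolding v_def
    by (rule has_vector_derivative_eq_rhs, (rule has_vector_derivative_add has_vector_derivative_diff
          has_vector_derivative_mult has_vector_derivative_const has_vector_derivative_csol
          has_vector_derivative_ssol \<psi> dd that)+)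
      (simp add: algebra_simps)
  then obtain d where d: "\<And>t. t \<in> {0..b} \<Longrightarrow> v t = d"
    using has_vector_derivative_zero_constant[of "{0..b}" v] by (auto simp: convex_real_interval)
  have "0 \<in> {0..b}" using t by auto
  with t c[of 0] c[of t] d[of 0] d[of t] have u: "u t = \<psi> 0" and v: "v t = d\<psi> 0"
    by (auto simp: u_def v_def)
  have "u t * of_real (csol E t) + v t * of_real (ssol E t)
     = \<psi> t * (of_real (csol E t) * of_real (csol E t) + of_real E * of_real (ssol E t) * of_real (ssol E t))"
    by (simp add: u_def v_def algebra_simps)
  then show "\<psi> t = \<psi> 0 * of_real (csol E t) + d\<psi> 0 * of_real (ssol E t)"
    by (simp add: u v csol_square)
  have "v t * of_real (csol E t) - of_real E * u t * of_real (ssol E t)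
     = d\<psi> t * (of_real (csol E t) * of_real (csol E t) + of_real E * of_real (ssol E t) * of_real (ssol E t))"
    by (simp add: u_def v_def algebra_simps)
  then show "d\<psi> t = d\<psi> 0 * of_real (csol E t) - of_real E * \<psi> 0 * of_real (ssol E t)"
    by (simp add: u v csol_square)
qed

text \<open>Pairing with the cut-off \<open>t (1 - t / b)\<^sup>2\<close> recovers the boundary value of a solution.\<close>
lemma homogeneous_trace_bound:
  assumes "b > 0"
  shows "\<exists>K\<ge>0. \<forall>\<psi> d\<psi> :: real \<Rightarrow> complex.
    (\<forall>t\<in>{0..b}. (\<psi> has_vector_derivative d\<psi> t) (at t within {0..b}) \<and>
       d\<psi> t = d\<psi> 0 - integral {0..t} (\<lambda>t. of_real E * \<psi> t)) \<longrightarrow>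
    norm (\<psi> 0) \<le> K * (b + integral {0..b} (\<lambda>t. (norm (\<psi> t))\<^sup>2))"
proof -
  \<comment> \<open>The cut-off multiplied out: simple zero with slope 1 at 0, double zero at
    \<open>b\<close>.\<close>
  define w where "w t = t - 2 * t\<^sup>2 / b + t ^ 3 / b\<^sup>2" for t
  define w' where "w' t = 1 - 4 * t / b + 3 * t\<^sup>2 / b\<^sup>2" for t
  define w'' where "w'' t = - 4 / b + 6 * t / b\<^sup>2" for t
  have w: "(w has_real_derivative w' t) (at t within A)" for t A
    unfolding w_def w'_def using assms by (auto intro!: derivative_eq_intros simp: field_simps)
  have w': "(w' has_real_derivative w'' t) (at t within A)" for t A
    unfolding w''_def w'_def using assms by (auto intro!: derivative_eq_intros simp: field_simps)
  note cw = has_vector_derivative_of_real[OF w, where 'a = complex]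
  note cw' = has_vector_derivative_of_real[OF w', where 'a = complex]
  have ends: "w 0 = 0" "w' 0 = 1" "w b = 0" "w' b = 0"
    using assms by (auto simp: w_def w'_def power2_eq_square power3_eq_cube)
  define h where "h t = E * w t + w'' t" for t
  have cont_h: "continuous_on {0..b} h"
    unfolding h_def w_def w''_def using assms by (intro continuous_intros) auto
  then obtain K where K0: "K \<ge> 0" and K: "\<And>t. t \<in> {0..b} \<Longrightarrow> \<bar>h t\<bar> \<le> K"
    by (rule continuous_on_interval_bounded) blast
  show ?thesis
  proof (intro exI conjI allI impI)
    show "0 \<le> K" by (rule K0)
    fix \<psi> d\<psi> :: "real \<Rightarrow> complex"
    assume *: "\<forall>t\<in>{0..b}. (\<psi> has_vector_derivative d\<psi> t) (at t within {0..b}) \<and>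
       d\<psi> t = d\<psi> 0 - integral {0..t} (\<lambda>t. of_real E * \<psi> t)"
    have cont: "continuous_on {0..b} \<psi>"
      using * by (intro continuous_on_vector_derivative) auto
    have dd: "(d\<psi> has_vector_derivative - of_real E * \<psi> t) (at t within {0..b})" if "t \<in> {0..b}" for t
    proof (rule has_vector_derivative_transform[OF that])
      show "((\<lambda>t. d\<psi> 0 - integral {0..t} (\<lambda>t. of_real E * \<psi> t)) has_vector_derivative - of_real E * \<psi> t)
         (at t within {0..b})"
      by (rule has_vector_derivative_eq_rhs, rule has_vector_derivative_diff[OF has_vector_derivative_const
            integral_has_vector_derivative[OF continuous_on_mult[OF continuous_on_const cont] that]]) simp
    qed (use * in blast)
    \<comment> \<open>The Wronskian of \<open>w\<close> and \<open>\<psi>\<close>. By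
      \<open>ends\<close> it vanishes at \<open>b\<close> and equals -\<psi>(0) at 0, so integrating
      its derivative isolates \<psi>(0) and removes both boundary slopes.\<close>
    define \<Phi> where "\<Phi> t = of_real (w t) * d\<psi> t - of_real (w' t) * \<psi> t" for t
    have "(\<Phi> has_vector_derivative - (of_real (h t) * \<psi> t)) (at t within {0..b})" if "t \<in> {0..b}" for t
      unfolding \<Phi>_def
      by (rule has_vector_derivative_eq_rhs, (rule has_vector_derivative_diff
            has_vector_derivative_mult cw cw' dd that *[rule_format, OF that, THEN conjunct1])+)
        (simp add: h_def algebra_simps)
    then have "((\<lambda>t. - (of_real (h t) * \<psi> t)) has_integral (\<Phi> b - \<Phi> 0)) {0..b}"
      using assms by (intro fundamental_theorem_of_calculus) auto
    then have "((\<lambda>t. - (of_real (h t) * \<psi> t)) has_integral \<psi> 0) {0..b}"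
      by (simp add: \<Phi>_def ends)
    then have eq: "\<psi> 0 = integral {0..b} (\<lambda>t. - (of_real (h t) * \<psi> t))"
      by (rule integral_unique[symmetric])
    \<comment> \<open>The majorant 1 + |\<psi>|^2 of |\<psi>| replaces Cauchy-Schwarz. Linearity in
      the norm is lost, but a bound uniform over all vertices is what is wanted.\<close>
    have "norm (\<psi> 0) \<le> integral {0..b} (\<lambda>t. K * (1 + (norm (\<psi> t))\<^sup>2))"
      unfolding eq
    proof (rule integral_norm_bound_integral)
      show "(\<lambda>t. - (of_real (h t) * \<psi> t)) integrable_on {0..b}"
        by (intro integrable_continuous_real continuous_intros cont cont_h)
      show "(\<lambda>t. K * (1 + (norm (\<psi> t))\<^sup>2)) integrable_on {0..b}"
        by (intro integrable_continuous_real continuous_intros cont)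
      fix t assume t: "t \<in> {0..b}"
      have "2 * norm (\<psi> t) \<le> 1 + (norm (\<psi> t))\<^sup>2"
        using sum_squares_bound[of 1 "norm (\<psi> t)"] by simp
      then have "norm (\<psi> t) \<le> 1 + (norm (\<psi> t))\<^sup>2"
        using norm_ge_zero[of "\<psi> t"] by linarith
      then show "norm (- (of_real (h t) * \<psi> t)) \<le> K * (1 + (norm (\<psi> t))\<^sup>2)"
        using K[OF t] K0 by (simp add: norm_mult mult_mono)
    qed
    also have "\<dots> = K * (b + integral {0..b} (\<lambda>t. (norm (\<psi> t))\<^sup>2))"
    proof -
      have "(\<lambda>t. (norm (\<psi> t))\<^sup>2) integrable_on {0..b}"
        by (intro integrable_continuous_real continuous_intros cont)
      then show ?thesis using assms by (simp add: integral_add[OF integrable_const_ivl])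
    qed
    finally show "norm (\<psi> 0) \<le> K * (b + integral {0..b} (\<lambda>t. (norm (\<psi> t))\<^sup>2))" .
  qed
qed

section \<open>The inhomogeneous edge equation with an integrable right-hand side\<close>

lemma absolutely_integrable_continuous_mult:
  fixes P g :: "real \<Rightarrow> complex"
  assumes "continuous_on {a..b} P" "g absolutely_integrable_on {a..b}"
  shows "(\<lambda>s. P s * g s) absolutely_integrable_on {a..b}"
proof (rule absolutely_integrable_bounded_measurable_product[where h = "(*)" and f = P and g = g, OF _ _ _ _ assms(2)])
  show "bilinear ((*) :: complex \<Rightarrow> complex \<Rightarrow> complex)"
    by (simp add: bilinear_conv_bounded_bilinear bounded_bilinear_mult)
  show "P \<in> borel_measurable (lebesgue_on {a..b})"
    using assms(1) by (rule continuous_imp_measurable_on_sets_lebesgue) simp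
  show "bounded (P ` {a..b})"
    using assms(1) by (intro compact_imp_bounded compact_continuous_image) auto
qed simp

text \<open>Here \<open>g\<close> is only integrable, so \<open>U\<close> need not be differentiable; the defect
  of the product formula has vanishing derivative at every point nevertheless.\<close>
lemma product_rule_indefinite_integral:
  fixes g :: "real \<Rightarrow> complex"
  assumes b: "b \<ge> 0" and g: "g absolutely_integrable_on {0..b}"
    and P: "\<And>t. t \<in> {0..b} \<Longrightarrow> (P has_real_derivative P' t) (at t within {0..b})"
    and P': "continuous_on {0..b} P'"
    and U: "\<And>t. t \<in> {0..b} \<Longrightarrow> U t = u + integral {0..t} g"
    and t: "t \<in> {0..b}"
  shows "of_real (P t) * U t = of_real (P 0) * u + integral {0..t} (\<lambda>s. of_real (P' s) * U s + of_real (P s) * g s)"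
proof -
  have gi: "g integrable_on {0..b}" and ngi: "(\<lambda>t. norm (g t)) integrable_on {0..b}"
    using g by (auto simp: absolutely_integrable_on_def)
  have contP: "continuous_on {0..b} P" using P by (rule DERIV_continuous_on)
  have contU: "continuous_on {0..b} U"
    using U by (subst continuous_on_cong[OF refl U]) (auto intro!: continuous_intros indefinite_integral_continuous_1 gi)
  have Pg: "(\<lambda>s. of_real (P s) * g s) integrable_on {0..b}"
  proof -
    have "(\<lambda>s. of_real (P s) * g s) absolutely_integrable_on {0..b}"
      by (intro absolutely_integrable_continuous_mult g continuous_intros contP)
    then show ?thesis by (simp add: absolutely_integrable_on_def)
  qed
  obtain L where L0: "L \<ge> 0" and L: "\<And>t. t \<in> {0..b} \<Longrightarrow> \<bar>P' t\<bar> \<le> L"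
    using P' by (rule continuous_on_interval_bounded) blast
  have Plip: "\<bar>P x - P y\<bar> \<le> L * \<bar>x - y\<bar>" if "x \<in> {0..b}" "y \<in> {0..b}" for x y
    using field_differentiable_bound[of "{0..b}" P P' L x y] P L that by auto
  define N where "N t = integral {0..t} (\<lambda>s. norm (g s))" for t
  have contN: "continuous_on {0..b} N" unfolding N_def
    by (rule indefinite_integral_continuous_1[OF ngi])
  define I where "I s = of_real (P' s) * U s + of_real (P s) * g s" for s
  have P'U: "(\<lambda>s. of_real (P' s) * U s) integrable_on {0..b}"
    by (intro integrable_continuous_real continuous_intros P' contU)
  have Ii: "I integrable_on {0..b}" unfolding I_def by (intro integrable_add P'U Pg)
  define D where "D t = of_real (P t) * U t - integral {0..t} I" for t
  \<comment> \<open>\<open>N\<close> measures the mass of \<open>g\<close>. An increment of the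
    defect is bounded by the length of the interval times its mass, and the mass tends to 0 with the
    length, which forces the derivative to vanish.\<close>
  have est: "norm (D y - D x) \<le> 2 * L * (y - x) * (N y - N x)" if xy: "x \<in> {0..b}" "y \<in> {0..b}" "x \<le> y" for x y
  proof -
    have sub: "{x..y} \<subseteq> {0..b}" "{0..y} \<subseteq> {0..b}" using xy by auto
    have split: "integral {0..y} f = integral {0..x} f + integral {x..y} f" if "f integrable_on {0..b}" for f :: "real \<Rightarrow> complex"
      using Henstock_Kurzweil_Integration.integral_combine[of 0 x y f] xy integrable_on_subinterval[OF that sub(2)] by simp
    have splitN: "N y = N x + integral {x..y} (\<lambda>s. norm (g s))"
      unfolding N_def using Henstock_Kurzweil_Integration.integral_combine[of 0 x y "\<lambda>s. norm (g s)"] xy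
        integrable_on_subinterval[OF ngi sub(2)] by simp
    have gxy: "g integrable_on {x..y}" "(\<lambda>s. norm (g s)) integrable_on {x..y}" "I integrable_on {x..y}"
      "(\<lambda>s. of_real (P' s) * U s) integrable_on {x..y}" "(\<lambda>s. of_real (P s) * g s) integrable_on {x..y}"
      using gi ngi Ii P'U Pg sub(1) by (auto intro: integrable_on_subinterval)
    have P'xy: "(P' has_integral (P y - P x)) {x..y}"
      using xy(3) sub(1) by (intro fundamental_theorem_of_calculus)
        (auto simp: has_real_derivative_iff_has_vector_derivative[symmetric] intro!: DERIV_subset[OF P] )
    then have P'xy': "((\<lambda>s. complex_of_real (P' s) * U x) has_integral (of_real (P y - P x) * U x)) {x..y}"
      by (intro has_integral_mult_left has_integral_of_real)
    have Pyg: "((\<lambda>s. of_real (P y) * g s) has_integral (of_real (P y) * integral {x..y} g)) {x..y}"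
      by (intro has_integral_mult_right integrable_integral gxy)
    \<comment> \<open>The product increment is written with \<open>P\<close> frozen at
      \<open>y\<close> and \<open>U\<close> frozen at \<open>x\<close>. Replacing frozen by true
      values under the integral costs L (y - x) |g(s)| for \<open>P\<close> and L (N y - N x) for
      \<open>U\<close>; both integrate to the same bound, whence the factor 2 in
      \<open>est\<close>.\<close>
    have "D y - D x = of_real (P y) * U y - of_real (P x) * U x - integral {x..y} I"
      unfolding D_def split[OF Ii] by simp
    also have "\<dots> = of_real (P y) * integral {x..y} g + of_real (P y - P x) * U x - integral {x..y} I"
      using U[OF xy(1)] U[OF xy(2)] split[OF gi] by (simp add: algebra_simps)
    finally have "((\<lambda>s. of_real (P y) * g s + of_real (P' s) * U x - I s) has_integral (D y - D x)) {x..y}"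
      using has_integral_diff[OF has_integral_add[OF Pyg P'xy'] integrable_integral[OF gxy(3)]] by simp
    moreover have "norm (of_real (P y) * g s + of_real (P' s) * U x - I s)
        \<le> L * (y - x) * norm (g s) + L * (N y - N x)" if s: "s \<in> {x..y}" for s
    proof -
      have s': "s \<in> {0..b}" using s sub by auto
      have "{x..s} \<subseteq> {0..b}" "{0..s} \<subseteq> {0..b}" "{s..y} \<subseteq> {0..b}" using s sub xy by auto
      then have i: "g integrable_on {x..s}" "g integrable_on {0..s}" "(\<lambda>s. norm (g s)) integrable_on {x..s}"
        "(\<lambda>s. norm (g s)) integrable_on {s..y}"
        using gi ngi by (auto intro: integrable_on_subinterval)
      have "integral {0..x} g + integral {x..s} g = integral {0..s} g"
        by (rule Henstock_Kurzweil_Integration.integral_combine) (use i s xy in auto)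
      then have "U s - U x = integral {x..s} g"
        using U[OF s'] U[OF xy(1)] by (simp add: algebra_simps)
      then have "norm (U s - U x) \<le> integral {x..s} (\<lambda>s. norm (g s))"
        using integral_norm_bound_integral[OF i(1) i(3)] by simp
      also have "\<dots> \<le> N y - N x"
        unfolding splitN using s integral_subset_le[OF _ i(3) gxy(2)] by simp
      finally have 1: "norm (U s - U x) \<le> N y - N x" .
      have "norm (of_real (P y) * g s + of_real (P' s) * U x - I s)
        = norm (of_real (P y - P s) * g s - of_real (P' s) * (U s - U x))"
        by (simp add: I_def algebra_simps)
      also have "\<dots> \<le> norm (of_real (P y - P s) * g s) + norm (of_real (P' s) * (U s - U x))"
        by (rule norm_triangle_ineq4)
      also have "\<dots> = \<bar>P y - P s\<bar> * norm (g s) + \<bar>P' s\<bar> * norm (U s - U x)"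
        by (simp add: norm_mult del: of_real_diff)
      also have "\<dots> \<le> L * (y - x) * norm (g s) + L * (N y - N x)"
      proof (intro add_mono mult_mono)
        have "\<bar>P y - P s\<bar> \<le> L * \<bar>y - s\<bar>" by (rule Plip) (use xy s' in auto)
        also have "\<dots> \<le> L * (y - x)" using s L0 by (intro mult_left_mono) auto
        finally show "\<bar>P y - P s\<bar> \<le> L * (y - x)" .
      qed (use L0 1 L[OF s'] xy in auto)
      finally show ?thesis .
    qed
    moreover have "((\<lambda>s. L * (y - x) * norm (g s) + L * (N y - N x)) has_integral
        (L * (y - x) * (N y - N x) + (y - x) *\<^sub>R (L * (N y - N x)))) {x..y}"
      using xy(3) splitN has_integral_const_real[of "L * (N y - N x)" x y]
      by (intro has_integral_add has_integral_mult_right) (auto intro!: integrable_integral gxy)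
    ultimately have "norm (D y - D x) \<le> L * (y - x) * (N y - N x) + (y - x) *\<^sub>R (L * (N y - N x))"
      using integral_norm_bound_integral by (metis (no_types, lifting) has_integral_integrable_integral)
    then show ?thesis by (simp add: algebra_simps)
  qed
  have est': "norm (D y - D x) \<le> 2 * L * \<bar>N y - N x\<bar> * \<bar>y - x\<bar>" if xy: "x \<in> {0..b}" "y \<in> {0..b}" for x y
  proof (cases "x \<le> y")
    case True
    have "2 * L * (y - x) * (N y - N x) \<le> 2 * L * (y - x) * \<bar>N y - N x\<bar>"
      using True L0 by (intro mult_left_mono) auto
    with est[OF xy True] show ?thesis using True by (simp add: algebra_simps)
  next
    case False
    have "2 * L * (x - y) * (N x - N y) \<le> 2 * L * (x - y) * \<bar>N y - N x\<bar>"
      using False L0 by (intro mult_left_mono) auto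
    with est[OF xy(2,1)] show ?thesis using False by (simp add: algebra_simps norm_minus_commute)
  qed
  have "(D has_vector_derivative 0) (at x within {0..b})" if x: "x \<in> {0..b}" for x
    unfolding has_vector_derivative_def has_derivative_iff_norm
  proof (intro conjI)
    have "((\<lambda>y. 2 * L * \<bar>N y - N x\<bar>) \<longlongrightarrow> 2 * L * \<bar>N x - N x\<bar>) (at x within {0..b})"
      using contN x by (intro tendsto_intros) (auto simp: continuous_on_def)
    then have lim: "((\<lambda>y. 2 * L * \<bar>N y - N x\<bar>) \<longlongrightarrow> 0) (at x within {0..b})" by simp
    show "((\<lambda>y. norm (D y - D x - (y - x) *\<^sub>R 0) / norm (y - x)) \<longlongrightarrow> 0) (at x within {0..b})"
    proof (rule tendsto_sandwich[OF _ _ tendsto_const lim])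
      show "\<forall>\<^sub>F y in at x within {0..b}. norm (D y - D x - (y - x) *\<^sub>R 0) / norm (y - x) \<le> 2 * L * \<bar>N y - N x\<bar>"
        unfolding eventually_at_filter using est'[OF x] by (auto intro!: always_eventually simp: divide_le_eq)
    qed auto
  qed auto
  then obtain c where c: "\<And>t. t \<in> {0..b} \<Longrightarrow> D t = c"
    using has_vector_derivative_zero_constant[of "{0..b}" D] by (auto simp: convex_real_interval)
  have "D t = D 0" using c[OF t] c[of 0] b by auto
  moreover have "D 0 = of_real (P 0) * u" using U[of 0] b by (simp add: D_def)
  ultimately show ?thesis by (simp add: D_def I_def[abs_def] algebra_simps)
qed

lemma square_integrable_imp_absolutely_integrable:
  fixes f :: "real \<Rightarrow> complex"
  assumes f: "f measurable_on {0..b}" and f2: "(\<lambda>t. (norm (f t))\<^sup>2) integrable_on {0..b}"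
  shows "f absolutely_integrable_on {0..b}"
proof (rule measurable_bounded_by_integrable_imp_absolutely_integrable)
  show "f \<in> borel_measurable (lebesgue_on {0..b})"
    using f by (simp add: measurable_on_iff_borel_measurable)
  show "(\<lambda>t. 1 + (norm (f t))\<^sup>2) integrable_on {0..b}"
    by (intro integrable_add f2 integrable_const_ivl)
  fix t
  have "2 * norm (f t) \<le> 1 + (norm (f t))\<^sup>2"
    using sum_squares_bound[of 1 "norm (f t)"] by simp
  then show "norm (f t) \<le> 1 + (norm (f t))\<^sup>2"
    using norm_ge_zero[of "f t"] by linarith
qed simp

text \<open>Cauchy-Schwarz against the constant 1, obtained by integrating the square of the
  deviation of |f| from its mean \<open>I / b\<close>.\<close>

lemma square_integral_norm_le:
  fixes f :: "real \<Rightarrow> complex"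
  assumes b: "b > 0" and f: "f measurable_on {0..b}" and f2: "(\<lambda>t. (norm (f t))\<^sup>2) integrable_on {0..b}"
  shows "(integral {0..b} (\<lambda>t. norm (f t)))\<^sup>2 \<le> b * integral {0..b} (\<lambda>t. (norm (f t))\<^sup>2)"
proof -
  define I where "I = integral {0..b} (\<lambda>t. norm (f t))"
  define Q where "Q = integral {0..b} (\<lambda>t. (norm (f t))\<^sup>2)"
  have nf: "(\<lambda>t. norm (f t)) integrable_on {0..b}"
    using square_integrable_imp_absolutely_integrable[OF f f2] by (simp add: absolutely_integrable_on_def)
  have "((\<lambda>t. (norm (f t))\<^sup>2 - 2 * (I / b) * norm (f t) + (I / b)\<^sup>2) has_integral
      (Q - 2 * (I / b) * I + (b - 0) *\<^sub>R (I / b)\<^sup>2)) {0..b}"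
    unfolding I_def Q_def using b has_integral_const_real[of "(I / b)\<^sup>2" 0 b]
    by (intro has_integral_add has_integral_diff has_integral_mult_right integrable_integral nf f2)
      (simp add: I_def)
  moreover have "0 \<le> (norm (f t))\<^sup>2 - 2 * (I / b) * norm (f t) + (I / b)\<^sup>2" for t
    using zero_le_power2[of "norm (f t) - I / b"] by (simp add: power2_diff algebra_simps)
  ultimately have "0 \<le> Q - 2 * (I / b) * I + (b - 0) *\<^sub>R (I / b)\<^sup>2"
    by (rule has_integral_nonneg) 
  then have "I\<^sup>2 / b \<le> Q" using b by (simp add: power2_eq_square)
  then show ?thesis using b by (simp add: I_def Q_def field_simps)
qed

text \<open>The transfer matrix is applied to varying coefficients \<open>U\<close> and
  \<open>V\<close>. The contributions of \<open>f\<close> cancel in \<open>\<psi>\<close> and, since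
  the determinant is 1, add up to -f in \<open>d\<psi>\<close>. As \<open>U\<close> and
  \<open>V\<close> are only indefinite integrals, each product is rewritten as an integral rather
  than differentiated.\<close>

lemma variation_of_constants:
  fixes f :: "real \<Rightarrow> complex" and c d :: complex and b E :: real
  assumes b: "b > 0" and f: "f absolutely_integrable_on {0..b}"
  defines "U \<equiv> \<lambda>t. c + integral {0..t} (\<lambda>s. of_real (ssol E s) * f s)"
    and "V \<equiv> \<lambda>t. d - integral {0..t} (\<lambda>s. of_real (csol E s) * f s)"
  defines "\<psi> \<equiv> \<lambda>t. of_real (csol E t) * U t + of_real (ssol E t) * V t"
    and "d\<psi> \<equiv> \<lambda>t. of_real (csol E t) * V t - of_real E * of_real (ssol E t) * U t"
  assumes t: "t \<in> {0..b}"
  shows "(\<psi> has_vector_derivative d\<psi> t) (at t within {0..b})"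
    and "d\<psi> t = d\<psi> 0 - integral {0..t} (\<lambda>s. f s + of_real E * \<psi> s)"
proof -
  define u where "u s = of_real (ssol E s) * f s" for s
  define v where "v s = - (of_real (csol E s) * f s)" for s
  have u: "u absolutely_integrable_on {0..b}" unfolding u_def
    by (intro absolutely_integrable_continuous_mult f continuous_intros continuous_ssol)
  have v: "v absolutely_integrable_on {0..b}" unfolding v_def
    using absolutely_integrable_continuous_mult[OF continuous_on_minus[OF continuous_on_of_real[OF continuous_csol]] f]
    by simp
  have U: "U t = c + integral {0..t} u" for t by (simp add: U_def u_def[abs_def])
  have V: "V t = d + integral {0..t} v" for t by (simp add: V_def v_def[abs_def])
  have ui: "u integrable_on {0..b}" and vi: "v integrable_on {0..b}"
    using u v by (auto simp: absolutely_integrable_on_def)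
  have contU: "continuous_on {0..b} U" and contV: "continuous_on {0..b} V"
    unfolding U[abs_def] V[abs_def]
    by (intro continuous_intros indefinite_integral_continuous_1 ui vi)+
  note cont = contU contV continuous_csol continuous_ssol
  have C': "continuous_on {0..b} (\<lambda>t. - E * ssol E t)" by (intro continuous_intros cont)
  have ES: "((\<lambda>t. - E * ssol E t) has_real_derivative - E * csol E t) (at t within A)" for t A
    by (intro DERIV_cmult DERIV_ssol)
  have EC: "continuous_on {0..b} (\<lambda>t. - E * csol E t)" by (intro continuous_intros cont)
  note parts = product_rule_indefinite_integral
  have sub: "g integrable_on {0..t}" if "t \<in> {0..b}" "g integrable_on {0..b}" for t and g :: "real \<Rightarrow> complex"
    using that by (auto intro: integrable_on_subinterval)
  have int: "(\<lambda>s. of_real (P' s) * W s + of_real (P s) * w s) integrable_on {0..b}"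
    if "continuous_on {0..b} P" "continuous_on {0..b} P'" "continuous_on {0..b} W" "w absolutely_integrable_on {0..b}"
    for P P' :: "real \<Rightarrow> real" and W w :: "real \<Rightarrow> complex"
  proof (rule integrable_add)
    show "(\<lambda>s. of_real (P' s) * W s) integrable_on {0..b}"
      by (intro integrable_continuous_real continuous_intros that)
    show "(\<lambda>s. of_real (P s) * w s) integrable_on {0..b}"
      using absolutely_integrable_continuous_mult[of 0 b "\<lambda>s. of_real (P s)" w] that
      by (simp add: absolutely_integrable_on_def continuous_on_of_real)
  qed
  \<comment> \<open>The integrand \<open>d\<psi>\<close> is continuous although \<open>f\<close>
    need not be, so this representation makes \<open>\<psi>\<close> differentiable at every
    point.\<close>
  have \<psi>: "\<psi> t = c + integral {0..t} d\<psi>" if t: "t \<in> {0..b}" for t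
  proof -
    have "\<psi> t = c + integral {0..t} (\<lambda>s. of_real (- E * ssol E s) * U s + of_real (csol E s) * u s)
       + integral {0..t} (\<lambda>s. of_real (csol E s) * V s + of_real (ssol E s) * v s)"
      using b parts[OF _ u DERIV_csol C' U t] parts[OF _ v DERIV_ssol continuous_csol V t]
      by (simp add: \<psi>_def)
    also have "\<dots> = c + integral {0..t} (\<lambda>s. (of_real (- E * ssol E s) * U s + of_real (csol E s) * u s) +
       (of_real (csol E s) * V s + of_real (ssol E s) * v s))"
      by (subst integral_add[OF sub[OF t int[OF continuous_csol C' contU u]]
              sub[OF t int[OF continuous_ssol continuous_csol contV v]]]) (simp only: add.assoc)
    also have "(\<lambda>s. (of_real (- E * ssol E s) * U s + of_real (csol E s) * u s) +
       (of_real (csol E s) * V s + of_real (ssol E s) * v s)) = d\<psi>"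
      by (auto simp: fun_eq_iff d\<psi>_def u_def v_def)
    finally show ?thesis .
  qed
  have contd: "continuous_on {0..b} d\<psi>" unfolding d\<psi>_def by (intro continuous_intros cont)
  show "(\<psi> has_vector_derivative d\<psi> t) (at t within {0..b})"
  proof (rule has_vector_derivative_transform[OF t \<psi>])
    show "((\<lambda>t. c + integral {0..t} d\<psi>) has_vector_derivative d\<psi> t) (at t within {0..b})"
      by (rule has_vector_derivative_eq_rhs, rule has_vector_derivative_add[OF has_vector_derivative_const
            integral_has_vector_derivative[OF contd t]]) simp
  qed
  have "d\<psi> t = d + integral {0..t} (\<lambda>s. of_real (- E * ssol E s) * V s + of_real (csol E s) * v s)
     + integral {0..t} (\<lambda>s. of_real (- E * csol E s) * U s + of_real (- E * ssol E s) * u s)"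
    using b parts[OF _ v DERIV_csol C' V t] parts[OF _ u ES EC U t]
    by (simp add: d\<psi>_def)
  also have "\<dots> = d + integral {0..t} (\<lambda>s. (of_real (- E * ssol E s) * V s + of_real (csol E s) * v s)
     + (of_real (- E * csol E s) * U s + of_real (- E * ssol E s) * u s))"
    by (subst integral_add[OF sub[OF t int[OF continuous_csol C' contV v]] sub[OF t int[OF C' EC contU u]]])
      (simp only: add.assoc)
  also have "(\<lambda>s. (of_real (- E * ssol E s) * V s + of_real (csol E s) * v s)
     + (of_real (- E * csol E s) * U s + of_real (- E * ssol E s) * u s)) = (\<lambda>s. - (f s + of_real E * \<psi> s))"
  proof
    fix s
    have "(of_real (- E * ssol E s) * V s + of_real (csol E s) * v s)
     + (of_real (- E * csol E s) * U s + of_real (- E * ssol E s) * u s)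
     = - (of_real (csol E s) * of_real (csol E s) + of_real E * of_real (ssol E s) * of_real (ssol E s)) * f s
       - of_real E * \<psi> s"
      by (simp add: \<psi>_def u_def v_def algebra_simps)
    then show "(of_real (- E * ssol E s) * V s + of_real (csol E s) * v s)
     + (of_real (- E * csol E s) * U s + of_real (- E * ssol E s) * u s) = - (f s + of_real E * \<psi> s)"
      by (simp add: csol_square)
  qed
  finally have "d\<psi> t = d - integral {0..t} (\<lambda>s. f s + of_real E * \<psi> s)"
    by (simp only: integral_neg add_uminus_conv_diff)
  then show "d\<psi> t = d\<psi> 0 - integral {0..t} (\<lambda>s. f s + of_real E * \<psi> s)"
    by (simp add: d\<psi>_def V_def)
qed

text \<open>Besides the Dirichlet problem this records the Dirichlet-to-Neumann data: the end slopes
  in terms of the boundary values and two moments of \<open>f\<close>. The vertex conditions see a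
  solution only through these slopes.\<close>

definition edge_solution ::
    "real \<Rightarrow> real \<Rightarrow> (real \<Rightarrow> complex) \<Rightarrow> complex \<Rightarrow> complex \<Rightarrow> (real \<Rightarrow> complex) \<Rightarrow> (real \<Rightarrow> complex) \<Rightarrow> bool" where
  "edge_solution E b f c0 c1 \<psi> d\<psi> \<longleftrightarrow>
     (\<forall>t\<in>{0..b}. (\<psi> has_vector_derivative d\<psi> t) (at t within {0..b}) \<and>
        d\<psi> t = d\<psi> 0 - integral {0..t} (\<lambda>s. f s + of_real E * \<psi> s)) \<and>
     \<psi> 0 = c0 \<and> \<psi> b = c1 \<and>
     d\<psi> 0 = (c1 - of_real (csol E b) * (c0 + integral {0..b} (\<lambda>s. of_real (ssol E s) * f s))) / of_real (ssol E b)
        + integral {0..b} (\<lambda>s. of_real (csol E s) * f s) \<and>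
     d\<psi> b = (of_real (csol E b) * c1 - c0 - integral {0..b} (\<lambda>s. of_real (ssol E s) * f s)) / of_real (ssol E b)"

text \<open>Since S(b) is nonzero, the initial slope can be chosen to hit any value at
  \<open>b\<close>. The constant depends on \<open>E\<close> and \<open>b\<close> alone, which is
  what makes the estimates on the infinitely many edges uniform.\<close>

lemma edge_boundary_problem:
  fixes b E :: real
  assumes b: "b > 0" and S: "ssol E b \<noteq> 0"
  shows "\<exists>M\<ge>0. \<forall>f c0 c1. f absolutely_integrable_on {0..b} \<longrightarrow>
     norm (integral {0..b} (\<lambda>s. of_real (ssol E s) * f s)) \<le> M * integral {0..b} (\<lambda>s. norm (f s)) \<and>
     norm (integral {0..b} (\<lambda>s. of_real (csol E s) * f s)) \<le> M * integral {0..b} (\<lambda>s. norm (f s)) \<and>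
     (\<exists>\<psi> d\<psi>. edge_solution E b f c0 c1 \<psi> d\<psi> \<and>
       (\<forall>t\<in>{0..b}. norm (\<psi> t) \<le> M * (norm c0 + norm c1 + integral {0..b} (\<lambda>s. norm (f s)))))"
proof -
  obtain K1 where K1: "\<And>t. t \<in> {0..b} \<Longrightarrow> \<bar>csol E t\<bar> \<le> K1"
    using continuous_csol by (rule continuous_on_interval_bounded) blast
  obtain K2 where K2: "\<And>t. t \<in> {0..b} \<Longrightarrow> \<bar>ssol E t\<bar> \<le> K2"
    using continuous_ssol by (rule continuous_on_interval_bounded) blast
  define K where "K = max K1 K2"
  have K: "\<bar>csol E t\<bar> \<le> K" "\<bar>ssol E t\<bar> \<le> K" if "t \<in> {0..b}" for t
    using K1[OF that] K2[OF that] by (auto simp: K_def)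
  have K0: "0 \<le> K" using K(1)[of 0] b by auto
  define s where "s = \<bar>ssol E b\<bar>"
  have s: "s > 0" using S by (simp add: s_def)
  \<comment> \<open>\<open>M\<close> dominates the coefficients of |c0|, |c1| and \<open>I\<close>
    in the final estimate of \<open>\<psi>\<close>, and also \<open>K\<close>, which bounds the two
    moments.\<close>
  define M where "M = K + 2 * K\<^sup>2 + K * ((1 + K + K\<^sup>2) / s + K)"
  have M: "K \<le> M" "0 \<le> M" using K0 s by (auto simp: M_def)
  show ?thesis
  proof (intro exI[of _ M] conjI allI impI)
    show "0 \<le> M" by (rule M)
    fix f :: "real \<Rightarrow> complex" and c0 c1 assume f: "f absolutely_integrable_on {0..b}"
    define I where "I = integral {0..b} (\<lambda>s. norm (f s))"
    define A where "A = integral {0..b} (\<lambda>s. of_real (ssol E s) * f s)"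
    define B where "B = integral {0..b} (\<lambda>s. of_real (csol E s) * f s)"
    \<comment> \<open>Solved from C(b) (c0 + A) + S(b) (d - B) = c1, the boundary condition at
      \<open>b\<close>.\<close>
    define d where "d = (c1 - of_real (csol E b) * (c0 + A)) / of_real (ssol E b) + B"
    define U where "U t = c0 + integral {0..t} (\<lambda>s. of_real (ssol E s) * f s)" for t
    define V where "V t = d - integral {0..t} (\<lambda>s. of_real (csol E s) * f s)" for t
    define \<psi> where "\<psi> t = of_real (csol E t) * U t + of_real (ssol E t) * V t" for t
    define d\<psi> where "d\<psi> t = of_real (csol E t) * V t - of_real E * of_real (ssol E t) * U t" for t
    have nf: "(\<lambda>t. norm (f t)) integrable_on {0..b}" using f by (simp add: absolutely_integrable_on_def)
    have bound: "norm (integral {0..t} (\<lambda>s. of_real (P s) * f s)) \<le> K * I"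
      if t: "t \<in> {0..b}" and P: "continuous_on {0..b} P" "\<And>s. s \<in> {0..b} \<Longrightarrow> \<bar>P s\<bar> \<le> K" for t and P :: "real \<Rightarrow> real"
    proof -
      have sub: "{0..t} \<subseteq> {0..b}" using t by auto
      have nft: "(\<lambda>t. norm (f t)) integrable_on {0..t}" by (rule integrable_on_subinterval[OF nf sub])
      have "(\<lambda>s. of_real (P s) * f s) integrable_on {0..b}"
        using absolutely_integrable_continuous_mult[of 0 b "\<lambda>s. of_real (P s)" f] P f
        by (simp add: absolutely_integrable_on_def continuous_on_of_real)
      then have "norm (integral {0..t} (\<lambda>s. of_real (P s) * f s)) \<le> integral {0..t} (\<lambda>s. K * norm (f s))"
        using P(2) sub
        by (intro integral_norm_bound_integral integrable_on_subinterval[OF _ sub] integrable_on_mult_right[OF nf])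
          (auto simp: norm_mult intro!: mult_right_mono)
      also have "\<dots> = K * integral {0..t} (\<lambda>s. norm (f s))" by simp
      also have "\<dots> \<le> K * I"
        unfolding I_def by (intro mult_left_mono integral_subset_le sub nf nft K0) auto
      finally show ?thesis .
    qed
    have I0: "0 \<le> I" unfolding I_def by (rule integral_nonneg[OF nf]) simp
    have A: "norm (integral {0..t} (\<lambda>s. of_real (ssol E s) * f s)) \<le> K * I" if "t \<in> {0..b}" for t
      using bound[OF that continuous_ssol K(2)] .
    have B: "norm (integral {0..t} (\<lambda>s. of_real (csol E s) * f s)) \<le> K * I" if "t \<in> {0..b}" for t
      using bound[OF that continuous_csol K(1)] .
    have bb: "b \<in> {0..b}" using b by auto
    have "norm d \<le> norm ((c1 - of_real (csol E b) * (c0 + A)) / complex_of_real (ssol E b)) + norm B"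
      unfolding d_def by (rule norm_triangle_ineq)
    also have "\<dots> \<le> (norm c1 + K * (norm c0 + K * I)) / s + K * I"
    proof (rule add_mono)
      have "norm (c1 - of_real (csol E b) * (c0 + A)) \<le> norm c1 + \<bar>csol E b\<bar> * norm (c0 + A)"
        using norm_triangle_ineq4[of c1 "of_real (csol E b) * (c0 + A)"] by (simp add: norm_mult)
      also have "\<dots> \<le> norm c1 + K * (norm c0 + K * I)"
        using K(1)[OF bb] A[OF bb] by (intro add_mono mult_mono norm_triangle_mono K0) (auto simp: A_def)
      finally show "norm ((c1 - of_real (csol E b) * (c0 + A)) / complex_of_real (ssol E b))
          \<le> (norm c1 + K * (norm c0 + K * I)) / s"
        using s by (simp add: norm_divide s_def divide_right_mono)
      show "norm B \<le> K * I" using B[OF bb] by (simp add: B_def)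
    qed
    finally have d: "norm d \<le> (norm c1 + K * (norm c0 + K * I)) / s + K * I" .
    have \<psi>_bound: "norm (\<psi> t) \<le> M * (norm c0 + norm c1 + I)" if t: "t \<in> {0..b}" for t
    proof -
      have "norm (\<psi> t) \<le> \<bar>csol E t\<bar> * norm (U t) + \<bar>ssol E t\<bar> * norm (V t)"
        unfolding \<psi>_def using norm_triangle_ineq[of "of_real (csol E t) * U t" "of_real (ssol E t) * V t"]
        by (simp add: norm_mult)
      also have "\<dots> \<le> K * (norm c0 + K * I) + K * (((norm c1 + K * (norm c0 + K * I)) / s + K * I) + K * I)"
      proof (intro add_mono mult_mono K[OF t] K0)
        show "norm (U t) \<le> norm c0 + K * I"
          unfolding U_def by (rule norm_triangle_mono[OF order_refl A[OF t]])
        have "norm (V t) \<le> norm d + norm (integral {0..t} (\<lambda>s. of_real (csol E s) * f s))"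
          unfolding V_def by (rule norm_triangle_ineq4)
        then show "norm (V t) \<le> ((norm c1 + K * (norm c0 + K * I)) / s + K * I) + K * I"
          using d B[OF t] by linarith
      qed auto
      also have "\<dots> = (K + K * K / s) * norm c0 + (K / s) * norm c1 + (2 * K\<^sup>2 + K * (K\<^sup>2 / s + K)) * I - K\<^sup>2 * I + K\<^sup>2 * I"
        using s by (simp add: field_simps power2_eq_square)
      also have "\<dots> \<le> M * norm c0 + M * norm c1 + M * I - K\<^sup>2 * I + K\<^sup>2 * I"
        using K0 I0 s by (intro add_mono diff_mono mult_right_mono)
          (auto simp: M_def add_divide_distrib distrib_left power2_eq_square intro!: add_nonneg_nonneg)
      also have "\<dots> = M * (norm c0 + norm c1 + I)" by (simp add: algebra_simps)
      finally show ?thesis .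
    qed
    have sb: "complex_of_real (ssol E b) \<noteq> 0" using S by simp
    have Vb: "V b = (c1 - of_real (csol E b) * (c0 + A)) / of_real (ssol E b)"
      by (simp add: V_def d_def B_def)
    have Ub: "U b = c0 + A" by (simp add: U_def A_def)
    have \<psi>b: "\<psi> b = c1" using sb by (simp add: \<psi>_def Vb Ub)
    have SV: "of_real (ssol E b) * V b = c1 - of_real (csol E b) * (c0 + A)" using sb by (simp add: Vb)
    have "of_real (ssol E b) * d\<psi> b = of_real (csol E b) * (of_real (ssol E b) * V b) -
        of_real E * of_real (ssol E b) * of_real (ssol E b) * U b"
      by (simp add: d\<psi>_def algebra_simps)
    also have "\<dots> = of_real (csol E b) * (c1 - of_real (csol E b) * (c0 + A)) -
        of_real E * of_real (ssol E b) * of_real (ssol E b) * (c0 + A)"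
      by (simp only: SV Ub)
    also have "\<dots> = of_real (csol E b) * c1 - (of_real (csol E b) * of_real (csol E b) + of_real E * of_real (ssol E b) * of_real (ssol E b)) * (c0 + A)"
      by (simp add: algebra_simps)
    also have "\<dots> = of_real (csol E b) * c1 - c0 - A" by (simp add: csol_square)
    finally have d\<psi>b: "d\<psi> b = (of_real (csol E b) * c1 - c0 - A) / of_real (ssol E b)"
      using sb by (simp add: field_simps)
    have KM: "K * I \<le> M * I" by (intro mult_right_mono M I0)
    show "norm (integral {0..b} (\<lambda>s. of_real (ssol E s) * f s)) \<le> M * integral {0..b} (\<lambda>s. norm (f s))"
      "norm (integral {0..b} (\<lambda>s. of_real (csol E s) * f s)) \<le> M * integral {0..b} (\<lambda>s. norm (f s))"
      using A[OF bb] B[OF bb] KM by (auto simp: I_def)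
    have "edge_solution E b f c0 c1 \<psi> d\<psi>"
      unfolding edge_solution_def
    proof (intro conjI ballI)
      fix t assume t: "t \<in> {0..b}"
      show "(\<psi> has_vector_derivative d\<psi> t) (at t within {0..b})"
        using variation_of_constants(1)[OF b f t, where c = c0 and d = d and E = E]
        unfolding \<psi>_def d\<psi>_def U_def V_def .
      show "d\<psi> t = d\<psi> 0 - integral {0..t} (\<lambda>s. f s + of_real E * \<psi> s)"
        using variation_of_constants(2)[OF b f t, where c = c0 and d = d and E = E]
        unfolding \<psi>_def d\<psi>_def U_def V_def .
    qed (use \<psi>b d\<psi>b in \<open>auto simp: \<psi>_def d\<psi>_def U_def V_def d_def A_def B_def\<close>)
    then show "\<exists>\<psi> d\<psi>. edge_solution E b f c0 c1 \<psi> d\<psi> \<and>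
       (\<forall>t\<in>{0..b}. norm (\<psi> t) \<le> M * (norm c0 + norm c1 + integral {0..b} (\<lambda>s. norm (f s))))"
      using \<psi>_bound unfolding I_def by blast
  qed
qed

section \<open>Square integrable functions on the graph and approximate eigenvalues\<close>

lemma edge_L2_sq_nonneg: "0 \<le> edge_L2_sq a f e"
  unfolding edge_L2_sq_def
  \<comment> \<open>If the square is not integrable, the integral is 0 by convention.\<close>
  by (cases "(\<lambda>t. (norm (f e t))\<^sup>2) integrable_on {0..a (snd e)}")
    (auto intro: integral_nonneg simp: not_integrable_integral)

lemma in_L2D:
  assumes "in_L2 a f"
  shows "f e measurable_on {0..a (snd e)}" "(\<lambda>t. (norm (f e t))\<^sup>2) integrable_on {0..a (snd e)}"
    "edge_L2_sq a f summable_on UNIV"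
  using assms unfolding in_L2_def by blast+

text \<open>The norm on the graph is the l2 norm of the family of edge norms. This lemma and the
  next translate between infinite sums and \<open>l2_bounded\<close>, so that the estimates concern
  finite sums only.\<close>

lemma in_L2_l2_bounded:
  assumes "in_L2 a f"
  shows "l2_bounded (\<lambda>e. sqrt (edge_L2_sq a f e)) (L2_norm a f)"
  using assms finite_sum_le_infsum[of "edge_L2_sq a f" UNIV]
  by (auto simp: l2_bounded_def in_L2_def L2_norm_def L2_set_def edge_L2_sq_nonneg)

lemma in_L2I_l2_bounded:
  assumes "\<And>e. f e measurable_on {0..a (snd e)}"
    and "\<And>e. (\<lambda>t. (norm (f e t))\<^sup>2) integrable_on {0..a (snd e)}"
    and bd: "l2_bounded (\<lambda>e. sqrt (edge_L2_sq a f e)) M"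
  shows "in_L2 a f" "L2_norm a f \<le> M"
proof -
  have M: "0 \<le> M" using bd by (rule l2_bounded_nonneg)
  have fin: "sum (edge_L2_sq a f) F \<le> M\<^sup>2" if "finite F" for F
    using l2_boundedD[OF bd that] M sqrt_le_D
    by (auto simp: L2_set_def edge_L2_sq_nonneg)
  have sm: "edge_L2_sq a f summable_on UNIV"
    by (rule nonneg_bounded_partial_sums_imp_summable_on[where C = "M\<^sup>2"])
      (auto simp: edge_L2_sq_nonneg intro!: eventually_finite_subsets_at_top_weakI fin)
  then show "in_L2 a f" using assms by (auto simp: in_L2_def)
  have "infsum (edge_L2_sq a f) UNIV \<le> M\<^sup>2"
    by (rule infsum_le_finite_sums[OF sm]) (rule fin)
  then show "L2_norm a f \<le> M"
    using M by (simp add: L2_norm_def real_le_lsqrt infsum_nonneg edge_L2_sq_nonneg)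
qed

lemma norm_add_square_le:
  "(norm (x + y))\<^sup>2 \<le> 2 * (norm x)\<^sup>2 + 2 * (norm (y :: 'a::real_normed_vector))\<^sup>2"
proof -
  have "(norm (x + y))\<^sup>2 \<le> (norm x + norm y)\<^sup>2"
    by (intro power_mono norm_triangle_ineq) simp
  also have "\<dots> \<le> 2 * (norm x)\<^sup>2 + 2 * (norm y)\<^sup>2"
    using sum_squares_bound[of "norm x" "norm y"] by (simp add: power2_sum)
  finally show ?thesis .
qed

text \<open>A substitute for Minkowski with a loss of 2 in the squares. Integrability of the left
  side comes from measurability together with the majorant \<open>B\<close>.\<close>

lemma edge_L2_sq_add_le:
  assumes f: "f e measurable_on {0..a (snd e)}" "(\<lambda>t. (norm (f e t))\<^sup>2) integrable_on {0..a (snd e)}"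
    and g: "g e measurable_on {0..a (snd e)}" "(\<lambda>t. (norm (g e t))\<^sup>2) integrable_on {0..a (snd e)}"
  shows "(\<lambda>t. (norm (f e t + v * g e t))\<^sup>2) integrable_on {0..a (snd e)}"
    and "edge_L2_sq a (\<lambda>e t. f e t + v * g e t) e \<le> 2 * edge_L2_sq a f e + 2 * (norm v)\<^sup>2 * edge_L2_sq a g e"
    and "(\<lambda>t. f e t + v * g e t) measurable_on {0..a (snd e)}"
proof -
  show m: "(\<lambda>t. f e t + v * g e t) measurable_on {0..a (snd e)}"
    using f(1) g(1) by (simp add: measurable_on_iff_borel_measurable)
  define B where "B t = 2 * (norm (f e t))\<^sup>2 + 2 * (norm v)\<^sup>2 * (norm (g e t))\<^sup>2" for t
  have B: "(B has_integral (2 * edge_L2_sq a f e + 2 * (norm v)\<^sup>2 * edge_L2_sq a g e)) {0..a (snd e)}"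
    unfolding B_def edge_L2_sq_def using f(2) g(2)
    by (intro has_integral_add has_integral_mult_right integrable_integral)
  have le: "(norm (f e t + v * g e t))\<^sup>2 \<le> B t" for t
    unfolding B_def using norm_add_square_le[of "f e t" "v * g e t"]
    by (simp add: norm_mult power_mult_distrib)
  show i: "(\<lambda>t. (norm (f e t + v * g e t))\<^sup>2) integrable_on {0..a (snd e)}"
  proof (rule measurable_bounded_by_integrable_imp_integrable)
    show "(\<lambda>t. (norm (f e t + v * g e t))\<^sup>2) \<in> borel_measurable (lebesgue_on {0..a (snd e)})"
      using m by (simp add: measurable_on_iff_borel_measurable)
    show "B integrable_on {0..a (snd e)}" using B by blast
    show "norm ((norm (f e t + v * g e t))\<^sup>2) \<le> B t" for t using le by simp
  qed simp
  show "edge_L2_sq a (\<lambda>e t. f e t + v * g e t) e \<le> 2 * edge_L2_sq a f e + 2 * (norm v)\<^sup>2 * edge_L2_sq a g e"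
    unfolding edge_L2_sq_def[of a "\<lambda>e t. f e t + v * g e t"]
    by (rule has_integral_le[OF integrable_integral[OF i] B]) (rule le)
qed

lemma in_L2_add_scale:
  assumes "in_L2 a f" "in_L2 a g"
  shows "in_L2 a (\<lambda>e t. f e t + v * g e t)"
proof -
  note f = in_L2D[OF assms(1)] and g = in_L2D[OF assms(2)]
  note add = edge_L2_sq_add_le[where f = f and g = g and a = a, OF f(1,2) g(1,2)]
  have "(\<lambda>e. 2 * edge_L2_sq a f e + 2 * (norm v)\<^sup>2 * edge_L2_sq a g e) summable_on UNIV"
    by (intro summable_on_add summable_on_cmult_right f g)
  then have "edge_L2_sq a (\<lambda>e t. f e t + v * g e t) summable_on UNIV"
    by (rule summable_on_comparison_test) (intro add(2) edge_L2_sq_nonneg)+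
  then show ?thesis
    unfolding in_L2_def by (intro conjI allI add(1,3))
qed

lemma lattice_H_diff:
  assumes "lattice_H a \<alpha> \<psi> g" "lattice_H a \<alpha> \<phi> h"
  shows "lattice_H a \<alpha> (\<lambda>e t. \<psi> e t - \<phi> e t) (\<lambda>e t. g e t - h e t)"
proof -
  from assms(1) obtain d\<psi> where 1: "in_L2 a \<psi>" "in_L2 a g"
    "\<And>e. g e integrable_on {0..a (snd e)}"
    "\<And>e t. t\<in>{0..a (snd e)} \<Longrightarrow> (\<psi> e has_vector_derivative d\<psi> e t) (at t within {0..a (snd e)})"
    "\<And>e t. t\<in>{0..a (snd e)} \<Longrightarrow> d\<psi> e t = d\<psi> e 0 - integral {0..t} (g e)"
    "\<And>n. \<exists>c. (\<forall>j. \<psi> (n, j) 0 = c \<and> \<psi> (n - unit_step j, j) (a j) = c) \<and>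
                 (\<Sum>j\<in>UNIV. d\<psi> (n, j) 0 - d\<psi> (n - unit_step j, j) (a j)) = complex_of_real \<alpha> * c"
    unfolding lattice_H_def by blast
  from assms(2) obtain d\<phi> where 2: "in_L2 a \<phi>" "in_L2 a h"
    "\<And>e. h e integrable_on {0..a (snd e)}"
    "\<And>e t. t\<in>{0..a (snd e)} \<Longrightarrow> (\<phi> e has_vector_derivative d\<phi> e t) (at t within {0..a (snd e)})"
    "\<And>e t. t\<in>{0..a (snd e)} \<Longrightarrow> d\<phi> e t = d\<phi> e 0 - integral {0..t} (h e)"
    "\<And>n. \<exists>c. (\<forall>j. \<phi> (n, j) 0 = c \<and> \<phi> (n - unit_step j, j) (a j) = c) \<and>
                 (\<Sum>j\<in>UNIV. d\<phi> (n, j) 0 - d\<phi> (n - unit_step j, j) (a j)) = complex_of_real \<alpha> * c"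
    unfolding lattice_H_def by blast
  show ?thesis unfolding lattice_H_def
  proof (intro conjI exI[of _ "\<lambda>e t. d\<psi> e t - d\<phi> e t"] allI ballI)
    show "in_L2 a (\<lambda>e t. \<psi> e t - \<phi> e t)" using in_L2_add_scale[OF 1(1) 2(1), of "-1"] by simp
    show "in_L2 a (\<lambda>e t. g e t - h e t)" using in_L2_add_scale[OF 1(2) 2(2), of "-1"] by simp
    fix e
    show "(\<lambda>t. g e t - h e t) integrable_on {0..a (snd e)}" by (intro integrable_diff 1 2)
    fix t assume t: "t \<in> {0..a (snd e)}"
    show "((\<lambda>t. \<psi> e t - \<phi> e t) has_vector_derivative d\<psi> e t - d\<phi> e t) (at t within {0..a (snd e)})"
      by (intro has_vector_derivative_diff 1(4) 2(4) t)
    have "g e integrable_on {0..t}" "h e integrable_on {0..t}"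
      using t by (auto intro!: integrable_on_subinterval[OF 1(3)] integrable_on_subinterval[OF 2(3)])
    then show "d\<psi> e t - d\<phi> e t = d\<psi> e 0 - d\<phi> e 0 - integral {0..t} (\<lambda>t. g e t - h e t)"
      by (simp add: integral_diff 1(5)[OF t] 2(5)[OF t])
  next
    fix n
    from 1(6)[of n] obtain c where c: "\<forall>j. \<psi> (n, j) 0 = c \<and> \<psi> (n - unit_step j, j) (a j) = c"
      "(\<Sum>j\<in>UNIV. d\<psi> (n, j) 0 - d\<psi> (n - unit_step j, j) (a j)) = complex_of_real \<alpha> * c" by blast
    from 2(6)[of n] obtain d where d: "\<forall>j. \<phi> (n, j) 0 = d \<and> \<phi> (n - unit_step j, j) (a j) = d"
      "(\<Sum>j\<in>UNIV. d\<phi> (n, j) 0 - d\<phi> (n - unit_step j, j) (a j)) = complex_of_real \<alpha> * d" by blast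
    have "(\<Sum>j\<in>UNIV. d\<psi> (n, j) 0 - d\<phi> (n, j) 0 - (d\<psi> (n - unit_step j, j) (a j) - d\<phi> (n - unit_step j, j) (a j)))
      = (\<Sum>j\<in>UNIV. d\<psi> (n, j) 0 - d\<psi> (n - unit_step j, j) (a j)) - (\<Sum>j\<in>UNIV. d\<phi> (n, j) 0 - d\<phi> (n - unit_step j, j) (a j))"
      by (simp add: sum_subtractf)
    also have "\<dots> = complex_of_real \<alpha> * (c - d)" unfolding c(2) d(2) by (simp add: algebra_simps)
    finally show "\<exists>c. (\<forall>j. \<psi> (n, j) 0 - \<phi> (n, j) 0 = c \<and> \<psi> (n - unit_step j, j) (a j) - \<phi> (n - unit_step j, j) (a j) = c) \<and>
      (\<Sum>j\<in>UNIV. d\<psi> (n, j) 0 - d\<phi> (n, j) 0 - (d\<psi> (n - unit_step j, j) (a j) - d\<phi> (n - unit_step j, j) (a j))) = complex_of_real \<alpha> * c"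
      using c(1) d(1) by (intro exI[of _ "c - d"]) auto
  qed
qed

text \<open>Weyl's criterion for approximate eigenvalues, with the smallness required edge by edge.\<close>
definition approx_eigenvalue :: "('d::finite \<Rightarrow> real) \<Rightarrow> real \<Rightarrow> real \<Rightarrow> bool" where
  "approx_eigenvalue a \<alpha> E \<longleftrightarrow> (\<forall>\<epsilon>>0. \<exists>\<psi> g. lattice_H a \<alpha> \<psi> g \<and>
     (\<forall>e. edge_L2_sq a (\<lambda>e t. g e t - of_real E * \<psi> e t) e \<le> \<epsilon> * edge_L2_sq a \<psi> e) \<and>
     (\<exists>e. 0 < edge_L2_sq a \<psi> e))"

text \<open>A quasimode for a nearby \<open>E'\<close> also serves \<open>E\<close>, since changing
  the energy adds a small multiple of the quasimode itself to the error. This is what reaches the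
  Dirichlet energies.\<close>

lemma approx_eigenvalue_closed:
  assumes "\<And>\<delta>. \<delta> > 0 \<Longrightarrow> \<exists>E'. \<bar>E' - E\<bar> < \<delta> \<and> approx_eigenvalue a \<alpha> E'"
  shows "approx_eigenvalue a \<alpha> E"
  unfolding approx_eigenvalue_def
proof (intro allI impI)
  fix \<epsilon> :: real assume \<epsilon>: "\<epsilon> > 0"
  \<comment> \<open>The error of the quasimode and the energy shift each get \<epsilon> / 4 in
    square; the factor 2 from \<open>edge_L2_sq_add_le\<close> brings their sum to
    \<epsilon>.\<close>
  then have "sqrt (\<epsilon> / 4) > 0" by simp
  then obtain E' where E': "\<bar>E' - E\<bar> < sqrt (\<epsilon> / 4)" "approx_eigenvalue a \<alpha> E'"
    using assms by blast
  from E'(1) have "\<bar>E' - E\<bar>\<^sup>2 < (sqrt (\<epsilon> / 4))\<^sup>2" by (intro power_strict_mono) auto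
  then have sq: "(E' - E)\<^sup>2 \<le> \<epsilon> / 4" using \<epsilon> by simp
  have "\<epsilon> / 4 > 0" using \<epsilon> by simp
  then obtain \<psi> g where *: "lattice_H a \<alpha> \<psi> g"
    "\<And>e. edge_L2_sq a (\<lambda>e t. g e t - of_real E' * \<psi> e t) e \<le> \<epsilon> / 4 * edge_L2_sq a \<psi> e"
    "\<exists>e. 0 < edge_L2_sq a \<psi> e"
    using E'(2) unfolding approx_eigenvalue_def by blast
  have L: "in_L2 a \<psi>" "in_L2 a g" using *(1) by (auto simp: lattice_H_def)
  have "edge_L2_sq a (\<lambda>e t. g e t - of_real E * \<psi> e t) e \<le> \<epsilon> * edge_L2_sq a \<psi> e" for e
  proof -
    define f where "f e t = g e t - of_real E' * \<psi> e t" for e t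
    have f: "in_L2 a f" using in_L2_add_scale[OF L(2,1), of "- of_real E'"] by (simp add: f_def[abs_def])
    have "(\<lambda>e t. g e t - of_real E * \<psi> e t) = (\<lambda>e t. f e t + of_real (E' - E) * \<psi> e t)"
      by (simp add: f_def fun_eq_iff algebra_simps)
    then have "edge_L2_sq a (\<lambda>e t. g e t - of_real E * \<psi> e t) e
        \<le> 2 * edge_L2_sq a f e + 2 * (norm (complex_of_real (E' - E)))\<^sup>2 * edge_L2_sq a \<psi> e"
      using edge_L2_sq_add_le(2)[where f = f and g = \<psi> and a = a and e = e and v = "of_real (E' - E)",
          OF in_L2D(1,2)[OF f] in_L2D(1,2)[OF L(1)]] by simp
    also have "(norm (complex_of_real (E' - E)))\<^sup>2 = (E' - E)\<^sup>2" by (simp only: norm_of_real power2_abs)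
    also have "2 * edge_L2_sq a f e + 2 * (E' - E)\<^sup>2 * edge_L2_sq a \<psi> e
        \<le> 2 * (\<epsilon> / 4 * edge_L2_sq a \<psi> e) + 2 * (\<epsilon> / 4) * edge_L2_sq a \<psi> e"
      using *(2)[of e] sq
      by (intro add_mono mult_left_mono mult_right_mono edge_L2_sq_nonneg) (auto simp: f_def[abs_def])
    finally show ?thesis by simp
  qed
  with *(1,3) show "\<exists>\<psi> g. lattice_H a \<alpha> \<psi> g \<and>
     (\<forall>e. edge_L2_sq a (\<lambda>e t. g e t - of_real E * \<psi> e t) e \<le> \<epsilon> * edge_L2_sq a \<psi> e) \<and>
     (\<exists>e. 0 < edge_L2_sq a \<psi> e)" by blast
qed

text \<open>Were \<open>E\<close> in the resolvent set, the error \<open>f\<close> of a quasimode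
  would have a controlled solution \<open>\<phi>\<close>, and injectivity would identify it with the
  quasimode. Its norm would then be at most half of itself.\<close>

lemma approx_eigenvalue_imp_spectrum:
  assumes "approx_eigenvalue a \<alpha> E"
  shows "E \<in> lattice_spectrum a \<alpha>"
proof -
  have False if R: "lattice_resolvent a \<alpha> E"
  proof -
    from R obtain C0 where C0: "\<And>f. in_L2 a f \<Longrightarrow> \<exists>\<psi>. lattice_H a \<alpha> \<psi> (\<lambda>e t. f e t + of_real E * \<psi> e t) \<and>
       L2_norm a \<psi> \<le> C0 * L2_norm a f"
      and inj: "\<And>\<psi>. lattice_H a \<alpha> \<psi> (\<lambda>e t. of_real E * \<psi> e t) \<Longrightarrow> \<forall>e. \<forall>t\<in>{0..a (snd e)}. \<psi> e t = 0"
      unfolding lattice_resolvent_def by blast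
    \<comment> \<open>The constant supplied by the resolvent may be nonpositive; this enlargement
      can be divided by.\<close>
    define C where "C = \<bar>C0\<bar> + 1"
    have C: "C > 0" "C0 \<le> C" by (auto simp: C_def)
    \<comment> \<open>Taking roots, the error norm is at most the norm of \<open>\<psi>\<close>
      divided by 2 C.\<close>
    define \<epsilon> where "\<epsilon> = 1 / (4 * C\<^sup>2)"
    have "\<epsilon> > 0" using C by (simp add: \<epsilon>_def)
    then obtain \<psi> g where *: "lattice_H a \<alpha> \<psi> g"
      "\<And>e. edge_L2_sq a (\<lambda>e t. g e t - of_real E * \<psi> e t) e \<le> \<epsilon> * edge_L2_sq a \<psi> e"
      "\<exists>e. 0 < edge_L2_sq a \<psi> e"
      using assms unfolding approx_eigenvalue_def by blast
    have L: "in_L2 a \<psi>" "in_L2 a g" using *(1) by (auto simp: lattice_H_def)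
    define f where "f e t = g e t - of_real E * \<psi> e t" for e t
    have f: "in_L2 a f" using in_L2_add_scale[OF L(2,1), of "- of_real E"] by (simp add: f_def[abs_def])
    obtain \<phi> where \<phi>: "lattice_H a \<alpha> \<phi> (\<lambda>e t. f e t + of_real E * \<phi> e t)" "L2_norm a \<phi> \<le> C0 * L2_norm a f"
      using C0[OF f] by blast
    have "lattice_H a \<alpha> (\<lambda>e t. \<psi> e t - \<phi> e t) (\<lambda>e t. of_real E * (\<psi> e t - \<phi> e t))"
      using lattice_H_diff[OF *(1) \<phi>(1)] by (simp add: f_def algebra_simps)
    then have "\<forall>e. \<forall>t\<in>{0..a (snd e)}. \<psi> e t = \<phi> e t" using inj by fastforce
    then have "edge_L2_sq a \<psi> = edge_L2_sq a \<phi>"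
      by (auto simp: edge_L2_sq_def fun_eq_iff intro!: integral_cong)
    then have eq: "L2_norm a \<psi> = L2_norm a \<phi>" by (simp add: L2_norm_def)
    have sm: "edge_L2_sq a \<psi> summable_on UNIV" "edge_L2_sq a f summable_on UNIV"
      using L f by (auto simp: in_L2_def)
    have pos: "0 < infsum (edge_L2_sq a \<psi>) UNIV"
    proof -
      obtain e where "0 < edge_L2_sq a \<psi> e" using *(3) by blast
      also have "\<dots> \<le> infsum (edge_L2_sq a \<psi>) UNIV"
        using finite_sum_le_infsum[OF sm(1), of "{e}"] by (simp add: edge_L2_sq_nonneg)
      finally show ?thesis .
    qed
    have "infsum (edge_L2_sq a f) UNIV \<le> infsum (\<lambda>e. \<epsilon> * edge_L2_sq a \<psi> e) UNIV"
      using *(2) sm by (intro infsum_mono summable_on_cmult_right) (auto simp: f_def[abs_def])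
    also have "\<dots> = \<epsilon> * infsum (edge_L2_sq a \<psi>) UNIV"
      by (rule infsum_cmult_right) (use sm in auto)
    finally have "L2_norm a f \<le> sqrt (\<epsilon> * infsum (edge_L2_sq a \<psi>) UNIV)"
      unfolding L2_norm_def by (rule real_sqrt_le_mono)
    also have "\<dots> = L2_norm a \<psi> / (2 * C)"
      using C by (simp add: L2_norm_def \<epsilon>_def real_sqrt_mult real_sqrt_divide)
    finally have 1: "L2_norm a f \<le> L2_norm a \<psi> / (2 * C)" .
    have 2: "0 < L2_norm a \<psi>" using pos by (simp add: L2_norm_def)
    have "0 \<le> L2_norm a f" using in_L2_l2_bounded[OF f] l2_bounded_nonneg by blast
    then have "L2_norm a \<psi> \<le> C * L2_norm a f"
      using \<phi>(2) eq C mult_right_mono[of C0 C "L2_norm a f"] by linarith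
    also have "\<dots> \<le> L2_norm a \<psi> / 2" using 1 C by (simp add: field_simps)
    finally show False using 2 by simp
  qed
  then show ?thesis by (auto simp: lattice_spectrum_def)
qed

section \<open>Resolvent set\<close>

text \<open>Vertex values determine the solution on every edge, and the vertex conditions become the
  homogeneous discrete equation. The vertex values are bounded by the trace estimate, so the maximum
  principle kills them.\<close>

lemma resolvent_injective:
  fixes a :: "'d::finite \<Rightarrow> real"
  assumes a: "\<And>j. a j > 0" and S: "\<And>j. ssol E (a j) \<noteq> 0"
    and dom: "(\<Sum>j\<in>UNIV. 2 * \<bar>1 / ssol E (a j)\<bar>) < \<alpha> + (\<Sum>j\<in>UNIV. 2 * (csol E (a j) / ssol E (a j)))"
    and H: "lattice_H a \<alpha> \<psi> (\<lambda>e t. of_real E * \<psi> e t)" and t: "t \<in> {0..a (snd e)}"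
  shows "\<psi> e t = 0"
proof -
  from H obtain d\<psi> where \<psi>: "in_L2 a \<psi>"
    "\<And>e t. t\<in>{0..a (snd e)} \<Longrightarrow> (\<psi> e has_vector_derivative d\<psi> e t) (at t within {0..a (snd e)})"
    "\<And>e t. t\<in>{0..a (snd e)} \<Longrightarrow> d\<psi> e t = d\<psi> e 0 - integral {0..t} (\<lambda>t. of_real E * \<psi> e t)"
    "\<And>n. \<exists>c. (\<forall>j. \<psi> (n, j) 0 = c \<and> \<psi> (n - unit_step j, j) (a j) = c) \<and>
                 (\<Sum>j\<in>UNIV. d\<psi> (n, j) 0 - d\<psi> (n - unit_step j, j) (a j)) = complex_of_real \<alpha> * c"
    unfolding lattice_H_def by blast
  then obtain c where c: "\<And>n j. \<psi> (n, j) 0 = c n" "\<And>n j. \<psi> (n - unit_step j, j) (a j) = c n"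
    "\<And>n. (\<Sum>j\<in>UNIV. d\<psi> (n, j) 0 - d\<psi> (n - unit_step j, j) (a j)) = complex_of_real \<alpha> * c n"
    by metis
  have sol: "\<psi> e t = \<psi> e 0 * of_real (csol E t) + d\<psi> e 0 * of_real (ssol E t)"
    "d\<psi> e t = d\<psi> e 0 * of_real (csol E t) - of_real E * \<psi> e 0 * of_real (ssol E t)"
    if "t \<in> {0..a (snd e)}" for e t
    using homogeneous_solution[of "a (snd e)" "\<psi> e" "d\<psi> e" E t] \<psi>(2,3) that by blast+
  define w where "w j = 1 / ssol E (a j)" for j
  define \<gamma> where "\<gamma> = (\<Sum>j\<in>UNIV. 2 * (csol E (a j) / ssol E (a j)))"
  have aj: "a j \<in> {0..a (snd (n, j))}" for n :: "'d \<Rightarrow> int" and j using a[of j] by simp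
  \<comment> \<open>The far end of the edge is read off from the vertex condition at the
    neighbouring vertex.\<close>
  have up: "\<psi> (n, j) (a j) = c (shift_up j n)" for n j
    using c(2)[of "shift_up j n" j] by simp
  have d0: "d\<psi> (n, j) 0 = of_real (w j) * (c (shift_up j n) - of_real (csol E (a j)) * c n)" for n j
  proof -
    have "c (shift_up j n) = c n * of_real (csol E (a j)) + d\<psi> (n, j) 0 * of_real (ssol E (a j))"
      using sol(1)[OF aj[of j n]] by (simp add: up c(1))
    then show ?thesis using S[of j] by (simp add: w_def field_simps)
  qed
  have d1: "d\<psi> (n, j) (a j) = of_real (w j) * (of_real (csol E (a j)) * c (shift_up j n) - c n)" for n j
  proof -
    have "d\<psi> (n, j) (a j) = d\<psi> (n, j) 0 * of_real (csol E (a j)) - of_real E * c n * of_real (ssol E (a j))"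
      using sol(2)[OF aj[of j n]] by (simp add: c(1))
    then have x: "of_real (ssol E (a j)) * d\<psi> (n, j) (a j) = of_real (ssol E (a j)) *
        (d\<psi> (n, j) 0 * of_real (csol E (a j)) - of_real E * c n * of_real (ssol E (a j)))"
      by simp
    have "of_real (ssol E (a j)) * d\<psi> (n, j) (a j)
       = (d\<psi> (n, j) 0 * of_real (ssol E (a j))) * of_real (csol E (a j)) -
         of_real E * of_real (ssol E (a j)) * of_real (ssol E (a j)) * c n"
      unfolding x by (simp add: algebra_simps)
    also have "d\<psi> (n, j) 0 * of_real (ssol E (a j)) = c (shift_up j n) - of_real (csol E (a j)) * c n"
      using S[of j] by (simp add: d0 w_def field_simps)
    also have "(c (shift_up j n) - of_real (csol E (a j)) * c n) * of_real (csol E (a j)) -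
         of_real E * of_real (ssol E (a j)) * of_real (ssol E (a j)) * c n
       = of_real (csol E (a j)) * c (shift_up j n) - (of_real (csol E (a j)) * of_real (csol E (a j)) +
          of_real E * of_real (ssol E (a j)) * of_real (ssol E (a j))) * c n"
      by (simp add: algebra_simps)
    also have "\<dots> = of_real (csol E (a j)) * c (shift_up j n) - c n" by (simp add: csol_square)
    finally show ?thesis using S[of j] by (simp add: w_def field_simps)
  qed
  have eq: "of_real (\<alpha> + \<gamma>) * c n = (\<Sum>j\<in>UNIV. of_real (w j) * (c (shift_up j n) + c (n - unit_step j)))" for n
  proof -
    have "of_real \<alpha> * c n = (\<Sum>j\<in>UNIV. of_real (w j) * (c (shift_up j n) + c (n - unit_step j)) -
       of_real (2 * (csol E (a j) / ssol E (a j))) * c n)"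
      unfolding c(3)[symmetric] d0 d1 by (intro sum.cong refl) (simp add: w_def algebra_simps)
    also have "\<dots> = (\<Sum>j\<in>UNIV. of_real (w j) * (c (shift_up j n) + c (n - unit_step j))) - of_real \<gamma> * c n"
      by (simp add: sum_subtractf \<gamma>_def sum_distrib_right)
    finally show ?thesis by (simp add: algebra_simps)
  qed
  \<comment> \<open>One fixed direction suffices: every vertex starts an edge in it, and all these
    edges have the same length and hence the same trace constant.\<close>
  obtain j0 :: 'd where True by simp
  obtain K where K: "K \<ge> 0" "\<And>\<psi> d\<psi> :: real \<Rightarrow> complex.
    (\<forall>t\<in>{0..a j0}. (\<psi> has_vector_derivative d\<psi> t) (at t within {0..a j0}) \<and>
       d\<psi> t = d\<psi> 0 - integral {0..t} (\<lambda>t. of_real E * \<psi> t)) \<Longrightarrow>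
    norm (\<psi> 0) \<le> K * (a j0 + integral {0..a j0} (\<lambda>t. (norm (\<psi> t))\<^sup>2))"
    using homogeneous_trace_bound[OF a[of j0], of E] by blast
  have bd: "norm (c n) \<le> K * (a j0 + infsum (edge_L2_sq a \<psi>) UNIV)" for n
  proof -
    have "norm (c n) \<le> K * (a j0 + edge_L2_sq a \<psi> (n, j0))"
    proof -
      have "norm (\<psi> (n, j0) 0) \<le> K * (a j0 + integral {0..a j0} (\<lambda>t. (norm (\<psi> (n, j0) t))\<^sup>2))"
      proof (rule K(2)[of "\<psi> (n, j0)" "d\<psi> (n, j0)"], intro ballI conjI)
        fix t assume "t \<in> {0..a j0}"
        then have t: "t \<in> {0..a (snd (n, j0))}" by simp
        show "(\<psi> (n, j0) has_vector_derivative d\<psi> (n, j0) t) (at t within {0..a j0})"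
          using \<psi>(2)[OF t] by simp
        show "d\<psi> (n, j0) t = d\<psi> (n, j0) 0 - integral {0..t} (\<lambda>t. of_real E * \<psi> (n, j0) t)"
          by (rule \<psi>(3)[OF t])
      qed
      then show ?thesis by (simp only: c(1) edge_L2_sq_def snd_conv)
    qed
    also have "\<dots> \<le> K * (a j0 + infsum (edge_L2_sq a \<psi>) UNIV)"
      using finite_sum_le_infsum[OF in_L2D(3)[OF \<psi>(1)], of "{(n, j0)}"] K(1)
      by (intro mult_left_mono add_left_mono) (auto simp: edge_L2_sq_nonneg)
    finally show ?thesis .
  qed
  have c0: "c n = 0" for n
    by (rule discrete_injective[where w = w and \<beta> = "\<alpha> + \<gamma>", OF _ bd eq]) (use dom in \<open>simp add: w_def \<gamma>_def\<close>)
  obtain n j where e: "e = (n, j)" by force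
  have "d\<psi> e 0 = 0" by (simp add: e d0 c0)
  then show ?thesis using sol(1)[OF t] by (simp add: e c(1) c0)
qed

text \<open>Inserting the slopes of the edge solutions into the vertex conditions leaves a discrete
  equation for the unknown vertex values, whose source collects the moments of \<open>f\<close>.
  Once it is solved, the edge solutions with these boundary values fit together.\<close>

lemma resolvent_surjective:
  fixes a :: "'d::finite \<Rightarrow> real"
  assumes a: "\<And>j. a j > 0" and S: "\<And>j. ssol E (a j) \<noteq> 0"
    and dom: "(\<Sum>j\<in>UNIV. 2 * \<bar>1 / ssol E (a j)\<bar>) < \<alpha> + (\<Sum>j\<in>UNIV. 2 * (csol E (a j) / ssol E (a j)))"
  shows "\<exists>C. \<forall>f. in_L2 a f \<longrightarrow>
    (\<exists>\<psi>. lattice_H a \<alpha> \<psi> (\<lambda>e t. f e t + of_real E * \<psi> e t) \<and> L2_norm a \<psi> \<le> C * L2_norm a f)"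
proof -
  define w where "w j = 1 / ssol E (a j)" for j
  define q where "q j = csol E (a j) / ssol E (a j)" for j
  define \<gamma> where "\<gamma> = (\<Sum>j\<in>UNIV. 2 * q j)"
  define \<beta> where "\<beta> = \<alpha> + \<gamma>"
  define \<kappa> where "\<kappa> = (\<Sum>j\<in>UNIV. 2 * \<bar>w j\<bar>)"
  have \<kappa>: "\<kappa> < \<beta>" using dom by (simp add: \<kappa>_def \<beta>_def \<gamma>_def w_def q_def)
  \<comment> \<open>Naming the whole estimate lets one constant per direction be chosen at
    once.\<close>
  define \<Phi> where "\<Phi> j M \<longleftrightarrow> (\<forall>f c0 c1. f absolutely_integrable_on {0..a j} \<longrightarrow>
     norm (integral {0..a j} (\<lambda>s. of_real (ssol E s) * f s)) \<le> M * integral {0..a j} (\<lambda>s. norm (f s)) \<and>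
     norm (integral {0..a j} (\<lambda>s. of_real (csol E s) * f s)) \<le> M * integral {0..a j} (\<lambda>s. norm (f s)) \<and>
     (\<exists>\<psi> d\<psi>. edge_solution E (a j) f c0 c1 \<psi> d\<psi> \<and>
       (\<forall>t\<in>{0..a j}. norm (\<psi> t) \<le> M * (norm c0 + norm c1 + integral {0..a j} (\<lambda>s. norm (f s))))))" for j M
  have "\<exists>M\<ge>0. \<Phi> j M" for j unfolding \<Phi>_def by (rule edge_boundary_problem[OF a S])
  then obtain M where M0: "\<And>j. 0 \<le> M j" and M\<Phi>: "\<And>j. \<Phi> j (M j)" by metis
  have M: "norm (integral {0..a j} (\<lambda>s. of_real (ssol E s) * f s)) \<le> M j * integral {0..a j} (\<lambda>s. norm (f s))"
      "norm (integral {0..a j} (\<lambda>s. of_real (csol E s) * f s)) \<le> M j * integral {0..a j} (\<lambda>s. norm (f s))"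
      "\<exists>\<psi> d\<psi>. edge_solution E (a j) f c0 c1 \<psi> d\<psi> \<and>
       (\<forall>t\<in>{0..a j}. norm (\<psi> t) \<le> M j * (norm c0 + norm c1 + integral {0..a j} (\<lambda>s. norm (f s))))"
    if "f absolutely_integrable_on {0..a j}" for j f c0 c1
    using M\<Phi>[of j] that unfolding \<Phi>_def by blast+
  \<comment> \<open>With finitely many directions, sums over them serve as constants valid on every
    edge.\<close>
  define MM where "MM = (\<Sum>j\<in>UNIV. M j)"
  have MM: "M j \<le> MM" for j unfolding MM_def by (rule member_le_sum) (auto simp: M0)
  have MM0: "0 \<le> MM" unfolding MM_def by (intro sum_nonneg M0)
  define R where "R = (\<Sum>j\<in>UNIV. sqrt (a j))"
  have R: "sqrt (a j) \<le> R" for j unfolding R_def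
    by (rule member_le_sum) (auto intro: less_imp_le a)
  have R0: "0 \<le> R" unfolding R_def by (intro sum_nonneg) (auto intro: less_imp_le a)
  define D where "D = (\<Sum>j\<in>UNIV. 1 + \<bar>q j\<bar> + \<bar>w j\<bar>)"
  \<comment> \<open>\<open>R * MM\<close> turns boundary values and forcing into an edge norm. The
    bracket adds the vertex values at the two ends of an edge, each counted over all directions, and
    the integral of |f|.\<close>
  define C where "C = R * MM * (CARD('d) * (MM * R * D / (\<beta> - \<kappa>)) + CARD('d) * (MM * R * D / (\<beta> - \<kappa>)) + R)"
  show ?thesis
  proof (intro exI[of _ C] allI impI)
    fix f assume f: "in_L2 a f"
    define N where "N = L2_norm a f"
    note fD = in_L2D[OF f]
    have fabs: "f e absolutely_integrable_on {0..a (snd e)}" for e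
      by (rule square_integrable_imp_absolutely_integrable[OF fD(1,2)])
    define I where "I e = integral {0..a (snd e)} (\<lambda>s. norm (f e s))" for e
    have I0: "0 \<le> I e" for e unfolding I_def
      using fabs[of e] by (intro integral_nonneg) (auto simp: absolutely_integrable_on_def)
    have I_le: "I e \<le> R * sqrt (edge_L2_sq a f e)" for e
    proof -
      have "I e = sqrt ((I e)\<^sup>2)" using I0 by simp
      also have "\<dots> \<le> sqrt (a (snd e) * edge_L2_sq a f e)"
        unfolding I_def edge_L2_sq_def
        by (intro real_sqrt_le_mono square_integral_norm_le fD a)
      also have "\<dots> = sqrt (a (snd e)) * sqrt (edge_L2_sq a f e)" by (rule real_sqrt_mult)
      also have "\<dots> \<le> R * sqrt (edge_L2_sq a f e)"
        by (intro mult_right_mono R) (simp add: edge_L2_sq_nonneg)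
      finally show ?thesis .
    qed
    have I_bd: "l2_bounded I (R * N)"
    proof (rule l2_bounded_mono)
      show "l2_bounded (\<lambda>e. R * sqrt (edge_L2_sq a f e)) (R * N)"
        unfolding N_def using R0 by (intro l2_bounded_scale in_L2_l2_bounded f) simp
      show "norm (I e) \<le> norm (R * sqrt (edge_L2_sq a f e))" for e
        using I_le[of e] I0[of e] by simp
    qed
    define A where "A e = integral {0..a (snd e)} (\<lambda>s. of_real (ssol E s) * f e s)" for e
    define B where "B e = integral {0..a (snd e)} (\<lambda>s. of_real (csol E s) * f e s)" for e
    define Q where "Q = MM * (R * N)"
    have MI: "l2_bounded (\<lambda>e. MM * I e) Q"
      unfolding Q_def using MM0 by (intro l2_bounded_scale I_bd) simp
    have "norm (A e) \<le> M (snd e) * I e \<and> norm (B e) \<le> M (snd e) * I e" for e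
      unfolding A_def B_def I_def by (intro conjI M fabs)
    moreover have "M (snd e) * I e \<le> norm (MM * I e)" for e
      using MM0 mult_right_mono[OF MM I0[of e]] I0[of e] by (simp add: abs_mult)
    ultimately have AB: "norm (A e) \<le> norm (MM * I e)" "norm (B e) \<le> norm (MM * I e)" for e
      by (meson order_trans)+
    have A: "l2_bounded A Q" and B: "l2_bounded B Q"
      by (rule l2_bounded_mono[OF MI], rule AB)+
    \<comment> \<open>The part of the slope sum due to \<open>f\<close>: B - q A from the outgoing
      edge, w A from the incoming one.\<close>
    define r where "r n = (\<Sum>j\<in>UNIV. B (n, j) + of_real (- q j) * A (n, j) + of_real (w j) * A (n - unit_step j, j))" for n
    have "l2_bounded r (\<Sum>j\<in>UNIV. Q + \<bar>q j\<bar> * Q + \<bar>w j\<bar> * Q)"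
      unfolding r_def
    proof (intro l2_bounded_sum l2_bounded_add l2_bounded_scale)
      fix j :: 'd
      show "l2_bounded (\<lambda>n. B (n, j)) Q" "l2_bounded (\<lambda>n. A (n, j)) Q"
        by (rule l2_bounded_reindex[OF B] l2_bounded_reindex[OF A], simp add: inj_def)+
      show "l2_bounded (\<lambda>n. A (n - unit_step j, j)) Q"
        by (rule l2_bounded_reindex[OF A]) (use inj_shift(2)[of j] in \<open>auto simp: inj_def\<close>)
    qed auto
    also have "(\<Sum>j\<in>UNIV. Q + \<bar>q j\<bar> * Q + \<bar>w j\<bar> * Q) = Q * D"
      by (simp add: D_def sum_distrib_left algebra_simps)
    finally have r: "l2_bounded r (Q * D)" .
    obtain c where c: "l2_bounded c (Q * D / (\<beta> - \<kappa>))"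
      "\<And>n. of_real \<beta> * c n = r n + (\<Sum>j\<in>UNIV. of_real (w j) * (c (shift_up j n) + c (n - unit_step j)))"
      using discrete_resolvent[OF \<kappa>[unfolded \<kappa>_def] r] unfolding \<kappa>_def by blast
    define Nc where "Nc = Q * D / (\<beta> - \<kappa>)"
    define \<Psi> where "\<Psi> e \<psi> d\<psi> \<longleftrightarrow> edge_solution E (a (snd e)) (f e) (c (fst e)) (c (shift_up (snd e) (fst e))) \<psi> d\<psi> \<and>
       (\<forall>t\<in>{0..a (snd e)}. norm (\<psi> t) \<le> M (snd e) * (norm (c (fst e)) + norm (c (shift_up (snd e) (fst e))) + I e))" for e \<psi> d\<psi>
    have "\<exists>\<psi> d\<psi>. \<Psi> e \<psi> d\<psi>" for e unfolding \<Psi>_def I_def by (rule M(3)[OF fabs])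
    then obtain \<psi> d\<psi> where \<Psi>: "\<And>e. \<Psi> e (\<psi> e) (d\<psi> e)" by metis
    have es: "edge_solution E (a (snd e)) (f e) (c (fst e)) (c (shift_up (snd e) (fst e))) (\<psi> e) (d\<psi> e)"
      and \<psi>_le: "t\<in>{0..a (snd e)} \<Longrightarrow> norm (\<psi> e t) \<le> M (snd e) * (norm (c (fst e)) + norm (c (shift_up (snd e) (fst e))) + I e)"
      for e t
      using \<Psi>[of e] unfolding \<Psi>_def by blast+
    have \<psi>:
      "\<And>t. t\<in>{0..a (snd e)} \<Longrightarrow> (\<psi> e has_vector_derivative d\<psi> e t) (at t within {0..a (snd e)})"
      "\<And>t. t\<in>{0..a (snd e)} \<Longrightarrow> d\<psi> e t = d\<psi> e 0 - integral {0..t} (\<lambda>s. f e s + of_real E * \<psi> e s)"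
      "\<psi> e 0 = c (fst e)" "\<psi> e (a (snd e)) = c (shift_up (snd e) (fst e))"
      "d\<psi> e 0 = (c (shift_up (snd e) (fst e)) - of_real (csol E (a (snd e))) * (c (fst e) + A e)) / of_real (ssol E (a (snd e))) + B e"
      "d\<psi> e (a (snd e)) = (of_real (csol E (a (snd e))) * c (shift_up (snd e) (fst e)) - c (fst e) - A e) / of_real (ssol E (a (snd e)))"
      for e
      using es[of e] unfolding edge_solution_def A_def B_def by blast+
    have cont: "continuous_on {0..a (snd e)} (\<psi> e)" for e
      by (rule continuous_on_vector_derivative) (rule \<psi>(1))
    have meas: "\<psi> e measurable_on {0..a (snd e)}" for e
      by (simp add: measurable_on_iff_borel_measurable continuous_imp_measurable_on_sets_lebesgue cont)
    have int: "(\<lambda>t. (norm (\<psi> e t))\<^sup>2) integrable_on {0..a (snd e)}" for e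
      by (intro integrable_continuous_real continuous_intros cont)
    define z where "z e = norm (c (fst e)) + norm (c (shift_up (snd e) (fst e))) + I e" for e
    have z0: "0 \<le> z e" for e using I0[of e] by (simp add: z_def)
    have edge: "sqrt (edge_L2_sq a \<psi> e) \<le> R * MM * z e" for e
    proof -
      have "edge_L2_sq a \<psi> e \<le> integral {0..a (snd e)} (\<lambda>t. (MM * z e)\<^sup>2)"
        unfolding edge_L2_sq_def
      proof (rule integral_le[OF int])
        fix t assume "t \<in> {0..a (snd e)}"
        from \<psi>_le[OF this] have "norm (\<psi> e t) \<le> M (snd e) * z e" by (simp add: z_def)
        also have "\<dots> \<le> MM * z e" by (intro mult_right_mono MM z0)
        finally show "(norm (\<psi> e t))\<^sup>2 \<le> (MM * z e)\<^sup>2" by (intro power_mono) auto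
      qed (rule integrable_const_ivl)
      also have "\<dots> = a (snd e) * (MM * z e)\<^sup>2" using a[of "snd e"] by simp
      finally have "sqrt (edge_L2_sq a \<psi> e) \<le> sqrt (a (snd e) * (MM * z e)\<^sup>2)" by (rule real_sqrt_le_mono)
      also have "\<dots> = sqrt (a (snd e)) * (MM * z e)"
        using MM0 z0 by (simp add: real_sqrt_mult)
      also have "\<dots> \<le> R * (MM * z e)" by (intro mult_right_mono R mult_nonneg_nonneg MM0 z0)
      finally show ?thesis by (simp add: mult_ac)
    qed
    have cn: "l2_bounded (\<lambda>n. norm (c n)) Nc"
      by (rule l2_bounded_mono[OF c(1)[folded Nc_def]]) simp
    have "l2_bounded z (CARD('d) * Nc + CARD('d) * Nc + R * N)"
      unfolding z_def
    proof (intro l2_bounded_add I_bd l2_bounded_prod)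
      fix j :: 'd
      show "l2_bounded (\<lambda>x. norm (c (fst (x, j)))) Nc" using cn by simp
      show "l2_bounded (\<lambda>x. norm (c (shift_up (snd (x, j)) (fst (x, j))))) Nc"
        using l2_bounded_reindex[OF cn inj_shift(1)] by simp
    qed
    then have "l2_bounded (\<lambda>e. R * MM * z e) (R * MM * (CARD('d) * Nc + CARD('d) * Nc + R * N))"
      using R0 MM0 by (intro l2_bounded_scale) auto
    also have "R * MM * (CARD('d) * Nc + CARD('d) * Nc + R * N) = C * N"
      unfolding C_def Nc_def Q_def by (simp add: algebra_simps)
    finally have bd: "l2_bounded (\<lambda>e. sqrt (edge_L2_sq a \<psi> e)) (C * N)"
      by (rule l2_bounded_mono) (use edge R0 MM0 z0 in \<open>auto simp: edge_L2_sq_nonneg\<close>)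
    note L = in_L2I_l2_bounded[where f = \<psi> and a = a, OF meas int bd]
    have "lattice_H a \<alpha> \<psi> (\<lambda>e t. f e t + of_real E * \<psi> e t)"
      unfolding lattice_H_def
    proof (intro conjI exI[of _ d\<psi>] allI ballI)
      show "in_L2 a \<psi>" by (rule L)
      show "in_L2 a (\<lambda>e t. f e t + of_real E * \<psi> e t)" by (intro in_L2_add_scale f L)
      show "(\<lambda>t. f e t + of_real E * \<psi> e t) integrable_on {0..a (snd e)}" for e
      proof (rule integrable_add)
        show "f e integrable_on {0..a (snd e)}" using fabs by (simp add: absolutely_integrable_on_def)
        show "(\<lambda>t. of_real E * \<psi> e t) integrable_on {0..a (snd e)}"
          by (intro integrable_continuous_real continuous_intros cont)
      qed
      show "(\<psi> e has_vector_derivative d\<psi> e t) (at t within {0..a (snd e)})"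
        "d\<psi> e t = d\<psi> e 0 - integral {0..t} (\<lambda>t. f e t + of_real E * \<psi> e t)"
        if t: "t \<in> {0..a (snd e)}" for e t
        by (rule \<psi>(1)[OF t], rule \<psi>(2)[OF t])
      fix n :: "'d \<Rightarrow> int"
      have "d\<psi> (n, j) 0 - d\<psi> (n - unit_step j, j) (a j) =
         of_real (w j) * (c (shift_up j n) + c (n - unit_step j)) +
         (B (n, j) + of_real (- q j) * A (n, j) + of_real (w j) * A (n - unit_step j, j)) -
         of_real (2 * q j) * c n" for j
      proof -
        have W: "x / of_real (ssol E (a j)) = of_real (w j) * x" for x :: complex
          by (simp add: w_def divide_inverse)
        have q: "complex_of_real (q j) = of_real (w j) * of_real (csol E (a j))"
          by (simp add: w_def q_def divide_inverse)
        have d0: "d\<psi> (n, j) 0 = of_real (w j) * (c (shift_up j n) - of_real (csol E (a j)) * (c n + A (n, j))) + B (n, j)"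
          unfolding W[symmetric] using \<psi>(5)[of "(n, j)"] by simp
        have d1: "d\<psi> (n - unit_step j, j) (a j) = of_real (w j) *
            (of_real (csol E (a j)) * c n - c (n - unit_step j) - A (n - unit_step j, j))"
          unfolding W[symmetric] using \<psi>(6)[of "(n - unit_step j, j)"] by simp
        show ?thesis unfolding d0 d1 q by (simp add: q algebra_simps)
      qed
      then have "(\<Sum>j\<in>UNIV. d\<psi> (n, j) 0 - d\<psi> (n - unit_step j, j) (a j)) =
         (\<Sum>j\<in>UNIV. of_real (w j) * (c (shift_up j n) + c (n - unit_step j))) + r n - of_real \<gamma> * c n"
        by (simp add: r_def \<gamma>_def sum.distrib sum_subtractf sum_distrib_right)
      also have "\<dots> = of_real \<alpha> * c n"
        using c(2)[of n] by (simp add: \<beta>_def algebra_simps)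
      finally have "(\<Sum>j\<in>UNIV. d\<psi> (n, j) 0 - d\<psi> (n - unit_step j, j) (a j)) = of_real \<alpha> * c n" .
      moreover have "\<psi> (n, j) 0 = c n" "\<psi> (n - unit_step j, j) (a j) = c n" for j
        using \<psi>(3)[of "(n, j)"] \<psi>(4)[of "(n - unit_step j, j)"] by simp_all
      ultimately show "\<exists>c. (\<forall>j. \<psi> (n, j) 0 = c \<and> \<psi> (n - unit_step j, j) (a j) = c) \<and>
         (\<Sum>j\<in>UNIV. d\<psi> (n, j) 0 - d\<psi> (n - unit_step j, j) (a j)) = of_real \<alpha> * c"
        by blast
    qed
    then show "\<exists>\<psi>. lattice_H a \<alpha> \<psi> (\<lambda>e t. f e t + of_real E * \<psi> e t) \<and> L2_norm a \<psi> \<le> C * L2_norm a f"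
      by (intro exI[of _ \<psi>] conjI L(2)[unfolded N_def])
  qed
qed

text \<open>Dominance with hopping and diagonal terms grouped by direction, the form that becomes a
  half-angle tangent.\<close>

lemma diagonally_dominant_not_in_spectrum:
  fixes a :: "'d::finite \<Rightarrow> real"
  assumes a: "\<And>j. a j > 0" and S: "\<And>j. ssol E (a j) \<noteq> 0"
    and dom: "(\<Sum>j\<in>UNIV. 2 * ((1 / \<bar>ssol E (a j)\<bar>) - csol E (a j) / ssol E (a j))) < \<alpha>"
  shows "E \<notin> lattice_spectrum a \<alpha>"
proof -
  have dom': "(\<Sum>j\<in>UNIV. 2 * \<bar>1 / ssol E (a j)\<bar>) < \<alpha> + (\<Sum>j\<in>UNIV. 2 * (csol E (a j) / ssol E (a j)))"
    using dom by (simp add: right_diff_distrib sum_subtractf)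
  have "lattice_resolvent a \<alpha> E"
    unfolding lattice_resolvent_def
    by (intro conjI allI impI ballI resolvent_surjective[OF a S dom'] resolvent_injective[OF a S dom'])
  then show ?thesis by (simp add: lattice_spectrum_def)
qed

section \<open>Bloch quasimodes\<close>

lemma sum_power_nat_abs_le:
  fixes r :: real
  assumes "0 \<le> r" "r < 1" "finite X"
  shows "(\<Sum>k\<in>X. r ^ nat \<bar>k\<bar>) \<le> 2 / (1 - r)"
proof -
  have half: "(\<Sum>k\<in>Y. r ^ nat \<bar>k\<bar>) \<le> 1 / (1 - r)" if "finite Y" "inj_on (\<lambda>k. nat \<bar>k\<bar>) Y" for Y :: "int set"
  proof -
    have "(\<Sum>k\<in>Y. r ^ nat \<bar>k\<bar>) = (\<Sum>i\<in>(\<lambda>k. nat \<bar>k\<bar>) ` Y. r ^ i)"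
      using that by (simp add: sum.reindex)
    also have "\<dots> \<le> (\<Sum>i. r ^ i)"
      using assms that by (intro sum_le_suminf summable_geometric) auto
    also have "\<dots> = 1 / (1 - r)" using assms by (intro suminf_geometric) auto
    finally show ?thesis .
  qed
  have "(\<Sum>k\<in>X. r ^ nat \<bar>k\<bar>) = (\<Sum>k\<in>X \<inter> {0..}. r ^ nat \<bar>k\<bar>) + (\<Sum>k\<in>X \<inter> {..<0}. r ^ nat \<bar>k\<bar>)"
    using assms by (subst sum.union_disjoint[symmetric]) (auto intro!: sum.cong)
  also have "\<dots> \<le> 1 / (1 - r) + 1 / (1 - r)"
    using assms by (intro add_mono half) (auto simp: inj_on_def)
  finally show ?thesis by simp
qed

text \<open>The squared weight is a product over the coordinates, so its sum over a box factors into
  one-dimensional geometric sums.\<close>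

lemma l2_bounded_exp_decay:
  assumes "s > 0"
  shows "\<exists>M. l2_bounded (\<lambda>n :: 'd::finite \<Rightarrow> int. exp (- s * (\<Sum>i\<in>UNIV. real_of_int \<bar>n i\<bar>))) M"
proof -
  define r where "r = exp (- 2 * s)"
  have r: "0 \<le> r" "r < 1" using assms by (auto simp: r_def)
  have sq: "(exp (- s * (\<Sum>i\<in>UNIV. real_of_int \<bar>n i\<bar>)))\<^sup>2 = (\<Prod>i\<in>UNIV. r ^ nat \<bar>n i\<bar>)" for n :: "'d \<Rightarrow> int"
  proof -
    have "(exp (- s * (\<Sum>i\<in>UNIV. real_of_int \<bar>n i\<bar>)))\<^sup>2 = exp (\<Sum>i\<in>UNIV. - 2 * s * real_of_int \<bar>n i\<bar>)"
      by (simp add: power2_eq_square exp_add[symmetric] sum_distrib_left sum.distrib[symmetric] sum_negf[symmetric] mult_ac)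
    also have "\<dots> = (\<Prod>i\<in>UNIV. exp (- 2 * s * real_of_int \<bar>n i\<bar>))" by (rule exp_sum) simp
    also have "\<dots> = (\<Prod>i\<in>UNIV. r ^ nat \<bar>n i\<bar>)"
      unfolding r_def by (intro prod.cong refl) (simp add: exp_of_nat_mult[symmetric] mult_ac)
    finally show ?thesis .
  qed
  define M where "M = (2 / (1 - r)) ^ CARD('d)"
  have M: "0 \<le> M" using r by (simp add: M_def)
  have "l2_bounded (\<lambda>n :: 'd \<Rightarrow> int. exp (- s * (\<Sum>i\<in>UNIV. real_of_int \<bar>n i\<bar>))) (sqrt M)"
    unfolding l2_bounded_def
  proof (intro allI impI)
    fix F :: "('d \<Rightarrow> int) set" assume F: "finite F"
    \<comment> \<open>All coordinate values occurring in \<open>F\<close>; the box with these sides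
      contains \<open>F\<close>.\<close>
    define X :: "int set" where "X = (\<Union>n\<in>F. range n)"
    have X: "finite X" using F by (auto simp: X_def)
    have "(\<Sum>n\<in>F. \<Prod>i\<in>UNIV. r ^ nat \<bar>n i\<bar>) \<le> (\<Sum>n\<in>PiE (UNIV :: 'd set) (\<lambda>_. X). \<Prod>i\<in>UNIV. r ^ nat \<bar>n i\<bar>)"
    proof (rule sum_mono2)
      show "finite (PiE (UNIV :: 'd set) (\<lambda>_. X))" using X by (intro finite_PiE) auto
      show "F \<subseteq> PiE UNIV (\<lambda>_. X)" by (auto simp: X_def)
      show "0 \<le> (\<Prod>i\<in>UNIV. r ^ nat \<bar>n i\<bar>)" for n :: "'d \<Rightarrow> int" using r by (intro prod_nonneg) auto
    qed
    also have "\<dots> = (\<Prod>i\<in>(UNIV :: 'd set). \<Sum>k\<in>X. r ^ nat \<bar>k\<bar>)"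
      by (rule prod_sum_PiE[symmetric]) (use X in auto)
    also have "\<dots> \<le> (\<Prod>i\<in>(UNIV :: 'd set). 2 / (1 - r))"
      using r X by (intro prod_mono conjI sum_power_nat_abs_le sum_nonneg) auto
    also have "\<dots> = M" by (simp add: M_def)
    finally show "L2_set (\<lambda>n. norm (exp (- s * (\<Sum>i\<in>UNIV. real_of_int \<bar>n i\<bar>)))) F \<le> sqrt M"
      unfolding L2_set_def by (intro real_sqrt_le_mono) (simp only: real_norm_def power2_abs sq)
  qed
  then show ?thesis by blast
qed

lemma in_L2_continuous:
  fixes a :: "'d::finite \<Rightarrow> real" and u :: "('d \<Rightarrow> int) \<Rightarrow> real"
  assumes a: "\<And>j. a j > 0" and cont: "\<And>e. continuous_on {0..a (snd e)} (f e)"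
    and le: "\<And>e t. t \<in> {0..a (snd e)} \<Longrightarrow> norm (f e t) \<le> u (fst e) * K"
    and u: "\<And>n. 0 \<le> u n" "l2_bounded u M" and K: "0 \<le> K"
  shows "in_L2 a f"
proof -
  define R where "R = (\<Sum>j\<in>UNIV. sqrt (a j))"
  have R: "sqrt (a j) \<le> R" for j unfolding R_def
    by (rule member_le_sum) (auto intro: less_imp_le a)
  have R0: "0 \<le> R" unfolding R_def by (intro sum_nonneg) (auto intro: less_imp_le a)
  have meas: "f e measurable_on {0..a (snd e)}" for e
    by (simp add: measurable_on_iff_borel_measurable continuous_imp_measurable_on_sets_lebesgue cont)
  have int: "(\<lambda>t. (norm (f e t))\<^sup>2) integrable_on {0..a (snd e)}" for e
    by (intro integrable_continuous_real continuous_intros cont)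
  have "sqrt (edge_L2_sq a f e) \<le> R * K * u (fst e)" for e
  proof -
    have "edge_L2_sq a f e \<le> integral {0..a (snd e)} (\<lambda>t. (u (fst e) * K)\<^sup>2)"
      unfolding edge_L2_sq_def
      by (intro integral_le[OF int] integrable_const_ivl power_mono le) auto
    also have "\<dots> = a (snd e) * (u (fst e) * K)\<^sup>2" using a[of "snd e"] by simp
    finally have "sqrt (edge_L2_sq a f e) \<le> sqrt (a (snd e) * (u (fst e) * K)\<^sup>2)" by (rule real_sqrt_le_mono)
    also have "\<dots> = sqrt (a (snd e)) * (u (fst e) * K)"
      using u K by (simp add: real_sqrt_mult)
    also have "\<dots> \<le> R * (u (fst e) * K)" by (intro mult_right_mono R mult_nonneg_nonneg u K)
    finally show ?thesis by (simp add: mult_ac)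
  qed
  then have le': "norm (sqrt (edge_L2_sq a f e)) \<le> norm (R * K * u (fst e))" for e
    using R0 K u by (simp add: edge_L2_sq_nonneg)
  have "l2_bounded (\<lambda>e :: ('d \<Rightarrow> int) \<times> 'd. R * K * u (fst e)) (R * K * (CARD('d) * M))"
    using R0 K u(2) by (intro l2_bounded_scale l2_bounded_prod) auto
  then have "l2_bounded (\<lambda>e. sqrt (edge_L2_sq a f e)) (R * K * (CARD('d) * M))"
    by (rule l2_bounded_mono) (rule le')
  then show ?thesis by (rule in_L2I_l2_bounded(1)[where f = f and a = a, OF meas int])
qed

text \<open>The quasimodes are Bloch waves multiplied by the lattice weight \<open>exp (- s \<bar>n\<bar>)\<close>, interpolated
  along each edge by a profile that is flat at the vertices, so that the vertex conditions survive.\<close>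
lemma bloch_approx_eigenvalue:
  fixes a :: "'d::finite \<Rightarrow> real"
  assumes a: "\<And>j. a j > 0" and S: "\<And>j. ssol E (a j) \<noteq> 0"
    and x: "\<And>j. \<bar>x j\<bar> \<le> 1" and disp: "(\<Sum>j\<in>UNIV. 2 * ((x j - csol E (a j)) / ssol E (a j))) = \<alpha>"
  shows "approx_eigenvalue a \<alpha> E"
proof -
  \<comment> \<open>The quasimomentum is real because |x_j| \<le> 1.\<close>
  define \<theta> where "\<theta> j = arccos (x j)" for j
  define z where "z j = cis (\<theta> j)" for j
  have z_Re: "z j + cnj (z j) = of_real (2 * x j)" and z_norm: "z j * cnj (z j) = 1" for j
    using x[of j] by (simp_all add: z_def \<theta>_def complex_eq_iff cos_arccos_abs cis_cnj cis_mult)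
  \<comment> \<open>The initial slope for which the edge solution runs from 1 to the Bloch factor
    \<open>z j\<close>.\<close>
  define m where "m j = (z j - of_real (csol E (a j))) / of_real (ssol E (a j))" for j
  have Sc: "complex_of_real (ssol E (a j)) \<noteq> 0" for j using S by simp
  define \<phi> where "\<phi> j t = of_real (csol E t) + m j * of_real (ssol E t)" for j t
  define \<phi>' where "\<phi>' j t = m j * of_real (csol E t) - of_real E * of_real (ssol E t)" for j t
  have \<phi>_deriv: "(\<phi> j has_vector_derivative \<phi>' j t) (at t within A)" for j t A
    unfolding \<phi>_def \<phi>'_def
    by (rule has_vector_derivative_eq_rhs, (rule has_vector_derivative_add has_vector_derivative_mult
          has_vector_derivative_const has_vector_derivative_csol has_vector_derivative_ssol)+) simp
  have \<phi>'_deriv: "(\<phi>' j has_vector_derivative - of_real E * \<phi> j t) (at t within A)" for j t A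
    unfolding \<phi>_def \<phi>'_def
    by (rule has_vector_derivative_eq_rhs, (rule has_vector_derivative_diff has_vector_derivative_mult
          has_vector_derivative_const has_vector_derivative_csol has_vector_derivative_ssol)+)
      (simp add: algebra_simps)
  have cont\<phi>: "continuous_on A (\<phi> j)" and cont\<phi>': "continuous_on A (\<phi>' j)" for A j
    by (rule continuous_on_vector_derivative[OF \<phi>_deriv] continuous_on_vector_derivative[OF \<phi>'_deriv])+
  have \<phi>0: "\<phi> j 0 = 1" "\<phi>' j 0 = m j" for j by (simp_all add: \<phi>_def \<phi>'_def)
  have Sm: "of_real (ssol E (a j)) * m j = z j - of_real (csol E (a j))" for j
    using Sc by (simp add: m_def)
  have \<phi>a: "\<phi> j (a j) = z j" for j using Sm[of j] by (simp add: \<phi>_def mult.commute)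
  have "of_real (ssol E (a j)) * \<phi>' j (a j) = of_real (csol E (a j)) * z j - 1" for j
  proof -
    have "of_real (ssol E (a j)) * \<phi>' j (a j) = (of_real (ssol E (a j)) * m j) * of_real (csol E (a j)) -
       of_real E * of_real (ssol E (a j)) * of_real (ssol E (a j))"
      by (simp add: \<phi>'_def algebra_simps)
    also have "\<dots> = z j * of_real (csol E (a j)) - (of_real (csol E (a j)) * of_real (csol E (a j)) +
        of_real E * of_real (ssol E (a j)) * of_real (ssol E (a j)))"
      unfolding Sm by (simp add: algebra_simps)
    finally show ?thesis by (simp add: csol_square mult.commute)
  qed
  then have \<phi>'a: "\<phi>' j (a j) = (of_real (csol E (a j)) * z j - 1) / of_real (ssol E (a j))" for j
    using Sc[of j] by (metis nonzero_mult_div_cancel_left)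

  \<comment> \<open>The cubic Hermite step from 0 to 1 with zero slope at both ends: it changes the
    weight along the edge without adding to the slopes at the vertices.\<close>
  define \<eta> where "\<eta> j t = 3 * (t / a j)\<^sup>2 - 2 * (t / a j) ^ 3" for j t
  define \<eta>' where "\<eta>' j t = 6 * t / (a j)\<^sup>2 - 6 * t\<^sup>2 / (a j) ^ 3" for j t
  define \<eta>'' where "\<eta>'' j t = 6 / (a j)\<^sup>2 - 12 * t / (a j) ^ 3" for j t
  have an: "a j \<noteq> 0" for j using a[of j] by simp
  have \<eta>_deriv: "(\<eta> j has_real_derivative \<eta>' j t) (at t within A)" for j t A
    unfolding \<eta>_def \<eta>'_def using an[of j]
    by (auto intro!: derivative_eq_intros simp: field_simps power2_eq_square power3_eq_cube)
  have \<eta>'_deriv: "(\<eta>' j has_real_derivative \<eta>'' j t) (at t within A)" for j t A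
    unfolding \<eta>'_def \<eta>''_def using an[of j]
    by (auto intro!: derivative_eq_intros simp: field_simps)
  have \<eta>_ends: "\<eta> j 0 = 0" "\<eta> j (a j) = 1" "\<eta>' j 0 = 0" "\<eta>' j (a j) = 0" for j
    using an[of j] by (simp_all add: \<eta>_def \<eta>'_def power2_eq_square power3_eq_cube)
  have cont\<eta>: "continuous_on A (\<eta> j)" and cont\<eta>': "continuous_on A (\<eta>' j)" for A j
    by (rule DERIV_continuous_on[OF \<eta>_deriv] DERIV_continuous_on[OF \<eta>'_deriv])+
  have cont\<eta>'': "continuous_on A (\<eta>'' j)" for A j
    unfolding \<eta>''_def using an[of j] by (intro continuous_intros) auto
  have \<eta>_range: "0 \<le> \<eta> j t" "\<eta> j t \<le> 1" if "t \<in> {0..a j}" for j t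
  proof -
    define u where "u = t / a j"
    have u: "0 \<le> u" "u \<le> 1" using that a[of j] by (auto simp: u_def)
    have e: "\<eta> j t = u\<^sup>2 * (3 - 2 * u)" "1 - \<eta> j t = (1 - u)\<^sup>2 * (1 + 2 * u)"
      by (simp_all add: \<eta>_def u_def[symmetric] power2_eq_square power3_eq_cube algebra_simps)
    show "0 \<le> \<eta> j t" unfolding e(1) using u by simp
    have "0 \<le> 1 - \<eta> j t" unfolding e(2) using u by simp
    then show "\<eta> j t \<le> 1" by simp
  qed

  \<comment> \<open>The commutator term: differentiating (1 + \<rho> \<eta>) \<phi> twice yields -E
    times itself plus \<rho> times \<open>w\<close>.\<close>
  define w where "w j t = of_real (\<eta>'' j t) * \<phi> j t + 2 * of_real (\<eta>' j t) * \<phi>' j t" for j t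
  have contw: "continuous_on A (w j)" for j A
    unfolding w_def by (intro continuous_intros cont\<phi> cont\<phi>' cont\<eta>' cont\<eta>'')
  have "\<exists>B\<ge>0. \<forall>t\<in>{0..a j}. norm (w j t) \<le> B \<and> norm (\<phi> j t) \<le> B" for j
  proof -
    have "continuous_on {0..a j} (\<lambda>t. norm (w j t) + norm (\<phi> j t))"
      by (intro continuous_intros contw cont\<phi>)
    then obtain K where "K \<ge> 0" "\<And>t. t \<in> {0..a j} \<Longrightarrow> \<bar>norm (w j t) + norm (\<phi> j t)\<bar> \<le> K"
      by (rule continuous_on_interval_bounded) blast
    then have "0 \<le> K" "norm (w j t) \<le> K \<and> norm (\<phi> j t) \<le> K" if "t \<in> {0..a j}" for t
      using that norm_ge_zero[of "w j t"] norm_ge_zero[of "\<phi> j t"] by (smt (verit))+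
    with \<open>K \<ge> 0\<close> show ?thesis by blast
  qed
  then obtain B where B: "\<And>j. B j \<ge> 0" "\<And>j t. t \<in> {0..a j} \<Longrightarrow> norm (w j t) \<le> B j"
      "\<And>j t. t \<in> {0..a j} \<Longrightarrow> norm (\<phi> j t) \<le> B j"
    by metis
  define BB where "BB = (\<Sum>j\<in>UNIV. B j)"
  have BB: "B j \<le> BB" for j unfolding BB_def by (rule member_le_sum) (auto simp: B)
  have BB0: "0 \<le> BB" unfolding BB_def by (intro sum_nonneg B)
  define \<mu> where "\<mu> j = integral {0..a j} (\<lambda>t. (norm (\<phi> j t))\<^sup>2)" for j
  have \<phi>int: "(\<lambda>t. (norm (\<phi> j t))\<^sup>2) integrable_on {0..a j}" for j
    by (intro integrable_continuous_real continuous_intros cont\<phi>)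
  have \<mu>: "\<mu> j > 0" for j
  proof -
    have "\<mu> j \<ge> 0" unfolding \<mu>_def by (intro integral_nonneg \<phi>int) simp
    moreover have "\<mu> j \<noteq> 0"
    proof
      assume "\<mu> j = 0"
      then have "\<forall>t\<in>{0..a j}. (norm (\<phi> j t))\<^sup>2 = 0"
        unfolding \<mu>_def by (subst (asm) integral_eq_0_iff) (auto intro!: continuous_intros cont\<phi> a)
      then show False using \<phi>0[of j] a[of j] by (auto dest: bspec[of _ _ 0])
    qed
    ultimately show ?thesis by simp
  qed
  \<comment> \<open>On an edge the error is at most \<xi>^2 \<delta>^2 B^2 a and the mass at least
    \<xi>^2 \<mu> / 4. \<open>D\<close> bounds their quotient up to \<delta>^2, uniformly in the
    direction.\<close>
  define D where "D = (\<Sum>j\<in>UNIV. 4 * (B j)\<^sup>2 * a j / \<mu> j)"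
  have Dj: "4 * (B j)\<^sup>2 * a j / \<mu> j \<le> D" for j
    unfolding D_def by (rule member_le_sum) (auto intro!: divide_nonneg_pos mult_nonneg_nonneg less_imp_le[OF a] \<mu>)
  have D0: "0 \<le> D" unfolding D_def
    by (intro sum_nonneg divide_nonneg_pos mult_nonneg_nonneg less_imp_le[OF a] \<mu>) auto

  show ?thesis unfolding approx_eigenvalue_def
  proof (intro allI impI)
    fix \<epsilon> :: real assume \<epsilon>: "\<epsilon> > 0"
    \<comment> \<open>The bound 1/2 keeps the factor 1 + \<rho> \<eta> away from 0; the other bound
      gives \<open>\<delta>\<^sup>2 * D \<le> \<epsilon>\<close>.\<close>
    define \<delta> where "\<delta> = min (1 / 2) (\<epsilon> / (D + 1))"
    have "0 < \<delta>" unfolding \<delta>_def using \<epsilon> D0 by simp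
    moreover have "\<delta> \<le> 1 / 2" "\<delta> \<le> \<epsilon> / (D + 1)" unfolding \<delta>_def by (rule min.cobounded1 min.cobounded2)+
    ultimately have \<delta>: "0 < \<delta>" "\<delta> \<le> 1 / 2" "\<delta> \<le> \<epsilon> / (D + 1)" by auto
    have \<delta>D: "\<delta>\<^sup>2 * D \<le> \<epsilon>"
    proof -
      have "\<delta>\<^sup>2 * D \<le> \<delta> * (D + 1)"
        using \<delta> D0 by (intro mult_mono) (auto simp: power2_eq_square mult_le_one mult_left_le)
      also have "\<dots> \<le> \<epsilon>" using \<delta>(3) D0 by (simp add: field_simps)
      finally show ?thesis .
    qed
    \<comment> \<open>Weights at neighbouring vertices then differ by a factor 1 + \<delta> or its
      inverse, which is at least 1 - \<delta>.\<close>
    define s where "s = ln (1 + \<delta>)"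
    have s: "s > 0" using \<delta> by (simp add: s_def)
    define \<xi> where "\<xi> n = exp (- s * (\<Sum>i\<in>UNIV. real_of_int \<bar>n i\<bar>))" for n :: "'d \<Rightarrow> int"
    have \<xi>0: "\<xi> n > 0" for n by (simp add: \<xi>_def)
    obtain Mc where \<xi>l2: "l2_bounded \<xi> Mc"
      using l2_bounded_exp_decay[OF s] unfolding \<xi>_def by blast
    define \<rho> where "\<rho> n j = exp (- s * real_of_int (\<bar>n j + 1\<bar> - \<bar>n j\<bar>)) - 1" for n :: "'d \<Rightarrow> int" and j
    have \<xi>_up: "\<xi> (shift_up j n) = \<xi> n * (1 + \<rho> n j)" for n j
    proof -
      have "(\<Sum>i\<in>UNIV. real_of_int \<bar>shift_up j n i\<bar>)
         = (\<Sum>i\<in>UNIV. real_of_int \<bar>n i\<bar> + (if i = j then real_of_int (\<bar>n j + 1\<bar> - \<bar>n j\<bar>) else 0))"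
        by (intro sum.cong refl) (auto simp: unit_step_def)
      also have "\<dots> = (\<Sum>i\<in>UNIV. real_of_int \<bar>n i\<bar>) + real_of_int (\<bar>n j + 1\<bar> - \<bar>n j\<bar>)"
        by (simp only: sum.distrib sum.delta finite_UNIV finite UNIV_I if_True)
      finally have e: "(\<Sum>i\<in>UNIV. real_of_int \<bar>shift_up j n i\<bar>)
         = (\<Sum>i\<in>UNIV. real_of_int \<bar>n i\<bar>) + real_of_int (\<bar>n j + 1\<bar> - \<bar>n j\<bar>)" .
      show ?thesis unfolding \<xi>_def \<rho>_def e
        by (simp add: exp_add[symmetric] algebra_simps)
    qed
    have \<rho>: "\<bar>\<rho> n j\<bar> \<le> \<delta>" for n j
    proof -
      have e: "exp s = 1 + \<delta>" "exp (- s) = 1 / (1 + \<delta>)" using \<delta> by (simp_all add: s_def exp_minus field_simps)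
      have "1 - \<delta> \<le> 1 / (1 + \<delta>)" using \<delta> by (simp add: field_simps)
      then have lo: "1 - \<delta> \<le> exp (- s)" using e by simp
      have "\<bar>real_of_int (\<bar>n j + 1\<bar> - \<bar>n j\<bar>)\<bar> \<le> 1" by linarith
      then have "\<bar>- s * real_of_int (\<bar>n j + 1\<bar> - \<bar>n j\<bar>)\<bar> \<le> s * 1"
        unfolding abs_mult using s by (intro mult_mono) auto
      then have "exp (- s) \<le> exp (- s * real_of_int (\<bar>n j + 1\<bar> - \<bar>n j\<bar>))"
        "exp (- s * real_of_int (\<bar>n j + 1\<bar> - \<bar>n j\<bar>)) \<le> exp s"
        by (auto simp only: exp_le_cancel_iff abs_le_iff)
      then show ?thesis using lo e unfolding \<rho>_def by linarith
    qed
    define A where "A n = cis (\<Sum>i\<in>UNIV. \<theta> i * real_of_int (n i)) * of_real (\<xi> n)" for n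
    have A_norm: "norm (A n) = \<xi> n" for n using \<xi>0[of n] by (simp add: A_def norm_mult)
    have A_up: "A (shift_up j n) = A n * z j * of_real (1 + \<rho> n j)" for n j
    proof -
      have "(\<Sum>i\<in>UNIV. \<theta> i * real_of_int (shift_up j n i)) = (\<Sum>i\<in>UNIV. \<theta> i * real_of_int (n i) + (if i = j then \<theta> j else 0))"
        by (intro sum.cong refl) (auto simp: unit_step_def algebra_simps)
      also have "\<dots> = (\<Sum>i\<in>UNIV. \<theta> i * real_of_int (n i)) + \<theta> j"
        by (simp only: sum.distrib sum.delta finite_UNIV finite UNIV_I if_True)
      finally show ?thesis unfolding A_def \<xi>_up z_def
        by (simp add: cis_mult[symmetric] del: of_real_add)
    qed
    define \<psi> :: "('d \<Rightarrow> int) \<times> 'd \<Rightarrow> real \<Rightarrow> complex" where "\<psi> e t = A (fst e) * (of_real (1 + \<rho> (fst e) (snd e) * \<eta> (snd e) t) * \<phi> (snd e) t)" for e t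
    define d\<psi> :: "('d \<Rightarrow> int) \<times> 'd \<Rightarrow> real \<Rightarrow> complex" where "d\<psi> e t = A (fst e) * (of_real (\<rho> (fst e) (snd e) * \<eta>' (snd e) t) * \<phi> (snd e) t +
       of_real (1 + \<rho> (fst e) (snd e) * \<eta> (snd e) t) * \<phi>' (snd e) t)" for e t
    define f :: "('d \<Rightarrow> int) \<times> 'd \<Rightarrow> real \<Rightarrow> complex" where "f e t = - (A (fst e) * of_real (\<rho> (fst e) (snd e)) * w (snd e) t)" for e t
    define g where "g e t = f e t + of_real E * \<psi> e t" for e t
    have contf: "continuous_on T (f e)" for T e
      unfolding f_def by (intro continuous_intros contw)
    have cont\<psi>: "continuous_on T (\<psi> e)" for T e
      unfolding \<psi>_def by (intro continuous_intros cont\<phi> cont\<eta>)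
    have contg: "continuous_on T (g e)" for T e
      unfolding g_def by (intro continuous_intros contf cont\<psi>)
    have prof: "((\<lambda>t. complex_of_real (1 + r * \<eta> j t)) has_vector_derivative of_real (r * \<eta>' j t)) (at t within T)"
      "((\<lambda>t. complex_of_real (r * \<eta>' j t)) has_vector_derivative of_real (r * \<eta>'' j t)) (at t within T)" for r j t T
    proof -
      have "((\<lambda>t. 1 + r * \<eta> j t) has_real_derivative 0 + r * \<eta>' j t) (at t within T)"
        by (intro DERIV_add DERIV_const DERIV_cmult \<eta>_deriv)
      from has_vector_derivative_of_real[OF this]
      show "((\<lambda>t. complex_of_real (1 + r * \<eta> j t)) has_vector_derivative of_real (r * \<eta>' j t)) (at t within T)"
        by simp
      show "((\<lambda>t. complex_of_real (r * \<eta>' j t)) has_vector_derivative of_real (r * \<eta>'' j t)) (at t within T)"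
        by (intro has_vector_derivative_of_real DERIV_cmult \<eta>'_deriv)
    qed
    have \<psi>_deriv: "(\<psi> e has_vector_derivative d\<psi> e t) (at t within T)" for e t T
      unfolding \<psi>_def d\<psi>_def
      by (rule has_vector_derivative_eq_rhs, (rule has_vector_derivative_mult
            has_vector_derivative_const prof \<phi>_deriv)+) (simp add: algebra_simps)
    have d\<psi>_deriv: "(d\<psi> e has_vector_derivative - g e t) (at t within T)" for e t T
      unfolding d\<psi>_def
      by (rule has_vector_derivative_eq_rhs, (rule has_vector_derivative_add has_vector_derivative_mult
            has_vector_derivative_const prof \<phi>_deriv \<phi>'_deriv)+)
        (simp add: g_def f_def w_def \<psi>_def algebra_simps)
    have f_le: "norm (f e t) \<le> \<xi> (fst e) * (\<delta> * B (snd e))" if "t \<in> {0..a (snd e)}" for e :: "('d \<Rightarrow> int) \<times> 'd" and t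
      unfolding f_def norm_minus_cancel norm_mult A_norm norm_of_real mult.assoc
      using \<xi>0[of "fst e"] \<rho> \<delta> B that by (intro mult_left_mono mult_mono) auto
    have \<psi>_le: "norm (\<psi> e t) \<le> \<xi> (fst e) * (2 * BB)"
      and \<psi>_ge: "\<xi> (fst e) / 2 * norm (\<phi> (snd e) t) \<le> norm (\<psi> e t)" if t: "t \<in> {0..a (snd e)}" for e t
    proof -
      have "\<bar>\<rho> (fst e) (snd e) * \<eta> (snd e) t\<bar> \<le> 1 / 2 * 1"
        unfolding abs_mult using \<rho>[of "fst e" "snd e"] \<delta> \<eta>_range[OF t] by (intro mult_mono) auto
      then have b: "\<bar>1 + \<rho> (fst e) (snd e) * \<eta> (snd e) t\<bar> \<le> 2" "1 / 2 \<le> \<bar>1 + \<rho> (fst e) (snd e) * \<eta> (snd e) t\<bar>"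
        by linarith+
      show "norm (\<psi> e t) \<le> \<xi> (fst e) * (2 * BB)"
        unfolding \<psi>_def norm_mult A_norm norm_of_real
        using \<xi>0[of "fst e"] b B(3)[OF t] BB[of "snd e"] by (intro mult_left_mono mult_mono) auto
      have "\<xi> (fst e) * (1 / 2 * norm (\<phi> (snd e) t)) \<le> norm (\<psi> e t)"
        unfolding \<psi>_def norm_mult A_norm norm_of_real
        using \<xi>0[of "fst e"] b by (intro mult_left_mono mult_right_mono) auto
      then show "\<xi> (fst e) / 2 * norm (\<phi> (snd e) t) \<le> norm (\<psi> e t)" by simp
    qed
    have L\<psi>: "in_L2 a \<psi>"
      by (rule in_L2_continuous[OF a cont\<psi> \<psi>_le _ \<xi>l2]) (use \<xi>0 BB0 in \<open>auto intro: less_imp_le\<close>)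
    have Lf: "in_L2 a f"
    proof (rule in_L2_continuous[OF a contf _ _ \<xi>l2])
      fix e :: "('d \<Rightarrow> int) \<times> 'd" and t assume t: "t \<in> {0..a (snd e)}"
      have "\<xi> (fst e) * (\<delta> * B (snd e)) \<le> \<xi> (fst e) * (\<delta> * BB)"
        using \<xi>0[of "fst e"] \<delta> BB by (intro mult_left_mono) auto
      with f_le[OF t] show "norm (f e t) \<le> \<xi> (fst e) * (\<delta> * BB)" by linarith
    qed (use \<xi>0 BB0 \<delta> in \<open>auto intro: less_imp_le\<close>)
    have "lattice_H a \<alpha> \<psi> g" unfolding lattice_H_def
    proof (intro conjI exI[of _ d\<psi>] allI ballI)
      show "in_L2 a \<psi>" by (rule L\<psi>)
      show "in_L2 a g" unfolding g_def by (rule in_L2_add_scale[OF Lf L\<psi>])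
      show "g e integrable_on {0..a (snd e)}" for e by (rule integrable_continuous_real[OF contg])
      show "(\<psi> e has_vector_derivative d\<psi> e t) (at t within {0..a (snd e)})" for e t by (rule \<psi>_deriv)
      show "d\<psi> e t = d\<psi> e 0 - integral {0..t} (g e)" if "t \<in> {0..a (snd e)}" for e t
      proof -
        have "((\<lambda>t. - g e t) has_integral (d\<psi> e t - d\<psi> e 0)) {0..t}"
          using that by (intro fundamental_theorem_of_calculus d\<psi>_deriv) auto
        from has_integral_neg[OF this] have "integral {0..t} (g e) = - (d\<psi> e t - d\<psi> e 0)"
          by (intro integral_unique) simp
        then show ?thesis by simp
      qed
      fix n :: "'d \<Rightarrow> int"
      have A_down: "A (n - unit_step j) * of_real (1 + \<rho> (n - unit_step j) j) * z j = A n" for j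
        using A_up[of "n - unit_step j" j] by (simp add: mult_ac)
      have v0: "\<psi> (n, j) 0 = A n" for j by (simp add: \<psi>_def \<eta>_ends \<phi>0)
      have v1: "\<psi> (n - unit_step j, j) (a j) = A n" for j
        using A_down[of j] by (simp add: \<psi>_def \<eta>_ends \<phi>a mult.assoc)
      have "d\<psi> (n, j) 0 - d\<psi> (n - unit_step j, j) (a j) = of_real (2 * ((x j - csol E (a j)) / ssol E (a j))) * A n" for j
      proof -
        have 1: "d\<psi> (n, j) 0 = A n * m j" by (simp add: d\<psi>_def \<eta>_ends \<phi>0)
        have "d\<psi> (n - unit_step j, j) (a j) = A (n - unit_step j) * of_real (1 + \<rho> (n - unit_step j) j) * \<phi>' j (a j)"
          by (simp add: d\<psi>_def \<eta>_ends mult.assoc)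
        \<comment> \<open>Inserting z times its conjugate, which is 1, turns the amplitude at the
          previous vertex into the one at \<open>n\<close>.\<close>
        also have "\<dots> = (A (n - unit_step j) * of_real (1 + \<rho> (n - unit_step j) j) * z j) * (cnj (z j) * \<phi>' j (a j))"
          using z_norm[of j] by (simp add: mult_ac)
        also have "\<dots> = A n * (cnj (z j) * \<phi>' j (a j))" unfolding A_down ..
        also have "cnj (z j) * \<phi>' j (a j) = (of_real (csol E (a j)) * (z j * cnj (z j)) - cnj (z j)) / of_real (ssol E (a j))"
          by (simp add: \<phi>'a algebra_simps)
        also have "\<dots> = (of_real (csol E (a j)) - cnj (z j)) / of_real (ssol E (a j))" by (simp add: z_norm)
        finally have 2: "d\<psi> (n - unit_step j, j) (a j) = A n * ((of_real (csol E (a j)) - cnj (z j)) / of_real (ssol E (a j)))" .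
        have "d\<psi> (n, j) 0 - d\<psi> (n - unit_step j, j) (a j)
           = A n * ((z j + cnj (z j) - 2 * of_real (csol E (a j))) / of_real (ssol E (a j)))"
          unfolding 1 2 m_def right_diff_distrib[symmetric] diff_divide_distrib[symmetric] by (simp add: algebra_simps)
        then show ?thesis unfolding z_Re by (simp add: algebra_simps)
      qed
      then have "(\<Sum>j\<in>UNIV. d\<psi> (n, j) 0 - d\<psi> (n - unit_step j, j) (a j)) = of_real \<alpha> * A n"
        unfolding disp[symmetric] by (simp only: of_real_sum sum_distrib_right)
      with v0 v1 show "\<exists>c. (\<forall>j. \<psi> (n, j) 0 = c \<and> \<psi> (n - unit_step j, j) (a j) = c) \<and>
          (\<Sum>j\<in>UNIV. d\<psi> (n, j) 0 - d\<psi> (n - unit_step j, j) (a j)) = of_real \<alpha> * c" by blast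
    qed
    moreover have lower: "(\<xi> (fst e))\<^sup>2 / 4 * \<mu> (snd e) \<le> edge_L2_sq a \<psi> e" for e
    proof -
      have "integral {0..a (snd e)} (\<lambda>t. (\<xi> (fst e) / 2)\<^sup>2 * (norm (\<phi> (snd e) t))\<^sup>2) \<le> edge_L2_sq a \<psi> e"
        unfolding edge_L2_sq_def
      proof (rule integral_le)
        show "(\<lambda>t. (\<xi> (fst e) / 2)\<^sup>2 * (norm (\<phi> (snd e) t))\<^sup>2) integrable_on {0..a (snd e)}"
          by (rule integrable_on_mult_right[OF \<phi>int])
        show "(\<lambda>t. (norm (\<psi> e t))\<^sup>2) integrable_on {0..a (snd e)}"
          by (intro integrable_continuous_real continuous_intros cont\<psi>)
        fix t assume t: "t \<in> {0..a (snd e)}"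
        show "(\<xi> (fst e) / 2)\<^sup>2 * (norm (\<phi> (snd e) t))\<^sup>2 \<le> (norm (\<psi> e t))\<^sup>2"
          unfolding power_mult_distrib[symmetric] using \<psi>_ge[OF t] \<xi>0[of "fst e"]
          by (intro power_mono) auto
      qed
      then show ?thesis by (simp add: \<mu>_def power_divide)
    qed
    moreover have "edge_L2_sq a (\<lambda>e t. g e t - of_real E * \<psi> e t) e \<le> \<epsilon> * edge_L2_sq a \<psi> e" for e
    proof -
      have "edge_L2_sq a (\<lambda>e t. g e t - of_real E * \<psi> e t) e = edge_L2_sq a f e" by (simp add: g_def edge_L2_sq_def)
      also have "\<dots> \<le> integral {0..a (snd e)} (\<lambda>t. (\<xi> (fst e) * (\<delta> * B (snd e)))\<^sup>2)"
        unfolding edge_L2_sq_def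
        by (intro integral_le integrable_const_ivl integrable_continuous_real continuous_intros contf power_mono f_le) auto
      also have "\<dots> = (\<xi> (fst e))\<^sup>2 / 4 * \<mu> (snd e) * (\<delta>\<^sup>2 * (4 * (B (snd e))\<^sup>2 * a (snd e) / \<mu> (snd e)))"
        using a[of "snd e"] \<mu>[of "snd e"] by (simp add: power_mult_distrib)
      also have "\<dots> \<le> (\<xi> (fst e))\<^sup>2 / 4 * \<mu> (snd e) * \<epsilon>"
      proof (rule mult_left_mono)
        have "\<delta>\<^sup>2 * (4 * (B (snd e))\<^sup>2 * a (snd e) / \<mu> (snd e)) \<le> \<delta>\<^sup>2 * D"
          by (intro mult_left_mono Dj) simp
        with \<delta>D show "\<delta>\<^sup>2 * (4 * (B (snd e))\<^sup>2 * a (snd e) / \<mu> (snd e)) \<le> \<epsilon>" by linarith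
      qed (use \<mu>[of "snd e"] in auto)
      also have "\<dots> \<le> edge_L2_sq a \<psi> e * \<epsilon>" using \<epsilon> by (intro mult_right_mono lower) auto
      finally show ?thesis by (simp add: mult.commute)
    qed
    moreover have "0 < edge_L2_sq a \<psi> (\<lambda>_. 0, j)" for j
    proof -
      define e :: "('d \<Rightarrow> int) \<times> 'd" where "e = (\<lambda>_. 0, j)"
      have "0 < (\<xi> (fst e))\<^sup>2 / 4 * \<mu> (snd e)"
        by (intro mult_pos_pos divide_pos_pos zero_less_power \<xi>0 \<mu>) simp
      then show ?thesis unfolding e_def[symmetric] by (rule less_le_trans[OF _ lower])
    qed
    ultimately show "\<exists>\<psi> g. lattice_H a \<alpha> \<psi> g \<and>
       (\<forall>e. edge_L2_sq a (\<lambda>e t. g e t - of_real E * \<psi> e t) e \<le> \<epsilon> * edge_L2_sq a \<psi> e) \<and>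
       (\<exists>e. 0 < edge_L2_sq a \<psi> e)" by blast
  qed
qed

section \<open>Bands and gaps\<close>

definition band_fun :: "('d::finite \<Rightarrow> real) \<Rightarrow> real \<Rightarrow> real" where
  "band_fun a k = 2 * k * (\<Sum>j\<in>UNIV. tan (pi / 2 * (k * a j / pi - of_int \<lfloor>k * a j / pi\<rfloor>)))"

text \<open>Both terms on the left have period pi, since the sign \<open>c\<close> picked up by sine
  and cosine cancels. On (0, pi) the claim is the half-angle formula.\<close>

lemma tan_half_fractional:
  assumes "sin x \<noteq> 0"
  shows "1 / \<bar>sin x\<bar> - cos x / sin x = tan (pi / 2 * (x / pi - of_int \<lfloor>x / pi\<rfloor>))"
proof -
  define N where "N = \<lfloor>x / pi\<rfloor>"
  define y where "y = x - of_int N * pi"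
  define c where "c = cos (of_int N * pi)"
  have sN: "sin (of_int N * pi) = 0" using sin_zero_iff_int2 by blast
  have c2: "c\<^sup>2 = 1" using sin_cos_squared_add[of "of_int N * pi"] sN by (simp add: c_def)
  then have c: "\<bar>c\<bar> = 1" by (auto simp: power2_eq_1_iff)
  have x: "x = y + of_int N * pi" by (simp add: y_def)
  have sx: "sin x = c * sin y" unfolding x sin_add sN c_def by simp
  have cx: "cos x = c * cos y" unfolding x cos_add sN c_def by simp
  have "of_int N \<le> x / pi" "x / pi < of_int N + 1" unfolding N_def by linarith+
  then have y: "0 \<le> y" "y < pi" by (simp_all add: y_def field_simps)
  have "y \<noteq> 0" using assms sx by auto
  then have sy: "sin y > 0" using y by (intro sin_gt_zero) auto
  have c0: "c \<noteq> 0" using c by auto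
  have cy: "1 + cos y \<noteq> 0"
  proof
    assume "1 + cos y = 0"
    then have "cos y = - 1" by simp
    then show False using sy sin_cos_squared_add[of y] by simp
  qed
  have "1 / \<bar>sin x\<bar> - cos x / sin x = (1 - cos y) / sin y"
    using c c0 sy by (simp add: sx cx abs_mult diff_divide_distrib)
  also have "\<dots> = sin y / (cos y + 1)"
    using sy cy sin_cos_squared_add[of y] by (simp add: field_simps power2_eq_square)
  also have "\<dots> = tan (y / 2)" using tan_half[of "y / 2"] by simp
  also have "y / 2 = pi / 2 * (x / pi - of_int N)" by (simp add: y_def field_simps)
  finally show ?thesis by (simp add: N_def)
qed

lemma csol_ssol_square_energy:
  assumes "k > 0"
  shows "csol (k\<^sup>2) t = cos (k * t)" "ssol (k\<^sup>2) t = sin (k * t) / k"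
  using assms by (simp_all add: csol_def ssol_def)

lemma band_fun_eq:
  assumes k: "k > 0" and nz: "\<And>j. sin (k * a j) \<noteq> 0"
  shows "(\<Sum>j\<in>UNIV. 2 * (1 / \<bar>ssol (k\<^sup>2) (a j)\<bar> - csol (k\<^sup>2) (a j) / ssol (k\<^sup>2) (a j))) = band_fun a k"
proof -
  have "2 * (1 / \<bar>ssol (k\<^sup>2) (a j)\<bar> - csol (k\<^sup>2) (a j) / ssol (k\<^sup>2) (a j))
     = 2 * k * tan (pi / 2 * (k * a j / pi - of_int \<lfloor>k * a j / pi\<rfloor>))" for j
    unfolding tan_half_fractional[OF nz, symmetric]
    using k by (simp add: csol_ssol_square_energy right_diff_distrib)
  then show ?thesis by (simp add: band_fun_def sum_distrib_left)
qed

lemma band_gap_energy: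
  fixes a :: "'d::finite \<Rightarrow> real"
  assumes a: "\<And>j. a j > 0" and k: "k > 0" and nz: "\<And>j. sin (k * a j) \<noteq> 0" and "band_fun a k < \<alpha>"
  shows "k\<^sup>2 \<notin> lattice_spectrum a \<alpha>"
proof (rule diagonally_dominant_not_in_spectrum[OF a])
  show "ssol (k\<^sup>2) (a j) \<noteq> 0" for j using nz k by (simp add: csol_ssol_square_energy)
  show "(\<Sum>j\<in>UNIV. 2 * (1 / \<bar>ssol (k\<^sup>2) (a j)\<bar> - csol (k\<^sup>2) (a j) / ssol (k\<^sup>2) (a j))) < \<alpha>"
    unfolding band_fun_eq[OF k nz] by fact
qed

text \<open>Here S_j > 0 and C_j \<ge> 1, so every summand of the dominance condition is nonpositive
  and a repulsive coupling suffices.\<close>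

lemma nonpositive_energy:
  fixes a :: "'d::finite \<Rightarrow> real"
  assumes a: "\<And>j. a j > 0" and "\<alpha> > 0" and E: "E \<le> 0"
  shows "E \<notin> lattice_spectrum a \<alpha>"
proof (rule diagonally_dominant_not_in_spectrum[OF a])
  have S: "ssol E (a j) > 0" for j
    using E a[of j] by (auto simp: ssol_def)
  then show "ssol E (a j) \<noteq> 0" for j by (metis less_irrefl)
  have C: "csol E (a j) \<ge> 1" for j using E by (simp add: csol_def cosh_real_ge_1)
  have "2 * (1 / \<bar>ssol E (a j)\<bar> - csol E (a j) / ssol E (a j)) \<le> 0" for j
    using S[of j] C[of j] by (simp add: divide_right_mono)
  then have "(\<Sum>j\<in>UNIV. 2 * (1 / \<bar>ssol E (a j)\<bar> - csol E (a j) / ssol E (a j))) \<le> 0"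
    by (intro sum_nonpos) blast
  then show "(\<Sum>j\<in>UNIV. 2 * (1 / \<bar>ssol E (a j)\<bar> - csol E (a j) / ssol E (a j))) < \<alpha>"
    using \<open>\<alpha> > 0\<close> by linarith
qed

text \<open>The dispersion sum is affine in \<open>x\<close>, with value 0 at x = C and
  \<open>band_fun a k\<close> at x = sgn S. Moving all cosines by the common fraction
  \<open>\<tau>\<close> along this segment yields \<alpha> and stays inside [-1, 1].\<close>

lemma band_energy:
  fixes a :: "'d::finite \<Rightarrow> real"
  assumes a: "\<And>j. a j > 0" and "\<alpha> > 0" and k: "k > 0" and nz: "\<And>j. sin (k * a j) \<noteq> 0"
    and band: "band_fun a k \<ge> \<alpha>"
  shows "approx_eigenvalue a \<alpha> (k\<^sup>2)"
proof -
  define C where "C j = csol (k\<^sup>2) (a j)" for j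
  define S where "S j = ssol (k\<^sup>2) (a j)" for j
  have S: "S j \<noteq> 0" for j using nz k by (simp add: csol_ssol_square_energy S_def)
  have C: "\<bar>C j\<bar> \<le> 1" for j using k by (simp add: C_def csol_ssol_square_energy)
  define \<tau> where "\<tau> = \<alpha> / band_fun a k"
  have \<tau>: "0 \<le> \<tau>" "\<tau> \<le> 1" using \<open>\<alpha> > 0\<close> band by (auto simp: \<tau>_def)
  define x where "x j = C j + \<tau> * (sgn (S j) - C j)" for j
  show ?thesis
  proof (rule bloch_approx_eigenvalue[where x = x, OF a])
    show "ssol (k\<^sup>2) (a j) \<noteq> 0" for j using S by (simp add: S_def)
    show "\<bar>x j\<bar> \<le> 1" for j
    proof -
      have "x j = (1 - \<tau>) * C j + \<tau> * sgn (S j)" by (simp add: x_def algebra_simps)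
      then have "\<bar>x j\<bar> \<le> (1 - \<tau>) * \<bar>C j\<bar> + \<tau> * \<bar>sgn (S j)\<bar>"
        using \<tau> abs_triangle_ineq[of "(1 - \<tau>) * C j" "\<tau> * sgn (S j)"] by (simp add: abs_mult)
      also have "\<dots> \<le> (1 - \<tau>) * 1 + \<tau> * 1"
        using \<tau> C by (intro add_mono mult_left_mono) (auto simp: abs_sgn_eq)
      finally show ?thesis by simp
    qed
    have "2 * ((x j - C j) / S j) = \<tau> * (2 * (1 / \<bar>S j\<bar> - C j / S j))" for j
    proof -
      have "sgn (S j) / S j = 1 / \<bar>S j\<bar>" using S[of j] by (simp add: sgn_if)
      then have "(sgn (S j) - C j) / S j = 1 / \<bar>S j\<bar> - C j / S j" by (simp add: diff_divide_distrib)
      then show ?thesis by (simp add: x_def flip: times_divide_eq_right)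
    qed
    then have "(\<Sum>j\<in>UNIV. 2 * ((x j - C j) / S j)) = \<tau> * band_fun a k"
      unfolding band_fun_eq[OF k nz, symmetric] C_def S_def by (simp add: sum_distrib_left)
    also have "\<dots> = \<alpha>" using band \<open>\<alpha> > 0\<close> by (simp add: \<tau>_def)
    finally show "(\<Sum>j\<in>UNIV. 2 * ((x j - csol (k\<^sup>2) (a j)) / ssol (k\<^sup>2) (a j))) = \<alpha>"
      by (simp add: C_def S_def)
  qed
qed

section \<open>Monotonicity and blow-up of the tangent sum between Dirichlet momenta\<close>

text \<open>An interval free of Dirichlet momenta, on which all the integer parts in \<^const>\<open>band_fun\<close> are constant.\<close>
definition dirichlet_cell :: "('d::finite \<Rightarrow> real) \<Rightarrow> ('d \<Rightarrow> int) \<Rightarrow> real \<Rightarrow> real \<Rightarrow> bool" where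
  "dirichlet_cell a m lo hi \<longleftrightarrow> 0 \<le> lo \<and> lo < hi \<and>
     (\<forall>j. of_int (m j) * pi \<le> lo * a j \<and> hi * a j \<le> (of_int (m j) + 1) * pi)"

context
  fixes a :: "'d::finite \<Rightarrow> real" and m lo hi
  assumes a: "\<And>j. a j > 0" and cell: "dirichlet_cell a m lo hi"
begin

lemma cell_bounds: "0 \<le> lo" "lo < hi" "of_int (m j) * pi \<le> lo * a j" "hi * a j \<le> (of_int (m j) + 1) * pi"
  using cell by (auto simp: dirichlet_cell_def)

definition phase :: "real \<Rightarrow> 'd \<Rightarrow> real" where
  "phase k j = (k * a j - of_int (m j) * pi) / 2"

text \<open>The left end is included because a gap starts there; at the right end some tangent may
  become infinite.\<close>

lemma phase_range:
  assumes "lo \<le> k" "k < hi"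
  shows "0 \<le> phase k j" "phase k j < pi / 2"
proof -
  have "lo * a j \<le> k * a j" "k * a j < hi * a j" using assms a[of j] by simp_all
  then show "0 \<le> phase k j" "phase k j < pi / 2"
    using cell_bounds(3,4)[of j] by (auto simp: phase_def algebra_simps)
qed

lemma phase_mono: "k < k' \<Longrightarrow> phase k j < phase k' j"
  using a[of j] by (simp add: phase_def)

lemma band_fun_cell:
  assumes "lo \<le> k" "k < hi"
  shows "band_fun a k = 2 * k * (\<Sum>j\<in>UNIV. tan (phase k j))"
proof -
  have "\<lfloor>k * a j / pi\<rfloor> = m j" for j
    using phase_range[OF assms, of j] by (intro floor_unique) (auto simp: phase_def field_simps)
  then show ?thesis
    by (auto simp: band_fun_def phase_def field_simps intro!: arg_cong[where f = tan] sum.cong)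
qed

lemma cell_sin_nonzero:
  assumes "lo < k" "k < hi"
  shows "sin (k * a j) \<noteq> 0"
proof
  assume "sin (k * a j) = 0"
  then obtain i :: int where i: "k * a j = of_int i * pi" by (auto simp: sin_zero_iff_int2)
  have "0 < phase k j" "phase k j < pi / 2"
    using phase_range(1)[of lo j] phase_mono[OF assms(1), of j] phase_range(2)[of k j] cell_bounds(2) assms by auto
  then have "of_int (m j) * pi < of_int i * pi" "of_int i * pi < (of_int (m j) + 1) * pi"
    unfolding phase_def i by (auto simp: algebra_simps)
  then have "real_of_int (m j) < of_int i" "real_of_int i < of_int (m j + 1)" by auto
  then show False by (simp only: of_int_less_iff)
qed

lemma tan_phase_mono:
  assumes "lo \<le> k" "k < k'" "k' < hi"
  shows "tan (phase k j) < tan (phase k' j)"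
  using phase_range(1)[of k j] phase_range(2)[of k' j] phase_mono[OF assms(2), of j] assms
  by (intro tan_monotone) auto

lemma sum_tan_nonneg: "lo \<le> k \<Longrightarrow> k < hi \<Longrightarrow> 0 \<le> (\<Sum>j\<in>UNIV. tan (phase k j))"
  by (intro sum_nonneg tan_pos_pi2_le phase_range)

lemma band_fun_cell_mono:
  assumes "lo \<le> k" "k < k'" "k' < hi"
  shows "band_fun a k < band_fun a k'"
proof -
  have k': "0 < k'" "lo \<le> k'" "k < hi" using cell_bounds assms by linarith+
  \<comment> \<open>Only a weak inequality here, as the tangent sum can vanish at the left end;
    strictness comes from the tangents.\<close>
  have "2 * k * (\<Sum>j\<in>UNIV. tan (phase k j)) \<le> 2 * k' * (\<Sum>j\<in>UNIV. tan (phase k j))"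
    using assms k' by (intro mult_right_mono sum_tan_nonneg) auto
  also have "\<dots> < 2 * k' * (\<Sum>j\<in>UNIV. tan (phase k' j))"
    using assms k' by (intro mult_strict_left_mono sum_strict_mono tan_phase_mono) auto
  finally show ?thesis using assms k' by (simp add: band_fun_cell)
qed

lemma continuous_on_band_fun_cell:
  assumes "lo \<le> k" "k' < hi"
  shows "continuous_on {k..k'} (band_fun a)"
proof -
  have "continuous_on {k..k'} (\<lambda>k. 2 * k * (\<Sum>j\<in>UNIV. tan (phase k j)))"
  proof (intro continuous_intros)
    show "continuous_on {k..k'} (\<lambda>k. phase k j)" for j unfolding phase_def by (intro continuous_intros) auto
    fix j
    show "\<forall>x\<in>{k..k'}. cos (phase x j) \<noteq> 0"
    proof
      fix x assume "x \<in> {k..k'}"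
      then have "lo \<le> x" "x < hi" using assms by auto
      from phase_range[OF this, of j] have "0 < cos (phase x j)" by (intro cos_gt_zero_pi) auto
      then show "cos (phase x j) \<noteq> 0" by simp
    qed
  qed
  then show ?thesis
    by (rule continuous_on_eq) (use assms in \<open>auto simp: band_fun_cell\<close>)
qed

lemma band_fun_cell_unbounded:
  assumes l: "hi * a l = (of_int (m l) + 1) * pi" and "k0 < hi"
  obtains k where "lo < k" "k0 < k" "k < hi" "L < band_fun a k"
proof -
  define k1 where "k1 = (max lo k0 + hi) / 2"
  have k1: "lo < k1" "k0 < k1" "k1 < hi" "0 < k1"
    using assms cell_bounds(1,2) by (auto simp: k1_def max_def)
  define X where "X = (\<bar>L\<bar> + 1) / (2 * k1)"
  define k where "k = max k1 ((2 * arctan X + of_int (m l) * pi) / a l)"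
  have "2 * arctan X + of_int (m l) * pi < hi * a l"
    unfolding l using arctan_ubound[of X] by (simp add: algebra_simps)
  then have khi: "k < hi" using k1 a[of l] by (simp add: k_def pos_divide_less_eq)
  have klo: "lo < k" "k0 < k" "k1 \<le> k" using k1 by (auto simp: k_def)
  have "(2 * arctan X + of_int (m l) * pi) / a l \<le> k" by (simp add: k_def)
  then have "arctan X \<le> phase k l" using a[of l] by (simp add: phase_def field_simps)
  then have "tan (arctan X) \<le> tan (phase k l)"
    using phase_range(2)[of k l] klo khi arctan_lbound[of X] by (intro tan_mono_le) auto
  also have "tan (phase k l) \<le> (\<Sum>j\<in>UNIV. tan (phase k j))"
    using klo khi by (intro member_le_sum tan_pos_pi2_le phase_range) auto
  finally have X: "X \<le> (\<Sum>j\<in>UNIV. tan (phase k j))" by (simp add: tan_arctan)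
  have "L < 2 * k1 * X" using k1 by (simp add: X_def)
  also have "\<dots> \<le> 2 * k * (\<Sum>j\<in>UNIV. tan (phase k j))"
    using X klo k1 by (intro mult_mono) (auto simp: X_def)
  also have "\<dots> = band_fun a k" using klo khi by (simp add: band_fun_cell)
  finally show ?thesis using that klo khi by blast
qed

end

lemma next_dirichlet_cell:
  fixes a :: "'d::finite \<Rightarrow> real"
  assumes a: "\<And>j. a j > 0" and k0: "0 \<le> k0"
  obtains m hi l where "dirichlet_cell a m k0 hi" "hi * a l = (of_int (m l) + 1) * pi"
proof -
  define m where "m j = \<lfloor>k0 * a j / pi\<rfloor>" for j
  define h where "h j = (of_int (m j) + 1) * pi / a j" for j
  have m: "of_int (m j) * pi \<le> k0 * a j" "k0 * a j < (of_int (m j) + 1) * pi" for j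
  proof -
    have "of_int (m j) \<le> k0 * a j / pi" "k0 * a j / pi < of_int (m j) + 1" unfolding m_def by linarith+
    then show "of_int (m j) * pi \<le> k0 * a j" "k0 * a j < (of_int (m j) + 1) * pi"
      by (simp_all add: pos_le_divide_eq pos_divide_less_eq)
  qed
  define hi where "hi = Min (range h)"
  have "hi \<in> range h" unfolding hi_def by (rule Min_in) auto
  then obtain l where l: "hi = h l" by blast
  have hi: "hi \<le> h j" for j unfolding hi_def by (rule Min_le) auto
  have "k0 < h l" using m(2)[of l] a[of l] by (simp add: h_def pos_less_divide_eq)
  moreover have "hi * a j \<le> (of_int (m j) + 1) * pi" for j
    using hi[of j] a[of j] by (simp add: h_def pos_le_divide_eq)
  ultimately have "dirichlet_cell a m k0 hi" using k0 m l by (simp add: dirichlet_cell_def)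
  moreover have "hi * a l = (of_int (m l) + 1) * pi" using a[of l] by (simp add: l h_def)
  ultimately show ?thesis by (rule that)
qed

lemma previous_dirichlet_cell:
  fixes a :: "'d::finite \<Rightarrow> real"
  assumes a: "\<And>j. a j > 0" and k1: "0 < k1" and "sin (k1 * a l) = 0"
  obtains m lo where "dirichlet_cell a m lo k1" "k1 * a l = (of_int (m l) + 1) * pi"
proof -
  define m where "m j = \<lceil>k1 * a j / pi\<rceil> - 1" for j
  define h where "h j = of_int (m j) * pi / a j" for j
  have m: "of_int (m j) * pi < k1 * a j" "k1 * a j \<le> (of_int (m j) + 1) * pi" for j
  proof -
    have "of_int (m j) < k1 * a j / pi" "k1 * a j / pi \<le> of_int (m j) + 1" unfolding m_def by linarith+
    then show "of_int (m j) * pi < k1 * a j" "k1 * a j \<le> (of_int (m j) + 1) * pi"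
      by (simp_all add: pos_less_divide_eq pos_divide_le_eq)
  qed
  define lo where "lo = Max (insert 0 (range h))"
  have lo: "0 \<le> lo" "h j \<le> lo" for j unfolding lo_def by (rule Max_ge; simp)+
  have "h j < k1" for j using m(1)[of j] a[of j] by (simp add: h_def pos_divide_less_eq)
  then have "lo < k1" unfolding lo_def using k1 by (subst Max_less_iff) auto
  moreover have "of_int (m j) * pi \<le> lo * a j" for j
    using lo(2)[of j] a[of j] by (simp add: h_def pos_divide_le_eq)
  ultimately have "dirichlet_cell a m lo k1" using lo m by (simp add: dirichlet_cell_def)
  moreover have "k1 * a l = (of_int (m l) + 1) * pi"
  proof -
    obtain i :: int where i: "k1 * a l = of_int i * pi" using assms(3) by (auto simp: sin_zero_iff_int2)
    then have "m l = i - 1" by (simp add: m_def)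
    with i show ?thesis by simp
  qed
  ultimately show ?thesis by (rule that)
qed

lemma dirichlet_energy_in_spectrum:
  fixes a :: "'d::finite \<Rightarrow> real"
  assumes a: "\<And>j. a j > 0" and \<alpha>: "\<alpha> > 0" and k1: "0 < k1" and s: "sin (k1 * a l) = 0"
  shows "k1\<^sup>2 \<in> lattice_spectrum a \<alpha>"
proof (rule approx_eigenvalue_imp_spectrum, rule approx_eigenvalue_closed)
  obtain m lo where cell: "dirichlet_cell a m lo k1" and l: "k1 * a l = (of_int (m l) + 1) * pi"
    using previous_dirichlet_cell[where a = a, OF a k1 s] by blast
  fix \<delta> :: real assume \<delta>: "\<delta> > 0"
  have "k1 - \<delta> / (2 * k1) < k1" using \<delta> k1 by simp
  then obtain k where k: "lo < k" "k1 - \<delta> / (2 * k1) < k" "k < k1" "\<alpha> < band_fun a k"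
    using band_fun_cell_unbounded[OF a cell l] by blast
  have k0: "0 < k" using k(1) cell by (simp add: dirichlet_cell_def)
  have "approx_eigenvalue a \<alpha> (k\<^sup>2)"
    using band_energy[where a = a, OF a \<alpha> k0 cell_sin_nonzero[OF a cell k(1,3)]] k(4) by simp
  moreover have "\<bar>k\<^sup>2 - k1\<^sup>2\<bar> < \<delta>"
  proof -
    have "\<bar>k\<^sup>2 - k1\<^sup>2\<bar> = (k1 - k) * (k1 + k)"
      using k(3) k0 by (simp add: abs_if power2_eq_square algebra_simps mult_strict_mono)
    also have "\<dots> \<le> (k1 - k) * (2 * k1)" using k(3) by (intro mult_left_mono) auto
    also have "\<dots> < \<delta>" using k(2) k1 by (simp add: field_simps)
    finally show ?thesis .
  qed
  ultimately show "\<exists>E'. \<bar>E' - k1\<^sup>2\<bar> < \<delta> \<and> approx_eigenvalue a \<alpha> E'" by blast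
qed

lemma no_spectral_gap_above:
  fixes a :: "'d::finite \<Rightarrow> real"
  assumes a: "\<And>j. a j > 0" and \<alpha>: "\<alpha> > 0" and k0: "0 < k0" and band: "\<alpha> \<le> band_fun a k0"
  shows "\<not> spectral_gap (lattice_spectrum a \<alpha>) (k0\<^sup>2) E2"
proof
  assume gap: "spectral_gap (lattice_spectrum a \<alpha>) (k0\<^sup>2) E2"
  then have lt: "k0\<^sup>2 < E2" by (simp add: spectral_gap_def)
  then have "k0 < sqrt E2" using k0 by (simp add: real_less_rsqrt)
  obtain m hi l where cell: "dirichlet_cell a m k0 hi"
    using next_dirichlet_cell[where a = a, OF a less_imp_le[OF k0]] by blast
  have "k0 < min hi (sqrt E2)" using cell \<open>k0 < sqrt E2\<close> by (simp add: dirichlet_cell_def)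
  from dense[OF this] obtain k where k: "k0 < k" "k < hi" "k < sqrt E2" by auto
  have "k\<^sup>2 < (sqrt E2)\<^sup>2" using k k0 by (intro power_strict_mono) auto
  moreover have "0 \<le> E2" using lt zero_le_power2[of k0] by linarith
  then have "(sqrt E2)\<^sup>2 = E2" by simp
  moreover have "k0\<^sup>2 < k\<^sup>2" using k k0 by (intro power_strict_mono) auto
  moreover have "k\<^sup>2 \<in> lattice_spectrum a \<alpha>"
  proof (rule approx_eigenvalue_imp_spectrum, rule band_energy[where a = a, OF a \<alpha>])
    show "0 < k" using k k0 by simp
    show "sin (k * a j) \<noteq> 0" for j by (rule cell_sin_nonzero[OF a cell k(1,2)])
    show "\<alpha> \<le> band_fun a k" using band band_fun_cell_mono[OF a cell order_refl k(1,2)] by simp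
  qed
  ultimately show False using gap by (auto simp: spectral_gap_def)
qed

lemma spectral_gap_above:
  fixes a :: "'d::finite \<Rightarrow> real"
  assumes a: "\<And>j. a j > 0" and \<alpha>: "\<alpha> > 0" and k0: "0 < k0" and band: "band_fun a k0 < \<alpha>"
    and S: "k0\<^sup>2 \<in> lattice_spectrum a \<alpha>"
  shows "\<exists>E2. spectral_gap (lattice_spectrum a \<alpha>) (k0\<^sup>2) E2"
proof -
  obtain m hi l where cell: "dirichlet_cell a m k0 hi" and l: "hi * a l = (of_int (m l) + 1) * pi"
    using next_dirichlet_cell[where a = a, OF a less_imp_le[OF k0]] by blast
  have "k0 < hi" using cell by (simp add: dirichlet_cell_def)
  then obtain k2 where k2: "k0 < k2" "k2 < hi" "\<alpha> < band_fun a k2"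
    using band_fun_cell_unbounded[OF a cell l] by blast
  have "\<exists>k\<ge>k0. k \<le> k2 \<and> band_fun a k = \<alpha>"
    by (rule IVT'[OF _ _ _ continuous_on_band_fun_cell[OF a cell order_refl k2(2)]])
      (use band k2 in \<open>simp_all add: less_imp_le\<close>)
  then obtain k where k: "k0 \<le> k" "k \<le> k2" "band_fun a k = \<alpha>" by blast
  have "k \<noteq> k0" using k(3) band by blast
  then have k': "k0 < k" "k < hi" "0 < k" using k(1,2) k2(2) k0 by linarith+
  have "spectral_gap (lattice_spectrum a \<alpha>) (k0\<^sup>2) (k\<^sup>2)"
    unfolding spectral_gap_def
  proof (intro conjI S)
    show "k0\<^sup>2 < k\<^sup>2" using k' k0 by (intro power_strict_mono) auto
    show "k\<^sup>2 \<in> lattice_spectrum a \<alpha>"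
      using k(3) by (intro approx_eigenvalue_imp_spectrum band_energy[where a = a, OF a \<alpha> k'(3)]
          cell_sin_nonzero[OF a cell k'(1,2)]) simp
    have "E \<notin> lattice_spectrum a \<alpha>" if E: "k0\<^sup>2 < E" "E < k\<^sup>2" for E
    proof -
      have E0: "0 < E" using E zero_le_power2[of k0] by linarith
      have b: "k0 < sqrt E" "sqrt E < k" using E k0 k' by (auto intro: real_less_rsqrt real_less_lsqrt)
      have "(sqrt E)\<^sup>2 \<notin> lattice_spectrum a \<alpha>"
      proof (rule band_gap_energy[where a = a, OF a])
        show "0 < sqrt E" using E0 by simp
        show "sin (sqrt E * a j) \<noteq> 0" for j using b k' by (intro cell_sin_nonzero[OF a cell]) auto
        show "band_fun a (sqrt E) < \<alpha>"
          using band_fun_cell_mono[OF a cell _ b(2) k'(2)] b k(3) by simp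
      qed
      then show ?thesis using E0 by simp
    qed
    then show "{k0\<^sup>2<..<k\<^sup>2} \<inter> lattice_spectrum a \<alpha> = {}" by auto
  qed
  then show ?thesis by blast
qed

theorem theorem3p3:
  fixes a :: "'d::finite \<Rightarrow> real" and \<alpha> :: real
  assumes "\<And>j. a j > 0" and "\<alpha> > 0"
  shows "(\<forall>E1 E2. spectral_gap (lattice_spectrum a \<alpha>) E1 E2 \<longrightarrow>
            (\<exists>j. \<exists>m::nat. m \<ge> 1 \<and> E1 = (real m * pi / a j)\<^sup>2))
       \<and> (\<forall>l. \<forall>m::nat. m \<ge> 1 \<longrightarrow>
            ((\<exists>E2. spectral_gap (lattice_spectrum a \<alpha>) ((real m * pi / a l)\<^sup>2) E2) \<longleftrightarrow>
             (2 * real m * pi / a l) *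
               (\<Sum>j\<in>UNIV. tan (pi / 2 * (real m * a j / a l - of_int \<lfloor>real m * a j / a l\<rfloor>)))
               < \<alpha>))"
proof (intro conjI allI impI)
  fix E1 E2 assume gap: "spectral_gap (lattice_spectrum a \<alpha>) E1 E2"
  then have S: "E1 \<in> lattice_spectrum a \<alpha>" by (simp add: spectral_gap_def)
  then have E1: "0 < E1" using nonpositive_energy[where a = a and E = E1, OF assms] by linarith
  define k where "k = sqrt E1"
  have k: "0 < k" "E1 = k\<^sup>2" using E1 by (auto simp: k_def)
  have "\<exists>j. sin (k * a j) = 0"
  proof (rule ccontr)
    assume "\<nexists>j. sin (k * a j) = 0"
    then have nz: "\<And>j. sin (k * a j) \<noteq> 0" by blast
    have "\<alpha> \<le> band_fun a k"
      using band_gap_energy[where a = a and \<alpha> = \<alpha>, OF assms(1) k(1) nz] S k(2) by (simp add: not_less[symmetric]) blast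
    from no_spectral_gap_above[where a = a, OF assms k(1) this] show False using gap k(2) by simp
  qed
  then obtain j i where i: "k * a j = of_int i * pi" by (auto simp: sin_zero_iff_int2)
  have "0 < of_int i * pi" using k(1) assms(1)[of j] by (simp flip: i)
  then have "i > 0" by (simp add: zero_less_mult_iff)
  moreover have "k = real (nat i) * pi / a j"
    using i \<open>i > 0\<close> assms(1)[of j] by (simp add: field_simps)
  ultimately show "\<exists>j. \<exists>m::nat. m \<ge> 1 \<and> E1 = (real m * pi / a j)\<^sup>2"
    unfolding k(2) by (intro exI[of _ j] exI[of _ "nat i"]) auto
next
  fix l and m :: nat assume m: "m \<ge> 1"
  define k where "k = real m * pi / a l"
  have k: "0 < k" using m assms(1)[of l] by (simp add: k_def)
  have "k * a l = of_int (int m) * pi" using assms(1)[of l] by (simp add: k_def)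
  then have "sin (k * a l) = 0" unfolding sin_zero_iff_int2 by blast
  then have S: "k\<^sup>2 \<in> lattice_spectrum a \<alpha>" by (rule dirichlet_energy_in_spectrum[where a = a, OF assms k])
  have "k * a j / pi = real m * a j / a l" for j by (simp add: k_def)
  then have "band_fun a k = (2 * real m * pi / a l) *
      (\<Sum>j\<in>UNIV. tan (pi / 2 * (real m * a j / a l - of_int \<lfloor>real m * a j / a l\<rfloor>)))"
    by (simp add: band_fun_def k_def)
  moreover have "(\<exists>E2. spectral_gap (lattice_spectrum a \<alpha>) (k\<^sup>2) E2) \<longleftrightarrow> band_fun a k < \<alpha>"
    using no_spectral_gap_above[where a = a, OF assms k] spectral_gap_above[where a = a, OF assms k _ S]
    by (meson not_less)
  ultimately show "(\<exists>E2. spectral_gap (lattice_spectrum a \<alpha>) ((real m * pi / a l)\<^sup>2) E2) \<longleftrightarrow>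
     (2 * real m * pi / a l) *
       (\<Sum>j\<in>UNIV. tan (pi / 2 * (real m * a j / a l - of_int \<lfloor>real m * a j / a l\<rfloor>))) < \<alpha>"
    by (simp add: k_def)
qed

end
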